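(* Let $F_1$ be the graph with vertex set $\{1,2,3,4,5\}$ and edge set $\{12,23,24,25,34,35,45\}$ (a complete graph on $\{2,3,4,5\}$ with a pendant vertex $1$ attached to $2$). The problem $F_1$-Induced Minor is solvable in polynomial time.
   Context: All graphs are finite and simple. A graph $G$ contains $H$ as an induced minor if $H$ can be obtained from $G$ by vertex deletions and edge contractions. The problem $H$-Induced Minor takes a graph $G$ as input and asks whether $G$ contains $H$ as an induced minor. *)

theory Defs
  imports Main "HOL-Computational_Algebra.Polynomial"
begin

section \<open>Finite simple graphs and induced minors\<close>

type_synonym 'a ugraph = "'a set \<times> 'a set set"

abbreviation verts :: "'a ugraph \<Rightarrow> 'a set" where
  "verts G \<equiv> fst G"

abbreviation edges :: "'a ugraph \<Rightarrow> 'a set set" where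
  "edges G \<equiv> snd G"

definition simple_graph :: "'a ugraph \<Rightarrow> bool" where
  "simple_graph G \<longleftrightarrow> finite (verts G) \<and> (\<forall>e\<in>edges G. e \<subseteq> verts G \<and> card e = 2)"

definition delete_vertex :: "'a \<Rightarrow> 'a ugraph \<Rightarrow> 'a ugraph" where
  "delete_vertex v G = (verts G - {v}, {e \<in> edges G. v \<notin> e})"

text \<open>The vertex resulting from the contraction of \<open>uv\<close> is again called \<open>u\<close>. Parallel edges are
  merged because edges are sets, and no loop arises because the edge \<open>uv\<close> itself is removed.\<close>

definition contract_edge :: "'a \<Rightarrow> 'a \<Rightarrow> 'a ugraph \<Rightarrow> 'a ugraph" where
  "contract_edge u v G =
     (verts G - {v}, (\<lambda>e. (\<lambda>x. if x = v then u else x) ` e) ` (edges G - {{u, v}}))"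

inductive minor_step :: "'a ugraph \<Rightarrow> 'a ugraph \<Rightarrow> bool" where
  delete: "v \<in> verts G \<Longrightarrow> minor_step G (delete_vertex v G)"
| contract: "{u, v} \<in> edges G \<Longrightarrow> u \<noteq> v \<Longrightarrow> minor_step G (contract_edge u v G)"

definition graph_iso :: "'a ugraph \<Rightarrow> 'b ugraph \<Rightarrow> bool" where
  "graph_iso G H \<longleftrightarrow>
     (\<exists>f. bij_betw f (verts G) (verts H) \<and> edges H = (\<lambda>e. f ` e) ` edges G)"

definition contains_induced_minor :: "'a ugraph \<Rightarrow> 'b ugraph \<Rightarrow> bool" where
  "contains_induced_minor G H \<longleftrightarrow> (\<exists>G'. minor_step\<^sup>*\<^sup>* G G' \<and> graph_iso G' H)"

lemma simple_graph_delete_vertex: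
  "simple_graph G \<Longrightarrow> simple_graph (delete_vertex v G)"
  unfolding simple_graph_def delete_vertex_def by auto

lemma simple_graph_contract_edge:
  assumes G: "simple_graph G" and uv: "{u, v} \<in> edges G" "u \<noteq> v"
  shows "simple_graph (contract_edge u v G)"
proof -
  define f where "f = (\<lambda>x. if x = v then u else x)"
  have u: "u \<in> verts G" using G uv(1) unfolding simple_graph_def by blast
  have "f ` e \<subseteq> verts G - {v} \<and> card (f ` e) = 2"
    if e: "e \<in> edges G" "e \<noteq> {u, v}" for e
  proof -
    have ce: "card e = 2" "e \<subseteq> verts G" using G e(1) unfolding simple_graph_def by blast+
    obtain a b where ab: "e = {a, b}" "a \<noteq> b" using ce(1) unfolding card_2_iff by blast
    have "f a \<noteq> f b" using ab e(2) unfolding f_def by (auto split: if_splits)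
    moreover have "f a \<in> verts G - {v}" "f b \<in> verts G - {v}"
      using ab ce(2) u uv(2) unfolding f_def by (simp_all split: if_split)
    ultimately show ?thesis by (simp add: ab(1))
  qed
  moreover have "finite (verts G - {v})" using G by (simp add: simple_graph_def)
  ultimately show ?thesis
    unfolding simple_graph_def contract_edge_def f_def[symmetric] by simp
qed

lemma simple_graph_minor_step:
  "minor_step G G' \<Longrightarrow> simple_graph G \<Longrightarrow> simple_graph G'"
  by (erule minor_step.cases)
     (simp_all add: simple_graph_delete_vertex simple_graph_contract_edge)

lemma simple_graph_minor_steps:
  "minor_step\<^sup>*\<^sup>* G G' \<Longrightarrow> simple_graph G \<Longrightarrow> simple_graph G'"
  by (induction rule: rtranclp_induct) (simp_all add: simple_graph_minor_step)

section \<open>Polynomial time\<close>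

text \<open>Deterministic Turing machines with a fixed number of tapes. The tapes are infinite to the
  right only, and a head at cell 0 that is told to move left stays where it is. States and
  symbols are natural numbers below given bounds, hence finitely many; symbol 0 is the blank.\<close>

datatype direction = Go_Left | Stay | Go_Right

type_synonym tape = "(nat \<Rightarrow> nat) \<times> nat"

type_synonym config = "nat \<times> tape list"

record tm =
  num_tapes :: nat
  num_syms :: nat
  num_states :: nat
  start_state :: nat
  accept_state :: nat
  reject_state :: nat
  delta :: "nat \<Rightarrow> nat list \<Rightarrow> nat \<times> (nat \<times> direction) list"

definition wf_tm :: "tm \<Rightarrow> bool" where
  "wf_tm M \<longleftrightarrow>
     num_tapes M \<ge> 1 \<and> num_syms M \<ge> 3 \<and>
     start_state M < num_states M \<and> accept_state M < num_states M \<and>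
     reject_state M < num_states M \<and> accept_state M \<noteq> reject_state M \<and>
     (\<forall>q < num_states M. \<forall>rs. length rs = num_tapes M \<and> set rs \<subseteq> {..<num_syms M} \<longrightarrow>
        fst (delta M q rs) < num_states M \<and>
        length (snd (delta M q rs)) = num_tapes M \<and>
        fst ` set (snd (delta M q rs)) \<subseteq> {..<num_syms M})"

fun move_head :: "direction \<Rightarrow> nat \<Rightarrow> nat" where
  "move_head Go_Left h = h - 1"
| "move_head Stay h = h"
| "move_head Go_Right h = h + 1"

fun read_tape :: "tape \<Rightarrow> nat" where
  "read_tape (t, h) = t h"

fun act_tape :: "nat \<times> direction \<Rightarrow> tape \<Rightarrow> tape" where
  "act_tape (s, d) (t, h) = (t(h := s), move_head d h)"

fun tm_step :: "tm \<Rightarrow> config \<Rightarrow> config" where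
  "tm_step M (q, ts) =
     (if q = accept_state M \<or> q = reject_state M then (q, ts)
      else let (q', as) = delta M q (map read_tape ts) in (q', map2 act_tape as ts))"

fun bit_sym :: "bool \<Rightarrow> nat" where
  "bit_sym False = 1"
| "bit_sym True = 2"

definition input_tape :: "bool list \<Rightarrow> tape" where
  "input_tape w = ((\<lambda>i. if i < length w then bit_sym (w ! i) else 0), 0)"

definition init_config :: "tm \<Rightarrow> bool list \<Rightarrow> config" where
  "init_config M w =
     (start_state M, input_tape w # replicate (num_tapes M - 1) ((\<lambda>_. 0), 0))"

definition decides_in_time :: "tm \<Rightarrow> bool list set \<Rightarrow> (nat \<Rightarrow> nat) \<Rightarrow> bool" where
  "decides_in_time M L T \<longleftrightarrow>
     (\<forall>w. \<exists>t \<le> T (length w).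
        fst ((tm_step M ^^ t) (init_config M w)) =
          (if w \<in> L then accept_state M else reject_state M))"

definition polynomial_time_solvable :: "bool list set \<Rightarrow> bool" where
  "polynomial_time_solvable L \<longleftrightarrow>
     (\<exists>M (p :: nat poly). wf_tm M \<and> decides_in_time M L (poly p))"

section \<open>The problem \<open>H\<close>-Induced Minor\<close>

text \<open>Input graphs have vertex set \<open>{0..<n}\<close> and are presented as \<open>n\<close> in unary, terminated by a
  zero bit, followed by the rows of the adjacency matrix. Strings that do not encode a graph are
  no-instances.\<close>

definition encode_graph :: "nat ugraph \<Rightarrow> bool list" where
  "encode_graph G =
     (let n = card (verts G) in
        replicate n True @ [False] @
        concat (map (\<lambda>i. map (\<lambda>j. {i, j} \<in> edges G) [0..<n]) [0..<n]))"

lemma replicate_True_append_False_inject: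
  "replicate m True @ False # xs = replicate n True @ False # ys \<Longrightarrow> m = n \<and> xs = ys"
proof (induction m arbitrary: n)
  case 0
  then show ?case by (cases n) simp_all
next
  case (Suc m)
  then show ?case by (cases n) simp_all
qed

lemma encode_graph_inject:
  assumes G: "simple_graph G" "verts G = {0..<n}"
    and H: "simple_graph H" "verts H = {0..<m}"
    and eq: "encode_graph G = encode_graph H"
  shows "G = H"
proof -
  let ?rows = "\<lambda>K. map (\<lambda>i. map (\<lambda>j. {i, j} \<in> edges K) [0..<n]) [0..<n]"
  have nm: "n = m"
    using eq G(2) H(2) unfolding encode_graph_def Let_def
    by (auto dest: replicate_True_append_False_inject)
  have "concat (?rows G) = concat (?rows H)"
    using eq G(2) H(2) nm unfolding encode_graph_def Let_def by simp
  then have "?rows G = ?rows H"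
    by (rule concat_injective) (simp_all add: set_zip, auto)
  then have *: "({i, j} \<in> edges G) = ({i, j} \<in> edges H)" if "i < n" "j < n" for i j
    using that by (simp add: list_eq_iff_nth_eq)
  have "(e \<in> edges G) = (e \<in> edges H)" for e
  proof (cases "\<exists>i j. e = {i, j} \<and> i < n \<and> j < n")
    case True
    then show ?thesis using * by blast
  next
    case False
    have "\<not> (e \<subseteq> {0..<n} \<and> card e = 2)"
    proof
      assume e: "e \<subseteq> {0..<n} \<and> card e = 2"
      then obtain i j where "e = {i, j}" unfolding card_2_iff by blast
      moreover from this have "i < n" "j < n" using e by simp_all
      ultimately show False using False by blast
    qed
    then show ?thesis
      using G H nm unfolding simple_graph_def by blast
  qed
  then show ?thesis using G(2) H(2) nm by (simp add: prod_eq_iff set_eq_iff)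
qed

definition induced_minor_problem :: "'a ugraph \<Rightarrow> bool list set" where
  "induced_minor_problem H =
     {encode_graph G |G. simple_graph G \<and> (\<exists>n. verts G = {0..<n}) \<and> contains_induced_minor G H}"

definition F1 :: "nat ugraph" where
  "F1 = ({1, 2, 3, 4, 5}, {{1, 2}, {2, 3}, {2, 4}, {2, 5}, {3, 4}, {3, 5}, {4, 5}})"

lemma simple_graph_F1: "simple_graph F1"
  by (simp add: simple_graph_def F1_def)

end

(*
  A model of F1 consists of a vertex p and a K4 model with bags A, B, C, D in which p has neighbours
  only in A. A model with |A| minimal can be chosen, or rerouted, so that the neighbours of p in A lie
  in a connected subset A0 of at most 6 vertices. Guessing p and A0, deleting the other neighbours
  of p and contracting A0 to a vertex r, it remains to decide whether the component of r has a K4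
  minor, and this holds if and only if it contains four vertices no two of which can be separated by
  two other vertices. The resulting criterion is a first-order formula with reachability over the
  input graph, and such formulas are evaluated in polynomial time by a Turing machine whose work tapes
  serve as counters and bit arrays.
*)
theory Submission imports Defs begin

section \<open>Walks, cuts and connected vertex sets\<close>

section \<open>Connected sets\<close>

text \<open>The obstacle is that \<open>p\<close> must stay away from three bags but may have
  arbitrarily many neighbours in \<open>A\<close>, too many to guess. With a bounded
  \<open>A0\<close> the other neighbours of \<open>p\<close> can be deleted, because
  \<open>B\<close>, \<open>C\<close>, \<open>D\<close> contain none and \<open>A\<close> has none
  outside \<open>A0\<close>. In a counterexample with the smallest \<open>A\<close>, every non-cut
  vertex of \<open>A\<close> is the only contact of \<open>A\<close> with some bag. Three such
  vertices would allow a rerouting through \<open>p\<close>, so there are only two, and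
  \<open>A\<close> is an induced path. Rerouting along this path changes the pendant vertex and
  gives a smaller \<open>A\<close> or a bounded attachment. The constant 6 makes the path long
  enough for its vertex number 3 to be non-adjacent to the last but one. After the contraction any
  K4 minor in the component of \<open>r\<close> is enough: its bags can be grown until they cover
  the component, so one of them contains \<open>r\<close>, and K4 is symmetric. Bags are unbounded
  sets and cannot be quantified over in a first-order formula; four pairwise inseparable vertices
  can.\<close>

definition reach :: "('a \<Rightarrow> 'a \<Rightarrow> bool) \<Rightarrow> 'a set \<Rightarrow> 'a \<Rightarrow> 'a \<Rightarrow> bool" where
  "reach E U = (\<lambda>u v. u \<in> U \<and> v \<in> U \<and> E u v)\<^sup>*\<^sup>*"

definition conn :: "('a \<Rightarrow> 'a \<Rightarrow> bool) \<Rightarrow> 'a set \<Rightarrow> bool" where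
  "conn E A \<longleftrightarrow> A \<noteq> {} \<and> (\<forall>x\<in>A. \<forall>y\<in>A. reach E A x y)"

definition touch :: "('a \<Rightarrow> 'a \<Rightarrow> bool) \<Rightarrow> 'a set \<Rightarrow> 'a set \<Rightarrow> bool" where
  "touch E A B \<longleftrightarrow> (\<exists>a\<in>A. \<exists>b\<in>B. E a b)"

text \<open>This holds even for a vertex outside \<open>U\<close>; where that matters, membership in
  \<open>U\<close> is demanded separately, as in \<open>conn_component\<close>.\<close>

lemma reach_refl [simp]: "reach E U x x"
  by (simp add: reach_def)

lemma reach_trans: "reach E U x y \<Longrightarrow> reach E U y z \<Longrightarrow> reach E U x z"
  by (simp add: reach_def)

lemma reach_step: "u \<in> U \<Longrightarrow> v \<in> U \<Longrightarrow> E u v \<Longrightarrow> reach E U u v"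
  by (auto simp: reach_def)

text \<open>Steps may be collapsed as well as mapped to steps, so that walks can be carried along
  contractions.\<close>

lemma reach_map:
  assumes "reach E U a b"
    and "\<And>u v. u \<in> U \<Longrightarrow> v \<in> U \<Longrightarrow> E u v \<Longrightarrow> g u = g v \<or> (g u \<in> U' \<and> g v \<in> U' \<and> E' (g u) (g v))"
  shows "reach E' U' (g a) (g b)"
  using assms(1) unfolding reach_def
proof (induction rule: rtranclp_induct)
  case (step y z)
  then consider "g y = g z" | "g y \<in> U' \<and> g z \<in> U' \<and> E' (g y) (g z)" using assms(2)[of y z] by blast
  then show ?case using step.IH by cases (auto intro: rtranclp.rtrancl_into_rtrancl)
qed simp

lemma reach_mono: "reach E U x y \<Longrightarrow> U \<subseteq> U' \<Longrightarrow> reach E U' x y"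
  using reach_map[of E U x y "\<lambda>x. x" U' E] by auto

lemma reach_exit:
  assumes "reach E U a b" "a \<in> P" "b \<notin> P"
  shows "\<exists>u v. u \<in> P \<and> v \<notin> P \<and> u \<in> U \<and> v \<in> U \<and> E u v"
  using assms(1,3) unfolding reach_def
proof (induction rule: rtranclp_induct)
  case (step y z)
  then show ?case by (cases "y \<in> P") auto
qed (use assms in simp)

lemma conn_crossing:
  assumes "conn E A" "P \<subseteq> A" "P \<noteq> {}" "P \<noteq> A"
  shows "\<exists>u\<in>P. \<exists>w\<in>A - P. E u w"
proof -
  obtain a b where "a \<in> P" "b \<in> A - P" using assms by auto
  then show ?thesis using reach_exit[of E A a b P] assms unfolding conn_def by blast
qed

text \<open>The vertices reachable from \<open>x\<close> would otherwise form a proper part without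
  an edge leaving it. Together with \<open>conn_crossing\<close> this turns connectedness into a
  condition on cuts, which behaves well under unions, images and preimages.\<close>

lemma connI_crossing:
  assumes "A \<noteq> {}" "\<And>P. P \<subseteq> A \<Longrightarrow> P \<noteq> {} \<Longrightarrow> P \<noteq> A \<Longrightarrow> \<exists>u\<in>P. \<exists>w\<in>A - P. E u w"
  shows "conn E A"
  unfolding conn_def
proof (intro conjI ballI)
  fix x y assume x: "x \<in> A" and y: "y \<in> A"
  define P where "P = {z\<in>A. reach E A x z}"
  have "P = A"
  proof (rule ccontr)
    assume "P \<noteq> A"
    moreover have "P \<subseteq> A" "P \<noteq> {}" using x by (auto simp: P_def)
    ultimately obtain u w where "u \<in> P" "w \<in> A - P" "E u w" using assms(2)[of P] by blast
    then show False unfolding P_def by (auto intro: reach_trans reach_step)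
  qed
  then show "reach E A x y" using y by (auto simp: P_def)
qed (rule assms)

lemma conn_singleton [simp]: "conn E {x}"
  by (simp add: conn_def)

lemma conn_nonempty: "conn E A \<Longrightarrow> A \<noteq> {}"
  by (simp add: conn_def)

lemma touch_mono: "touch E A B \<Longrightarrow> A \<subseteq> A' \<Longrightarrow> B \<subseteq> B' \<Longrightarrow> touch E A' B'"
  unfolding touch_def by blast

lemma touch_Un1 [simp]: "touch E (A \<union> A') B \<longleftrightarrow> touch E A B \<or> touch E A' B"
  unfolding touch_def by blast

lemma touch_Un2 [simp]: "touch E A (B \<union> B') \<longleftrightarrow> touch E A B \<or> touch E A B'"
  unfolding touch_def by blast

lemma touch_insert1: "touch E (insert v A) B \<longleftrightarrow> touch E {v} B \<or> touch E A B"
  unfolding touch_def by blast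

lemma touch_insert2: "touch E A (insert v B) \<longleftrightarrow> touch E A {v} \<or> touch E A B"
  unfolding touch_def by blast

lemma touch_singleton [simp]: "touch E {u} {v} \<longleftrightarrow> E u v"
  unfolding touch_def by blast

lemma touchI: "E a b \<Longrightarrow> a \<in> A \<Longrightarrow> b \<in> B \<Longrightarrow> touch E A B"
  unfolding touch_def by blast

section \<open>Components and non-cut vertices of undirected graphs\<close>

locale sym_graph =
  fixes E :: "'a \<Rightarrow> 'a \<Rightarrow> bool"
  assumes E_sym: "E x y \<Longrightarrow> E y x"
begin

lemma touch_sym: "touch E A B \<longleftrightarrow> touch E B A"
  unfolding touch_def using E_sym by blast

lemma reach_sym: "reach E U x y \<Longrightarrow> reach E U y x"
  unfolding reach_def
proof (induction rule: rtranclp_induct)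
  case (step y z)
  then have "z \<in> U \<and> y \<in> U \<and> E z y" using E_sym by blast
  with step.IH show ?case by (rule converse_rtranclp_into_rtranclp[rotated])
qed simp

lemma conn_Un:
  assumes "conn E A" "conn E B" "touch E A B \<or> A \<inter> B \<noteq> {}"
  shows "conn E (A \<union> B)"
proof (rule connI_crossing)
  fix P assume P: "P \<subseteq> A \<union> B" "P \<noteq> {}" "P \<noteq> A \<union> B"
  show "\<exists>u\<in>P. \<exists>w\<in>A \<union> B - P. E u w"
  proof (cases "P \<inter> A = {} \<or> A \<subseteq> P")
    case False
    then show ?thesis using conn_crossing[OF assms(1), of "P \<inter> A"] by blast
  next
    case A: True
    show ?thesis
    proof (cases "P \<inter> B = {} \<or> B \<subseteq> P")
      case False
      then show ?thesis using conn_crossing[OF assms(2), of "P \<inter> B"] by blast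
    next
      case True
      obtain a b where ab: "a \<in> A" "b \<in> B" "E a b \<or> a = b"
        using assms(3) unfolding touch_def by blast
      consider "A \<subseteq> P" "B \<inter> P = {}" | "B \<subseteq> P" "A \<inter> P = {}"
        using A True P by blast
      then show ?thesis
      proof cases
        case 1
        then show ?thesis using ab by blast
      next
        case 2
        then show ?thesis using ab E_sym[of a b] by blast
      qed
    qed
  qed
qed (use assms conn_nonempty in blast)

lemma conn_insert: "conn E A \<Longrightarrow> touch E A {v} \<Longrightarrow> conn E (insert v A)"
  using conn_Un[of A "{v}"] by simp

lemma conn_component:
  assumes "x \<in> U"
  shows "conn E {y \<in> U. reach E U x y}" (is "conn E ?C")
proof (rule connI_crossing)
  show "?C \<noteq> {}" using assms by auto
  fix P assume P: "P \<subseteq> ?C" "P \<noteq> {}" "P \<noteq> ?C"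
  then obtain a b where ab: "a \<in> P" "b \<in> ?C" "b \<notin> P" by auto
  have "reach E U x a" "reach E U x b" using ab P by auto
  then have "reach E U a b" using reach_trans reach_sym by metis
  then obtain u v where uv: "u \<in> P" "v \<notin> P" "u \<in> U" "v \<in> U" "E u v" 
    using reach_exit[of E U a b P] ab by blast
  then have "reach E U x u" using P by auto
  then have "reach E U x v" using uv reach_trans reach_step by metis
  then show "\<exists>u\<in>P. \<exists>w\<in>?C - P. E u w" using uv by blast
qed

text \<open>The connected set \<open>P\<close> is grown inside \<open>A\<close> one vertex at a
  time; the vertex added last is the one that can be removed.\<close>

lemma noncut_outside:
  assumes "conn E A" "finite A" "conn E P" "P \<subset> A"
  shows "\<exists>w\<in>A - P. conn E (A - {w})"
  using assms(3,4)
proof (induction "card (A - P)" arbitrary: P rule: less_induct)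
  case less
  obtain u w where uw: "u \<in> P" "w \<in> A - P" "E u w"
    using conn_crossing[OF assms(1)] less.prems conn_nonempty by (metis psubsetE)
  have c: "conn E (insert w P)" using conn_insert less.prems(1) uw by (auto simp: touch_def)
  show ?case
  proof (cases "insert w P = A")
    case True
    then have "A - {w} = P" using uw by blast
    then show ?thesis using uw less.prems by metis
  next
    case False
    have "card (A - insert w P) < card (A - P)"
      using uw assms(2) by (intro psubset_card_mono) auto
    then show ?thesis using less.hyps[of "insert w P"] c False uw less.prems by blast
  qed
qed

lemma noncut_other:
  assumes "conn E A" "finite A" "x \<in> A" "A \<noteq> {x}"
  obtains w where "w \<in> A" "w \<noteq> x" "conn E (A - {w})"
  using noncut_outside[of A "{x}"] assms by auto

lemma two_noncuts:
  assumes "conn E A" "finite A" "card A \<ge> 2"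
  obtains u w where "u \<in> A" "w \<in> A" "u \<noteq> w" "conn E (A - {u})" "conn E (A - {w})"
proof -
  have ne: "A \<noteq> {x}" for x using assms(3) by auto
  obtain x where "x \<in> A" using assms conn_nonempty by blast
  then obtain u where u: "u \<in> A" "conn E (A - {u})" using noncut_other[OF assms(1,2) _ ne] by metis
  then obtain w where "w \<in> A" "w \<noteq> u" "conn E (A - {w})" using noncut_other[OF assms(1,2) _ ne] by metis
  then show thesis using that u by metis
qed

lemma noncut_touch:
  assumes "conn E A" "v \<in> A" "A \<noteq> {v}"
  shows "touch E {v} (A - {v})"
  using conn_crossing[OF assms(1), of "{v}"] assms by (auto simp: touch_def)

end

text \<open>The quotient of the graph on \<open>U\<close> by the fibres of \<open>f\<close>. A fibre
  that contains an edge produces a loop, so adjacency in quotients and in simple graphs is compared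
  for distinct vertices only.\<close>

definition contr :: "('a \<Rightarrow> 'b) \<Rightarrow> 'a set \<Rightarrow> ('a \<Rightarrow> 'a \<Rightarrow> bool) \<Rightarrow> 'b \<Rightarrow> 'b \<Rightarrow> bool" where
  "contr f U E a b \<longleftrightarrow> (\<exists>x\<in>U. \<exists>y\<in>U. f x = a \<and> f y = b \<and> E x y)"

lemma contr_sym_graph: "sym_graph E \<Longrightarrow> sym_graph (contr f U E)"
  unfolding sym_graph_def contr_def by blast

lemma touch_contr: "touch (contr f U E) A B \<longleftrightarrow> touch E (U \<inter> f -` A) (U \<inter> f -` B)"
  unfolding touch_def contr_def by blast

lemma conn_push:
  assumes "conn E A" "A \<subseteq> U"
  shows "conn (contr f U E) (f ` A)"
proof (rule connI_crossing)
  fix P assume P: "P \<subseteq> f ` A" "P \<noteq> {}" "P \<noteq> f ` A"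
  then have "A \<inter> f -` P \<subseteq> A" "A \<inter> f -` P \<noteq> {}" "A \<inter> f -` P \<noteq> A" by auto
  from conn_crossing[OF assms(1) this]
  show "\<exists>u\<in>P. \<exists>w\<in>f ` A - P. contr f U E u w" using assms(2) unfolding contr_def by blast
qed (use assms conn_nonempty in blast)

text \<open>If a cut \<open>P\<close> splits a fibre, the connected fibre supplies the crossing
  edge; otherwise \<open>P\<close> is a union of fibres and its image is a cut of the connected
  quotient set.\<close>

lemma conn_pull:
  assumes "sym_graph E" "conn (contr f U E) A" "\<And>a. a \<in> A \<Longrightarrow> conn E (U \<inter> f -` {a})"
  shows "conn E (U \<inter> f -` A)"
proof (rule connI_crossing)
  obtain a where "a \<in> A" using conn_nonempty[OF assms(2)] by blast
  then show "U \<inter> f -` A \<noteq> {}" using conn_nonempty[OF assms(3)] by blast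
  fix P assume P: "P \<subseteq> U \<inter> f -` A" "P \<noteq> {}" "P \<noteq> U \<inter> f -` A"
  show "\<exists>u\<in>P. \<exists>w\<in>U \<inter> f -` A - P. E u w"
  proof (cases "\<exists>x\<in>P. \<exists>y\<in>U - P. f x = f y")
    case True
    then obtain x y where xy: "x \<in> P" "y \<in> U - P" "f x = f y" by blast
    then have "f x \<in> A" using P by blast
    then have "conn E (U \<inter> f -` {f x})" using assms(3) by blast
    from conn_crossing[OF this, of "P \<inter> f -` {f x}"] xy P
    obtain u w where "u \<in> P \<inter> f -` {f x}" "w \<in> U \<inter> f -` {f x} - P \<inter> f -` {f x}" "E u w" by auto
    then show ?thesis using \<open>f x \<in> A\<close> by auto
  next
    case False
    have "f ` P \<subseteq> A" "f ` P \<noteq> {}" "f ` P \<noteq> A"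
    proof -
      show "f ` P \<noteq> A"
      proof
        assume *: "f ` P = A"
        have "U \<inter> f -` A \<subseteq> P"
        proof
          fix y assume y: "y \<in> U \<inter> f -` A"
          then obtain x where "x \<in> P" "f x = f y" using * by (metis IntD2 imageE vimageE)
          then show "y \<in> P" using False y by blast
        qed
        then show False using P by blast
      qed
    qed (use P in auto)
    then obtain a b where "a \<in> f ` P" "b \<in> A - f ` P" "contr f U E a b"
      using conn_crossing[OF assms(2)] by metis
    then obtain x y where xy: "x \<in> U" "y \<in> U" "f x = a" "f y = b" "E x y" unfolding contr_def by blast
    obtain x' where "x' \<in> P" "f x' = a" using \<open>a \<in> f ` P\<close> by blast
    then have "x \<in> P" using False xy by (metis DiffI)
    then show ?thesis using xy \<open>b \<in> A - f ` P\<close> by blast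
  qed
qed

section \<open>Models of F1 with bounded attachment\<close>

definition tri :: "('a \<Rightarrow> 'a \<Rightarrow> bool) \<Rightarrow> 'a set \<Rightarrow> 'a set \<Rightarrow> 'a set \<Rightarrow> bool" where
  "tri E B C D \<longleftrightarrow> conn E B \<and> conn E C \<and> conn E D \<and> B \<inter> C = {} \<and> B \<inter> D = {} \<and> C \<inter> D = {} \<and>
     touch E B C \<and> touch E B D \<and> touch E C D"

text \<open>\<open>A\<close> is singled out among the four bags because it is the one to which the
  pendant vertex will be attached.\<close>

definition k4 :: "('a \<Rightarrow> 'a \<Rightarrow> bool) \<Rightarrow> 'a set \<Rightarrow> 'a set \<Rightarrow> 'a set \<Rightarrow> 'a set \<Rightarrow> bool" where
  "k4 E A B C D \<longleftrightarrow> conn E A \<and> tri E B C D \<and> A \<inter> (B \<union> C \<union> D) = {} \<and>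
     touch E A B \<and> touch E A C \<and> touch E A D"

context sym_graph
begin

lemma tri_perm: "tri E B C D \<Longrightarrow> tri E C B D" "tri E B C D \<Longrightarrow> tri E B D C"
  unfolding tri_def using touch_sym by blast+

lemma k4_perm: "k4 E A B C D \<Longrightarrow> k4 E A C B D" "k4 E A B C D \<Longrightarrow> k4 E A B D C"
    "k4 E A B C D \<Longrightarrow> k4 E B A C D"
  unfolding k4_def tri_def using touch_sym by blast+

lemma conn_segment:
  assumes "a \<le> b" "\<And>i. a \<le> i \<Longrightarrow> i < b \<Longrightarrow> E (f i) (f (Suc i))"
  shows "conn E (f ` {a..b})"
  using assms
proof (induction b rule: dec_induct)
  case (step n)
  have "touch E (f ` {a..n}) {f (Suc n)}"
    using step by (intro touchI[of _ "f n"]) auto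
  then have "conn E (insert (f (Suc n)) (f ` {a..n}))" using step by (intro conn_insert) auto
  moreover have "{a..Suc n} = insert (Suc n) {a..n}" using step by auto
  ultimately show ?case by simp
qed simp

lemma reach_walk:
  assumes "reach E A u w" "u \<in> A"
  shows "\<exists>f l. f 0 = u \<and> f l = w \<and> f ` {..l} \<subseteq> A \<and> (\<forall>i<l. E (f i) (f (Suc i)))"
proof -
  obtain l where "((\<lambda>u v. u \<in> A \<and> v \<in> A \<and> E u v) ^^ l) u w"
    using assms(1) unfolding reach_def by (meson rtranclp_imp_relpowp)
  then obtain f where f: "f 0 = u" "f l = w" "\<And>i. i < l \<Longrightarrow> f i \<in> A \<and> f (Suc i) \<in> A \<and> E (f i) (f (Suc i))"
    unfolding relpowp_fun_conv by blast
  have "f i \<in> A" if "i \<le> l" for i using f(3)[of "i - 1"] f(1) assms(2) that by (cases i) auto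
  then show ?thesis using f by (intro exI[of _ f] exI[of _ l]) auto
qed

text \<open>A walk of least length from \<open>u\<close> to \<open>w\<close> inside \<open>A\<close>
  has neither a repeated vertex nor a chord.\<close>

lemma induced_path:
  assumes "conn E A" "u \<in> A" "w \<in> A"
  obtains f l where "f 0 = u" "f l = w" "f ` {..l} \<subseteq> A" "inj_on f {..l}"
    "\<And>i j. i < j \<Longrightarrow> j \<le> l \<Longrightarrow> E (f i) (f j) \<longleftrightarrow> j = Suc i"
proof -
  define W where "W l \<longleftrightarrow> (\<exists>f. f 0 = u \<and> f l = w \<and> f ` {..l} \<subseteq> A \<and> (\<forall>i<l. E (f i) (f (Suc i))))" for l
  have "\<exists>l. W l" using reach_walk assms unfolding W_def conn_def by metis
  then obtain l where l: "W l" "\<And>k. k < l \<Longrightarrow> \<not> W k" using exists_least_iff[of W] by blast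
  then obtain f where f: "f 0 = u" "f l = w" "f ` {..l} \<subseteq> A" "\<forall>i<l. E (f i) (f (Suc i))"
    unfolding W_def by blast
  \<comment> \<open>Both defects are treated at once: \<open>d\<close> steps are cut out after
    position \<open>i\<close>, where \<open>j = i + d\<close> for a repeated vertex and
    \<open>j = i + d + 1\<close> for a chord.\<close>
  have cut: False if ij: "i < j" "j \<le> l" "d > 0" "i + d \<le> j" "j \<le> i + d + 1"
    "if i + d = j then f i = f j else E (f i) (f j)" for i j d
  proof -
    define g where "g k = (if k \<le> i then f k else f (k + d))" for k
    have "g 0 = u" using f by (simp add: g_def)
    moreover have "g (l - d) = w"
    proof (cases "l - d \<le> i")
      case True
      then have "l = j" "l = i + d" using ij by (auto split: if_splits)
      then show ?thesis using ij f by (simp add: g_def)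
    next
      case False
      then show ?thesis using ij f by (simp add: g_def)
    qed
    moreover have "g ` {..l - d} \<subseteq> A" using f(3) ij by (auto simp: g_def)
    moreover have "E (g k) (g (Suc k))" if k: "k < l - d" for k
    proof -
      consider "k < i" | "k = i" | "k > i" by linarith
      then show ?thesis
      proof cases
        case 1
        then show ?thesis using f(4) ij by (simp add: g_def)
      next
        case 2
        show ?thesis
        proof (cases "i + d = j")
          case True
          then have "g (Suc k) = f (Suc j)" "g k = f j" using 2 ij by (simp_all add: g_def add.commute)
          moreover have "j < l" using k 2 True by simp
          ultimately show ?thesis using f(4) by simp
        next
          case False
          then have "j = Suc (i + d)" using ij by linarith
          then have "g k = f i" "g (Suc k) = f j" using 2 by (simp_all add: g_def)
          then show ?thesis using ij False by simp
        qed
      next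
        case 3
        then show ?thesis using f(4) k by (simp add: g_def)
      qed
    qed
    ultimately have "W (l - d)" unfolding W_def by blast
    moreover have "l - d < l" using ij by linarith
    ultimately show False using l(2) by blast
  qed
  have 1: "f i \<noteq> f j" if "i < j" "j \<le> l" for i j
    using cut[of i j "j - i"] that by auto
  have 2: "E (f i) (f j) \<longleftrightarrow> j = Suc i" if "i < j" "j \<le> l" for i j
    proof (cases "j = Suc i")
    case False
    then have "j - i - 1 > 0" "i + (j - i - 1) \<le> j" "j \<le> i + (j - i - 1) + 1" "i + (j - i - 1) \<noteq> j"
      using that by linarith+
    then show ?thesis using cut[OF that] False by (metis (full_types))
  qed (use f that in simp)
  have "inj_on f {..l}" using 1 by (intro inj_onI) (metis atMost_iff linorder_neqE_nat)
  then show thesis using that f 2 by blast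
qed

end

section \<open>Models of the pendant K4 and a minimal counterexample to bounded attachment\<close>

locale fin_graph = sym_graph E for E :: "'a \<Rightarrow> 'a \<Rightarrow> bool" +
  fixes V :: "'a set"
  assumes fin_V: "finite V"
begin

text \<open>The four bags of \<open>K\<^sub>4\<close> in a model of \<open>F1\<close>, with the pendant vertex \<open>p\<close> attached to \<open>A\<close>; one
  vertex always suffices for the bag of the pendant vertex.\<close>

definition mdl :: "'a \<Rightarrow> 'a set \<Rightarrow> 'a set \<Rightarrow> 'a set \<Rightarrow> 'a set \<Rightarrow> bool" where
  "mdl p A B C D \<longleftrightarrow> k4 E A B C D \<and> insert p (A \<union> B \<union> C \<union> D) \<subseteq> V \<and> p \<notin> A \<union> B \<union> C \<union> D \<and>
     touch E {p} A \<and> \<not> touch E {p} B \<and> \<not> touch E {p} C \<and> \<not> touch E {p} D"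

lemma mdl_perm: "mdl p A B C D \<Longrightarrow> mdl p A C B D" "mdl p A B C D \<Longrightarrow> mdl p A B D C"
  unfolding mdl_def using k4_perm(1)[of A B C D] k4_perm(2)[of A B C D] by auto

lemma mdlI:
  assumes "conn E A \<and> conn E B \<and> conn E C \<and> conn E D"
    and "touch E A B \<and> touch E A C \<and> touch E A D \<and> touch E B C \<and> touch E B D \<and> touch E C D"
    and "A \<inter> B = {} \<and> A \<inter> C = {} \<and> A \<inter> D = {} \<and> B \<inter> C = {} \<and> B \<inter> D = {} \<and> C \<inter> D = {}"
    and "insert p (A \<union> B \<union> C \<union> D) \<subseteq> V \<and> p \<notin> A \<union> B \<union> C \<union> D"
    and "touch E {p} A \<and> \<not> touch E {p} B \<and> \<not> touch E {p} C \<and> \<not> touch E {p} D"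
  shows "mdl p A B C D"
  using assms unfolding mdl_def k4_def tri_def by (simp add: Int_Un_distrib)

lemma mdlD:
  assumes "mdl p A B C D"
  shows mdl_conn: "conn E A" "conn E B" "conn E C" "conn E D"
    and mdl_touch: "touch E A B" "touch E A C" "touch E A D" "touch E B C" "touch E B D" "touch E C D"
    and mdl_disj: "A \<inter> B = {}" "A \<inter> C = {}" "A \<inter> D = {}" "B \<inter> C = {}" "B \<inter> D = {}" "C \<inter> D = {}"
    and mdl_sets: "insert p (A \<union> B \<union> C \<union> D) \<subseteq> V" "p \<notin> A \<union> B \<union> C \<union> D"
    and mdl_pend: "touch E {p} A" "\<not> touch E {p} B" "\<not> touch E {p} C" "\<not> touch E {p} D"
  using assms unfolding mdl_def k4_def tri_def by (simp_all add: Int_Un_distrib)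

text \<open>The bound 6 is forced by \<open>two_ends\<close>: a counterexample then has at least
  seven vertices in \<open>A\<close>, so that on the path \<open>f 0, ..., f l\<close> the vertices
  \<open>f 3\<close> and \<open>f (l - 1)\<close> are not adjacent.\<close>

definition good :: bool where
  "good \<longleftrightarrow> (\<exists>p A B C D A0. mdl p A B C D \<and> conn E A0 \<and> A0 \<subseteq> A \<and> card A0 \<le> 6 \<and>
     (\<forall>x\<in>A. E p x \<longrightarrow> x \<in> A0))"

lemma goodI: "mdl p A B C D \<Longrightarrow> conn E A0 \<Longrightarrow> A0 \<subseteq> A \<Longrightarrow> card A0 \<le> 6 \<Longrightarrow>
    (\<And>x. x \<in> A \<Longrightarrow> E p x \<Longrightarrow> x \<in> A0) \<Longrightarrow> good"
  unfolding good_def by blast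

end

text \<open>Minimality ranges over all pendant vertices \<open>p'\<close>, not just
  \<open>p\<close>, because the reroutings below replace the pendant vertex by a vertex of the old
  model.\<close>

locale min_model = fin_graph +
  fixes p :: 'a and A :: "'a set"
  assumes bad: "\<not> good"
    and min: "mdl p' A' B' C' D' \<Longrightarrow> card A \<le> card A'"
begin

lemma smaller: "mdl p' A' B' C' D' \<Longrightarrow> card A' < card A \<Longrightarrow> False"
  using min by fastforce

context
  fixes B C D :: "'a set"
  assumes m: "mdl p A B C D"
begin

lemma fin_A: "finite A"
  using mdl_sets[OF m] fin_V by (auto intro: finite_subset)

text \<open>A bag with at most six vertices would serve as its own \<open>A0\<close>.\<close>

lemma card_A: "card A \<ge> 7"
proof (rule ccontr)
  assume "\<not> card A \<ge> 7"
  then show False using goodI[OF m mdl_conn(1)[OF m]] bad by auto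
qed

text \<open>If \<open>v\<close> were the only neighbour of \<open>p\<close> in \<open>A\<close>,
  then \<open>{v}\<close> would serve as \<open>A0\<close>.\<close>

lemma p_touch: "touch E {p} (A - {v})"
proof (rule ccontr)
  assume *: "\<not> touch E {p} (A - {v})"
  then have "\<And>x. x \<in> A \<Longrightarrow> E p x \<Longrightarrow> x = v" unfolding touch_def by blast
  moreover obtain s where "s \<in> A" "E p s" using mdl_pend(1)[OF m] unfolding touch_def by blast
  ultimately show False using goodI[OF m, of "{v}"] bad by auto
qed

text \<open>Otherwise \<open>v\<close> could be dropped from \<open>A\<close>, leaving a smaller
  model. In what follows, \<open>v\<close> is called private for a bag if it is the only vertex of
  \<open>A\<close> that touches this bag.\<close>

lemma priv1:
  assumes "v \<in> A" "conn E (A - {v})"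
  shows "\<not> touch E (A - {v}) B \<or> \<not> touch E (A - {v}) C \<or> \<not> touch E (A - {v}) D"
proof (rule ccontr)
  assume *: "\<not> ?thesis"
  have "mdl p (A - {v}) B C D"
  proof (rule mdlI)
    show "touch E {p} (A - {v}) \<and> \<not> touch E {p} B \<and> \<not> touch E {p} C \<and> \<not> touch E {p} D"
      using mdl_pend[OF m] p_touch by simp
  qed (use * assms mdl_conn[OF m] mdl_touch[OF m] in simp, use * mdl_touch[OF m] in simp,
      use mdl_disj[OF m] in blast, use mdl_sets[OF m] in blast)
  moreover have "card (A - {v}) < card A" using assms fin_A by (meson card_Diff1_less)
  ultimately show False by (rule smaller)
qed

lemma priv_touch: "touch E A X \<Longrightarrow> \<not> touch E (A - {v}) X \<Longrightarrow> v \<in> A \<and> touch E {v} X"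
  unfolding touch_def by blast

text \<open>If \<open>v\<close> were private for \<open>B\<close> alone, it could move from
  \<open>A\<close> to \<open>B\<close>: it is not adjacent to \<open>p\<close>, and it joins the
  enlarged \<open>B\<close> to the rest of \<open>A\<close>.\<close>

lemma priv2:
  assumes "v \<in> A" "conn E (A - {v})" "\<not> E p v" "\<not> touch E (A - {v}) B"
  shows "\<not> touch E (A - {v}) C \<or> \<not> touch E (A - {v}) D"
proof (rule ccontr)
  assume *: "\<not> ?thesis"
  have Bv: "touch E B {v}"
    using priv_touch[OF mdl_touch(1)[OF m] assms(4)] touch_sym by blast
  have "A \<noteq> {v}" using card_A by auto
  then have v: "touch E (A - {v}) {v}" using noncut_touch[OF mdl_conn(1)[OF m] assms(1)] touch_sym by blast
  have "mdl p (A - {v}) (insert v B) C D"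
  proof (rule mdlI)
    show "conn E (A - {v}) \<and> conn E (insert v B) \<and> conn E C \<and> conn E D"
      using assms mdl_conn[OF m] conn_insert Bv by simp
    show "touch E (A - {v}) (insert v B) \<and> touch E (A - {v}) C \<and> touch E (A - {v}) D \<and>
      touch E (insert v B) C \<and> touch E (insert v B) D \<and> touch E C D"
      using * v mdl_touch[OF m] by (simp add: touch_insert1[of E v B] touch_insert2[of _ _ v B])
    show "touch E {p} (A - {v}) \<and> \<not> touch E {p} (insert v B) \<and> \<not> touch E {p} C \<and> \<not> touch E {p} D"
      using mdl_pend[OF m] p_touch assms(3) by (simp add: touch_insert2[of _ _ v B])
  qed (use mdl_disj[OF m] assms(1) in blast, use mdl_sets[OF m] assms(1) in blast)
  moreover have "card (A - {v}) < card A" using assms fin_A by (meson card_Diff1_less)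
  ultimately show False by (rule smaller)
qed

lemma priv_unique: "touch E A X \<Longrightarrow> v \<noteq> v' \<Longrightarrow> \<not> touch E (A - {v}) X \<Longrightarrow> \<not> touch E (A - {v'}) X \<Longrightarrow> False"
  unfolding touch_def by blast

text \<open>The four vertices \<open>p\<close>, \<open>v1\<close>, \<open>v2\<close>,
  \<open>v3\<close> form a star that can replace \<open>A\<close>. A further vertex of
  \<open>A\<close> adjacent to this star becomes the new pendant; it misses \<open>B\<close>,
  \<open>C\<close> and \<open>D\<close>, whose only contacts with \<open>A\<close> are
  \<open>v1\<close>, \<open>v2\<close> and \<open>v3\<close>.\<close>

lemma three_private:
  assumes v: "v1 \<noteq> v2" "v1 \<noteq> v3" "v2 \<noteq> v3"
    and S: "E p v1" "E p v2" "E p v3"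
    and priv: "\<not> touch E (A - {v1}) B" "\<not> touch E (A - {v2}) C" "\<not> touch E (A - {v3}) D"
  shows False
proof -
  let ?L = "{v1, v2, v3}"
  note c1 = priv_touch[OF mdl_touch(1)[OF m] priv(1)] priv_touch[OF mdl_touch(2)[OF m] priv(2)]
    priv_touch[OF mdl_touch(3)[OF m] priv(3)]
  have "card ?L \<le> 3" by (simp add: card_insert_if)
  then have "?L \<noteq> A" using card_A by auto
  then obtain u x where ux: "u \<in> ?L" "x \<in> A - ?L" "E u x"
    using conn_crossing[OF mdl_conn(1)[OF m], of ?L] c1 by auto
  have nx: "\<not> touch E {x} B" "\<not> touch E {x} C" "\<not> touch E {x} D"
    using priv ux unfolding touch_def by blast+
  have "conn E {v1, p}" "touch E {v1, p} {v2}" using S conn_insert[of "{p}" v1] by (auto simp: touch_def)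
  then have "conn E {v2, v1, p}" "touch E {v2, v1, p} {v3}" using S conn_insert[of "{v1, p}" v2]
    by (auto simp: touch_def)
  then have L: "conn E {v3, v2, v1, p}" by (rule conn_insert)
  let ?L' = "{v3, v2, v1, p}"
  have "mdl x ?L' B C D"
  proof (rule mdlI)
    show "conn E ?L' \<and> conn E B \<and> conn E C \<and> conn E D" using L mdl_conn[OF m] by simp
    show "touch E ?L' B \<and> touch E ?L' C \<and> touch E ?L' D \<and> touch E B C \<and> touch E B D \<and> touch E C D"
      using c1 mdl_touch[OF m] by (auto intro: touch_mono)
    have "E x u" using ux E_sym by blast
    then have "touch E {x} ?L'" using ux by (intro touchI[of _ x u]) auto
    then show "touch E {x} ?L' \<and> \<not> touch E {x} B \<and> \<not> touch E {x} C \<and> \<not> touch E {x} D"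
      using nx by simp
    have L': "?L' \<subseteq> insert p A" "x \<notin> ?L'" "x \<in> A" using c1 ux mdl_sets[OF m] by auto
    show "?L' \<inter> B = {} \<and> ?L' \<inter> C = {} \<and> ?L' \<inter> D = {} \<and> B \<inter> C = {} \<and> B \<inter> D = {} \<and> C \<inter> D = {}"
      using L'(1) mdl_disj[OF m] mdl_sets(2)[OF m] by fast
    show "insert x (?L' \<union> B \<union> C \<union> D) \<subseteq> V \<and> x \<notin> ?L' \<union> B \<union> C \<union> D"
      using L' mdl_disj(1-3)[OF m] mdl_sets[OF m] by fast
  qed
  moreover have "card ?L' \<le> 4" by (simp add: card_insert_if)
  then have "card ?L' < card A" using card_A by linarith
  ultimately show False by (rule smaller)
qed

end

text \<open>Each of the three vertices is private for some bag and no bag has two private vertices,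
  so each has exactly one bag. By \<open>priv2\<close> all three are adjacent to \<open>p\<close>,
  which \<open>three_private\<close> excludes.\<close>

lemma not_three_noncuts:
  assumes m: "mdl p A B C D"
    and v: "v1 \<in> A" "v2 \<in> A" "v3 \<in> A" "v1 \<noteq> v2" "v1 \<noteq> v3" "v2 \<noteq> v3"
    and c: "conn E (A - {v1})" "conn E (A - {v2})" "conn E (A - {v3})"
  shows False
proof -
  define P where "P v X = (\<not> touch E (A - {v}) X)" for v X
  note m1 = m mdl_perm[OF m]
  \<comment> \<open>Together these are the six orders of \<open>B\<close>, \<open>C\<close>,
    \<open>D\<close>, so that facts proved for one order apply to every distribution of the private
    bags.\<close>
  note m2 = m1 mdl_perm(1)[OF m1(3)] mdl_perm(2)[OF m1(2)] mdl_perm(1)[OF mdl_perm(2)[OF m1(2)]]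
  have u: "P v X \<Longrightarrow> P v' X \<Longrightarrow> v = v'" if "X \<in> {B, C, D}" for v v' X
    using priv_unique[OF m, of X v v'] that mdl_touch[OF m] unfolding P_def by auto
  have u': "\<not> (P v1 X \<and> P v2 X)" "\<not> (P v1 X \<and> P v3 X)" "\<not> (P v2 X \<and> P v3 X)" if "X \<in> {B, C, D}" for X
    using u[OF that] v by blast+
  have one: "P v B \<or> P v C \<or> P v D" if "v \<in> {v1, v2, v3}" for v
    using priv1[OF m, of v] that v c unfolding P_def by auto
  have two: "E p v \<or> (P v B \<and> P v C) \<or> (P v B \<and> P v D) \<or> (P v C \<and> P v D)" if "v \<in> {v1, v2, v3}" for v
  proof -
    have "v \<in> A" "conn E (A - {v})" using that v c by auto
    from priv2[OF m2(1) this] priv2[OF m2(2) this] priv2[OF m2(4) this] one[OF that]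
    show ?thesis unfolding P_def by argo
  qed
  have BCD: "B \<in> {B, C, D}" "C \<in> {B, C, D}" "D \<in> {B, C, D}" by auto
  have vs: "v1 \<in> {v1, v2, v3}" "v2 \<in> {v1, v2, v3}" "v3 \<in> {v1, v2, v3}" by auto
  note facts = u'[OF BCD(1)] u'[OF BCD(2)] u'[OF BCD(3)]
    one[OF vs(1)] one[OF vs(2)] one[OF vs(3)] two[OF vs(1)] two[OF vs(2)] two[OF vs(3)]
  have S: "E p v1" "E p v2" "E p v3" using facts by argo+
  have key: "mdl p A X Y Z \<Longrightarrow> \<not> (P v1 X \<and> P v2 Y \<and> P v3 Z)" for X Y Z
    using three_private[OF _ v(4-6) S] unfolding P_def by blast
  show False
    using facts key[OF m2(1)] key[OF m2(2)] key[OF m2(3)] key[OF m2(4)] key[OF m2(5)] key[OF m2(6)]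
    by argo
qed

end

section \<open>The bag \<open>A\<close> as a long induced path\<close>

lemma touch_singletonD: "\<not> touch E A B \<Longrightarrow> a \<in> A \<Longrightarrow> \<not> touch E {a} B"
  unfolding touch_def by blast

lemma private_touch: "touch E X Y \<Longrightarrow> \<not> touch E (X - {v}) Y \<Longrightarrow> v \<in> X \<and> touch E {v} Y"
  unfolding touch_def by blast

lemma touch_singletonE:
  assumes "touch E A B" obtains a where "a \<in> A" "touch E {a} B"
  using assms unfolding touch_def by blast

locale path_model = min_model +
  fixes f :: "nat \<Rightarrow> 'a" and l :: nat
  assumes A_eq: "A = f ` {..l}" and f_inj: "inj_on f {..l}" and l6: "6 \<le> l"
    and adj: "i < j \<Longrightarrow> j \<le> l \<Longrightarrow> E (f i) (f j) \<longleftrightarrow> j = Suc i"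
begin

lemma f_in: "i \<le> l \<Longrightarrow> f i \<in> A"
  by (simp add: A_eq)

lemma f_eq: "i \<le> l \<Longrightarrow> j \<le> l \<Longrightarrow> f i = f j \<longleftrightarrow> i = j"
  using f_inj by (auto simp: inj_on_def)

lemma f_mem: "i \<le> l \<Longrightarrow> S \<subseteq> {..l} \<Longrightarrow> f i \<in> f ` S \<longleftrightarrow> i \<in> S"
  using inj_on_image_mem_iff[OF f_inj] by simp

lemma A_minus: "i \<le> l \<Longrightarrow> A - {f i} = f ` ({..l} - {i})"
  using f_eq by (auto simp: A_eq)

lemma f_sub: "S \<subseteq> {..l} \<Longrightarrow> f ` S \<subseteq> A"
  by (auto simp: A_eq)

lemma adjE: "i \<le> l \<Longrightarrow> j \<le> l \<Longrightarrow> i \<noteq> j \<Longrightarrow> E (f i) (f j) \<longleftrightarrow> j = Suc i \<or> i = Suc j"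
  using adj[of i j] adj[of j i] E_sym by (cases i j rule: linorder_cases) auto

lemma seg_conn: "a \<le> b \<Longrightarrow> b \<le> l \<Longrightarrow> conn E (f ` {a..b})"
  by (rule conn_segment) (auto simp: adj)

lemma card_seg: "S \<subseteq> {..l} \<Longrightarrow> card (f ` S) = card S"
  using f_inj by (meson card_image inj_on_subset)

lemma card_A_l: "card A = Suc l"
  using card_seg[of "{..l}"] by (simp add: A_eq)

text \<open>Let \<open>f k\<close> be the last neighbour of \<open>p\<close> on the path. For small
  \<open>k\<close> the initial segment up to \<open>f k\<close> serves as \<open>A0\<close>.
  Otherwise \<open>f 0\<close> is given to \<open>B\<close>, \<open>f 2\<close> becomes the pendant,
  and \<open>p\<close> joins one of the two bags to shorten \<open>A\<close>.\<close>

lemma one_end: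
  assumes m: "mdl p A B C D" and pB: "\<not> touch E (A - {f 0}) B"
    and pC: "\<not> touch E (A - {f l}) C" and pD: "\<not> touch E (A - {f l}) D"
    and S0: "E p (f 0)" and Sl: "\<not> E p (f l)"
  shows False
proof -
  note mc = mdl_conn[OF m] and mt = mdl_touch[OF m] and md = mdl_disj[OF m] and ms = mdl_sets[OF m]
    and mp = mdl_pend[OF m]
  define K where "K = {i. i \<le> l \<and> E p (f i)}"
  have K: "finite K" "K \<noteq> {}" using S0 by (auto simp: K_def)
  define k where "k = Max K"
  have "k \<in> K" unfolding k_def using K by (rule Max_in)
  then have k: "k < l" "E p (f k)" using Sl by (auto simp: K_def le_less)
  have kmax: "i \<le> k" if "i \<le> l" "E p (f i)" for i
    unfolding k_def using K(1) that by (intro Max_ge) (simp_all add: K_def)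
  have B0: "touch E {f 0} B" and Cl: "touch E {f l} C" and Dl: "touch E {f l} D"
    using priv_touch[OF m] mt(1-3) pB pC pD by blast+
  have nB: "\<not> touch E {f i} B" if "0 < i" "i \<le> l" for i
    using touch_singletonD[OF pB, of "f i"] that f_in f_eq[of i 0] by auto
  have nC: "\<not> touch E {f i} C" if "i < l" for i
    using touch_singletonD[OF pC, of "f i"] that f_in f_eq[of i l] by auto
  have nD: "\<not> touch E {f i} D" if "i < l" for i
    using touch_singletonD[OF pD, of "f i"] that f_in f_eq[of i l] by auto
  have k3: "k \<ge> 3"
  proof (rule ccontr)
    assume "\<not> k \<ge> 3"
    have "good"
    proof (rule goodI[OF m, of "f ` {0..k}"])
      show "conn E (f ` {0..k})" using seg_conn k by simp
      show "f ` {0..k} \<subseteq> A" using k f_in by auto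
      show "card (f ` {0..k}) \<le> 6" using card_seg[of "{0..k}"] k \<open>\<not> k \<ge> 3\<close> by simp
      fix x assume "x \<in> A" "E p x"
      then obtain i where "x = f i" "i \<le> l" unfolding A_eq by blast
      then show "x \<in> f ` {0..k}" using kmax[of i] \<open>E p x\<close> by auto
    qed
    then show False using bad by simp
  qed
  have l2: "\<not> E (f 2) (f 0)" using adjE[of 2 0] l6 by simp
  have f2: "f 2 \<in> A" "f 2 \<noteq> f 0" "f 2 \<noteq> p" using f_in[of 2] f_eq[of 2 0] l6 ms by auto
  have B'c: "conn E (insert (f 0) B)" using conn_insert[OF mc(2)] B0 touch_sym by blast
  show False
  proof (cases "E p (f 2)")
    case True
    \<comment> \<open>Here the pendant \<open>f 2\<close> is attached to \<open>p\<close>, which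
      lies in the new \<open>A\<close> and also provides the contact with \<open>f 0\<close> in the
      new \<open>B\<close>.\<close>
    let ?A = "insert p (f ` {k..l})" and ?B = "insert (f 0) B"
    have sub: "?A \<subseteq> insert p A" "f 0 \<notin> ?A" "f 2 \<notin> ?A"
      using f_sub[of "{k..l}"] k k3 f2 f_mem[of 0 "{k..l}"] f_mem[of 2 "{k..l}"] l6 ms f_in[of 0] by auto
    have f0: "f 0 \<in> A" using f_in by simp
    have "?A \<inter> (B \<union> C \<union> D) = {}" using sub(1) md(1-3) ms(2) by blast
    moreover have "f 0 \<notin> C \<union> D" "f 2 \<notin> B \<union> C \<union> D" using f0 f2 md(1-3) by blast+
    moreover have "?A \<subseteq> V" "f 2 \<in> V" "f 0 \<in> V" using sub(1) ms(1) f0 f2 by blast+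
    ultimately have sets: "?A \<inter> B = {} \<and> ?A \<inter> C = {} \<and> ?A \<inter> D = {}" "?A \<inter> ?B = {}"
      "?B \<inter> C = {} \<and> ?B \<inter> D = {} \<and> C \<inter> D = {}" "insert (f 2) (?A \<union> ?B \<union> C \<union> D) \<subseteq> V" "f 2 \<notin> ?A \<union> ?B \<union> C \<union> D"
      using sub(2,3) md(4-6) ms(1) f2 by auto
    have "mdl (f 2) ?A ?B C D"
    proof (rule mdlI)
      have "touch E (f ` {k..l}) {p}" using k E_sym by (intro touchI[of _ "f k" p]) auto
      then show "conn E ?A \<and> conn E ?B \<and> conn E C \<and> conn E D"
        using conn_insert[OF seg_conn[of k l]] k mc B'c by simp
      have "touch E ?A ?B" using S0 by (intro touchI[of _ p "f 0"]) auto
      moreover have "touch E ?A C" "touch E ?A D"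
        using k touch_mono[OF Cl, of ?A C] touch_mono[OF Dl, of ?A D] by simp_all
      moreover have "touch E ?B C" "touch E ?B D"
        by (rule touch_mono[OF mt(4)] touch_mono[OF mt(5)]; blast)+
      ultimately show "touch E ?A ?B \<and> touch E ?A C \<and> touch E ?A D \<and> touch E ?B C \<and> touch E ?B D \<and> touch E C D"
        using mt by simp
      show "?A \<inter> ?B = {} \<and> ?A \<inter> C = {} \<and> ?A \<inter> D = {} \<and> ?B \<inter> C = {} \<and> ?B \<inter> D = {} \<and> C \<inter> D = {}"
        by (simp only: sets simp_thms)
      show "insert (f 2) (?A \<union> ?B \<union> C \<union> D) \<subseteq> V \<and> f 2 \<notin> ?A \<union> ?B \<union> C \<union> D"
        by (simp only: sets simp_thms)
      have "touch E {f 2} ?A" using True E_sym by (intro touchI[of _ "f 2" p]) auto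
      then show "touch E {f 2} ?A \<and> \<not> touch E {f 2} ?B \<and> \<not> touch E {f 2} C \<and> \<not> touch E {f 2} D"
        using nB[of 2] nC[of 2] nD[of 2] l6 l2 by (simp add: touch_insert2[of _ _ _ B])
    qed
    moreover have "card ?A \<le> Suc (card {k..l})"
      using card_seg[of "{k..l}"] by (simp add: card_insert_if)
    then have "card ?A < card A" using card_A_l k3 k by simp
    ultimately show False by (rule smaller)
  next
    case False
    \<comment> \<open>Here \<open>p\<close> joins \<open>B\<close> together with \<open>f 0\<close>
      and touches the new \<open>A\<close> in \<open>f k\<close>, as \<open>k\<close> is at least 3;
      the pendant \<open>f 2\<close> is attached to \<open>f 3\<close>.\<close>
    let ?A = "f ` {3..l}" and ?B = "insert p (insert (f 0) B)"
    have sub: "?A \<subseteq> A" "f 0 \<notin> ?A" "f 2 \<notin> ?A"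
      using f_sub[of "{3..l}"] f_mem[of 0 "{3..l}"] f_mem[of 2 "{3..l}"] l6 by auto
    have f0: "f 0 \<in> A" using f_in by simp
    have "?A \<inter> (B \<union> C \<union> D) = {}" "p \<notin> ?A" using sub(1) md(1-3) ms(2) by blast+
    moreover have "f 0 \<notin> C \<union> D" "f 2 \<notin> B \<union> C \<union> D" using f0 f2 md(1-3) by blast+
    moreover have "?A \<subseteq> V" "f 2 \<in> V" "f 0 \<in> V" using sub(1) ms(1) f0 f2 by blast+
    ultimately have sets: "?A \<inter> B = {} \<and> ?A \<inter> C = {} \<and> ?A \<inter> D = {}" "?A \<inter> ?B = {}"
      "?B \<inter> C = {} \<and> ?B \<inter> D = {} \<and> C \<inter> D = {}" "insert (f 2) (?A \<union> ?B \<union> C \<union> D) \<subseteq> V" "f 2 \<notin> ?A \<union> ?B \<union> C \<union> D"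
      using sub(2,3) md(4-6) ms f2 by auto
    have "mdl (f 2) ?A ?B C D"
    proof (rule mdlI)
      have "touch E (insert (f 0) B) {p}" using S0 E_sym by (intro touchI[of _ "f 0" p]) auto
      then show "conn E ?A \<and> conn E ?B \<and> conn E C \<and> conn E D"
        using seg_conn[of 3 l] conn_insert[OF B'c] k k3 mc by simp
      have "touch E ?A ?B" using k k3 E_sym by (intro touchI[of _ "f k" p]) auto
      moreover have "touch E ?A C" "touch E ?A D"
        using k k3 touch_mono[OF Cl, of ?A C] touch_mono[OF Dl, of ?A D] by simp_all
      moreover have "touch E ?B C" "touch E ?B D"
        by (rule touch_mono[OF mt(4)] touch_mono[OF mt(5)]; blast)+
      ultimately show "touch E ?A ?B \<and> touch E ?A C \<and> touch E ?A D \<and> touch E ?B C \<and> touch E ?B D \<and> touch E C D"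
        using mt by simp
      show "?A \<inter> ?B = {} \<and> ?A \<inter> C = {} \<and> ?A \<inter> D = {} \<and> ?B \<inter> C = {} \<and> ?B \<inter> D = {} \<and> C \<inter> D = {}"
        by (simp only: sets simp_thms)
      show "insert (f 2) (?A \<union> ?B \<union> C \<union> D) \<subseteq> V \<and> f 2 \<notin> ?A \<union> ?B \<union> C \<union> D"
        by (simp only: sets simp_thms)
      have "E (f 2) (f 3)" using adj[of 2 3] l6 by simp
      then have "touch E {f 2} ?A" using l6 by (intro touchI[of _ "f 2" "f 3"]) auto
      moreover have "\<not> E (f 2) p" using False E_sym by blast
      ultimately show "touch E {f 2} ?A \<and> \<not> touch E {f 2} ?B \<and> \<not> touch E {f 2} C \<and> \<not> touch E {f 2} D"
        using nB[of 2] nC[of 2] nD[of 2] l6 l2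
        by (simp add: touch_insert2[of _ _ _ B] touch_insert2[of _ _ _ "insert (f 0) B"])
    qed
    moreover have "card ?A < card A" using card_seg[of "{3..l}"] card_A_l by simp
    ultimately show False by (rule smaller)
  qed
qed

context
  assumes S0: "E p (f 0)" and Sl: "E p (f l)"
begin

context
  fixes B C D
  assumes m: "mdl p A B C D" and pB: "\<not> touch E (A - {f 0}) B" and pC: "\<not> touch E (A - {f l}) C"
begin

lemma B0: "touch E {f 0} B" and Cl: "touch E {f l} C"
  using priv_touch[OF m] mdl_touch(1,2)[OF m] pB pC by blast+

lemma nB: "0 < i \<Longrightarrow> i \<le> l \<Longrightarrow> \<not> touch E {f i} B"
  using touch_singletonD[OF pB, of "f i"] f_in f_eq[of i 0] by auto

lemma nC: "i < l \<Longrightarrow> \<not> touch E {f i} C"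
  using touch_singletonD[OF pC, of "f i"] f_in f_eq[of i l] by auto

text \<open>Removing two consecutive interior vertices cuts the path in two, but \<open>p\<close> is
  adjacent to both ends and joins the pieces again. The new bag has one vertex less; the removed
  vertex \<open>f x\<close> becomes the pendant, attached to its other neighbour on the path, and
  \<open>f t\<close> keeps the contact with \<open>D\<close>.\<close>

lemma drop_pair:
  assumes j: "0 < j" "Suc j < l" and x: "x = j \<or> x = Suc j" "\<not> touch E {f x} D"
    and t: "t \<le> l" "t \<noteq> j" "t \<noteq> Suc j" "touch E {f t} D"
  shows False
proof -
  note mc = mdl_conn[OF m] and mt = mdl_touch[OF m] and md = mdl_disj[OF m] and ms = mdl_sets[OF m]
    and mp = mdl_pend[OF m]
  let ?I = "{0..j-1}" and ?J = "{Suc (Suc j)..l}"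
  define A' where "A' = insert p (f ` ?I) \<union> f ` ?J"
  have "?I \<subseteq> {..l}" "?J \<subseteq> {..l}" using j by auto
  note IJ = this f_sub[OF this(1)] f_sub[OF this(2)]
  have sub: "A' \<subseteq> insert p A" using IJ by (auto simp: A'_def)
  have x': "0 < x" "x < l" "f x \<in> A" "f x \<notin> A'" "f x \<noteq> p"
    using x j f_in[of x] f_mem[OF _ IJ(1), of x] f_mem[OF _ IJ(2), of x] ms by (auto simp: A'_def)
  have "A' \<inter> (B \<union> C \<union> D) = {}" using sub(1) md(1-3) ms(2) by blast
  moreover have "f x \<notin> B \<union> C \<union> D" using x' md(1-3) by blast
  moreover have "A' \<subseteq> V" "f x \<in> V" using sub(1) ms(1) x' by blast+
  ultimately have sets: "A' \<inter> B = {} \<and> A' \<inter> C = {} \<and> A' \<inter> D = {}"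
    "B \<inter> C = {} \<and> B \<inter> D = {} \<and> C \<inter> D = {}" "insert (f x) (A' \<union> B \<union> C \<union> D) \<subseteq> V" "f x \<notin> A' \<union> B \<union> C \<union> D"
    using md(4-6) ms(1) x'(4) by auto
  have "mdl (f x) A' B C D"
  proof (rule mdlI)
    have "touch E (f ` ?I) {p}" using S0 E_sym by (intro touchI[of _ "f 0" p]) auto
    then have "conn E (insert p (f ` ?I))" using conn_insert[OF seg_conn[of 0 "j-1"]] j by simp
    moreover have "touch E (insert p (f ` ?I)) (f ` ?J)" using Sl j by (intro touchI[of _ p "f l"]) auto
    ultimately show "conn E A' \<and> conn E B \<and> conn E C \<and> conn E D"
      using mc conn_Un[of "insert p (f ` ?I)" "f ` ?J"] seg_conn[of "Suc (Suc j)" l] j by (simp add: A'_def)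
    have "f t \<in> A'" using t by (cases "t < j") (auto simp: A'_def)
    moreover have "f 0 \<in> A'" "f l \<in> A'" using j by (auto simp: A'_def)
    ultimately show "touch E A' B \<and> touch E A' C \<and> touch E A' D \<and> touch E B C \<and> touch E B D \<and> touch E C D"
      using mt touch_mono[OF t(4), of A' D] touch_mono[OF B0, of A' B] touch_mono[OF Cl, of A' C]
      by (simp only: empty_subsetI insert_subset subset_refl simp_thms)
    show "A' \<inter> B = {} \<and> A' \<inter> C = {} \<and> A' \<inter> D = {} \<and> B \<inter> C = {} \<and> B \<inter> D = {} \<and> C \<inter> D = {}"
      by (simp only: sets simp_thms)
    show "insert (f x) (A' \<union> B \<union> C \<union> D) \<subseteq> V \<and> f x \<notin> A' \<union> B \<union> C \<union> D"
      by (simp only: sets simp_thms)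
    have "touch E {f x} A'"
    proof (cases "x = j")
      case True
      then have "E (f x) (f (j - 1))" using adjE[of x "j - 1"] j by simp
      then show ?thesis by (intro touchI[of _ "f x" "f (j - 1)"]) (auto simp: A'_def)
    next
      case False
      then have "E (f x) (f (Suc (Suc j)))" using adjE[of x "Suc (Suc j)"] j x by simp
      then show ?thesis using j by (intro touchI[of _ "f x" "f (Suc (Suc j))"]) (auto simp: A'_def)
    qed
    then show "touch E {f x} A' \<and> \<not> touch E {f x} B \<and> \<not> touch E {f x} C \<and> \<not> touch E {f x} D"
      using nB[of x] nC[of x] x x' by simp
  qed
  moreover have "card A' < card A"
  proof -
    have "card (f ` ?I) = j" "card (f ` ?J) = l - Suc j" using card_seg[of ?I] card_seg[of ?J] j by auto
    then have "card A' \<le> Suc j + (l - Suc j)"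
      using card_Un_le[of "insert p (f ` ?I)" "f ` ?J"] by (simp add: A'_def card_insert_if split: if_splits)
    then show ?thesis using card_A_l j by simp
  qed
  ultimately show False by (rule smaller)
qed

text \<open>An interior vertex missing \<open>D\<close> would be a suitable pendant for
  \<open>drop_pair\<close>, once a pair containing it is found that avoids some contact
  \<open>f t\<close> with \<open>D\<close>.\<close>

lemma interior_touch:
  assumes "0 < j" "j < l"
  shows "touch E {f j} D"
proof (rule ccontr)
  assume j: "\<not> touch E {f j} D"
  obtain a where "a \<in> A" "touch E {a} D" using mdl_touch(3)[OF m] by (rule touch_singletonE)
  then obtain t where t: "t \<le> l" "touch E {f t} D" unfolding A_eq by auto
  have tj: "t \<noteq> j" using t j by blast
  \<comment> \<open>One of the pairs \<open>{j - 1, j}\<close> and \<open>{j, j + 1}\<close> is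
    interior and avoids \<open>t\<close>, unless \<open>j\<close> is next to an end and
    \<open>t\<close> is its inner neighbour. In that case the vertex beyond \<open>t\<close>
    decides: it either is another contact to keep, or misses \<open>D\<close> and is dropped in
    place of \<open>f j\<close>.\<close>
  show False
  proof (cases "j = 1 \<and> t = 2 \<or> Suc j = l \<and> Suc t = j")
    case False
    then have "(j \<ge> 2 \<and> Suc t \<noteq> j) \<or> (Suc j < l \<and> t \<noteq> Suc j)" using assms l6 tj by linarith
    then show False
    proof
      assume j2: "j \<ge> 2 \<and> Suc t \<noteq> j"
      then have "0 < j - 1" "Suc (j - 1) = j" "t \<noteq> j - 1" by linarith+
      then show False using drop_pair[of "j - 1" j t] j t tj assms by simp
    qed (use drop_pair[of j j t] j t tj assms in simp)
  next
    case True
    then show False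
    proof
      assume jt: "j = 1 \<and> t = 2"
      show False
      proof (cases "touch E {f 3} D")
        case True
        then show ?thesis using drop_pair[of 1 1 3] jt j l6 by simp
      next
        case False
        then show ?thesis using drop_pair[of 3 3 2] jt t l6 by simp
      qed
    next
      assume jt: "Suc j = l \<and> Suc t = j"
      show False
      proof (cases "touch E {f (l - 3)} D")
        case True
        then show ?thesis using drop_pair[of "l - 2" j "l - 3"] jt j l6 by fastforce
      next
        case False
        then show ?thesis using drop_pair[of "l - 4" "l - 3" t] jt t l6 by fastforce
      qed
    qed
  qed
qed

end

text \<open>Among the admissible triples one with the smallest \<open>D\<close> is taken. If the
  interior of the path saw two vertices of \<open>D\<close>, every non-cut vertex of
  \<open>D\<close> would be the only contact of \<open>D\<close> with both \<open>B\<close> and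
  \<open>C\<close>; but \<open>D\<close> has two non-cut vertices.\<close>

lemma single_attachment:
  assumes m: "mdl p A B C D" and pB: "\<not> touch E (A - {f 0}) B" and pC: "\<not> touch E (A - {f l}) C"
  shows "\<exists>B C D d. mdl p A B C D \<and> \<not> touch E (A - {f 0}) B \<and> \<not> touch E (A - {f l}) C \<and> d \<in> D \<and>
    (\<forall>i y. 0 < i \<longrightarrow> i < l \<longrightarrow> y \<in> D \<longrightarrow> E (f i) y \<longrightarrow> y = d)"
proof -
  define Q where "Q B C D \<longleftrightarrow> mdl p A B C D \<and> \<not> touch E (A - {f 0}) B \<and> \<not> touch E (A - {f l}) C" for B C D
  have "\<exists>n B C D. Q B C D \<and> card D = n" using assms unfolding Q_def by blast
  then obtain n where "\<exists>B C D. Q B C D \<and> card D = n" "\<And>k. k < n \<Longrightarrow> \<not> (\<exists>B C D. Q B C D \<and> card D = k)"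
    using exists_least_iff[of "\<lambda>n. \<exists>B C D. Q B C D \<and> card D = n"] by blast
  then obtain B C D where q: "Q B C D" and qmin: "\<And>B' C' D'. Q B' C' D' \<Longrightarrow> card D' < card D \<Longrightarrow> False"
    by blast
  have m: "mdl p A B C D" and pB: "\<not> touch E (A - {f 0}) B" and pC: "\<not> touch E (A - {f l}) C"
    using q unfolding Q_def by auto
  note mc = mdl_conn[OF m] and mt = mdl_touch[OF m] and md = mdl_disj[OF m] and ms = mdl_sets[OF m]
    and mp = mdl_pend[OF m]
  have fD: "finite D" using ms fin_V by (auto intro: finite_subset)
  show ?thesis
  proof (rule ccontr)
    assume no: "\<not> ?thesis"
    \<comment> \<open>The negated goal: no single vertex \<open>d\<close> collects all contacts of
      interior path vertices with \<open>D\<close>. In particular \<open>A\<close> still touches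
      \<open>D\<close> after any one vertex of \<open>D\<close> is taken away.\<close>
    have no: False if "d \<in> D" "\<And>i y. 0 < i \<Longrightarrow> i < l \<Longrightarrow> y \<in> D \<Longrightarrow> E (f i) y \<Longrightarrow> y = d" for d
      using no m pB pC that by blast
    have c0: "conn E (A - {f 0})"
    proof -
      have "{..l} - {0} = {1..l}" by auto
      then have "A - {f 0} = f ` {1..l}" using A_minus[of 0] by simp
      then show ?thesis using seg_conn[of 1 l] l6 by simp
    qed
    have cl: "conn E (A - {f l})"
    proof -
      have "{..l} - {l} = {0..l - 1}" using l6 by auto
      then have "A - {f l} = f ` {0..l - 1}" using A_minus[of l] by simp
      then show ?thesis using seg_conn[of 0 "l - 1"] l6 by simp
    qed
    have fin0: "card (A - {f 0}) < card A" "card (A - {f l}) < card A"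
      using fin_A[OF m] f_in[of 0] f_in[of l] by (meson card_Diff1_less order_refl le0)+
    have key: "\<not> touch E (D - {v}) B \<and> \<not> touch E (D - {v}) C"
      if v: "v \<in> D" "conn E (D - {v})" "D \<noteq> {v}" for v
    proof (rule ccontr)
      assume nkey: "\<not> ?thesis"
      have cd: "card (D - {v}) < card D" using v fD by (meson card_Diff1_less)
      have AD: "touch E A (D - {v})"
      proof (rule ccontr)
        assume "\<not> touch E A (D - {v})"
        then show False using no[OF v(1)] f_in unfolding touch_def by (metis DiffI less_imp_le singletonD)
      qed
      have vD: "touch E {v} (D - {v})" using noncut_touch mc(4) v by blast
      have BC: "touch E (D - {v}) B" if X: "\<not> touch E (D - {v}) B"
      proof -
        have C: "touch E (D - {v}) C" using nkey X by blast
        have vB: "touch E {v} B" using private_touch[OF _ X] mt(5) touch_sym[of B D] by simp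
        let ?B = "insert v B"
        have m': "mdl p X ?B C (D - {v})" if X: "X \<subseteq> A" "conn E X" "touch E X ?B" "touch E X C"
          "touch E X (D - {v})" "touch E {p} X" for X
        proof (rule mdlI)
          show "conn E X \<and> conn E ?B \<and> conn E C \<and> conn E (D - {v})"
            using X(2) v(2) mc conn_insert[OF mc(2), of v] vB touch_sym[of B "{v}"] by simp
          have "touch E ?B C" "touch E ?B (D - {v})" using mt(4) vD by (auto simp: touch_insert1[of E v B])
          then show "touch E X ?B \<and> touch E X C \<and> touch E X (D - {v}) \<and> touch E ?B C \<and> touch E ?B (D - {v})
            \<and> touch E C (D - {v})" using X C touch_sym[of C] by simp
          show "X \<inter> ?B = {} \<and> X \<inter> C = {} \<and> X \<inter> (D - {v}) = {} \<and> ?B \<inter> C = {} \<and> ?B \<inter> (D - {v}) = {} \<and> C \<inter> (D - {v}) = {}"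
            using X(1) md v(1) by auto
          show "insert p (X \<union> ?B \<union> C \<union> (D - {v})) \<subseteq> V \<and> p \<notin> X \<union> ?B \<union> C \<union> (D - {v})"
            using X(1) ms v(1) by auto
          have "\<not> E p v" "\<not> touch E {p} (D - {v})" using mp(4) v unfolding touch_def by blast+
          then show "touch E {p} X \<and> \<not> touch E {p} ?B \<and> \<not> touch E {p} C \<and> \<not> touch E {p} (D - {v})"
            using X mp by (simp add: touch_insert2[of E _ v B])
        qed
        have AB: "touch E A ?B" using mt(1) by (simp add: touch_insert2[of E _ v B])
        show ?thesis
        proof (cases "touch E (A - {f 0}) {v}")
          case False
          then have "Q ?B C (D - {v})" unfolding Q_def using m'[of A] mc mt AD mp AB pB pC
            by (simp add: touch_insert2[of E _ v B])
          then show ?thesis using qmin cd by blast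
        next
          case True
          show ?thesis
          proof (cases "touch E (A - {f 0}) (D - {v})")
            case True': True
            have "f l \<in> A - {f 0}" using f_in f_eq[of l 0] l6 by auto
            moreover have "touch E {f l} C" using priv_touch[OF m mt(2) pC] by simp
            ultimately have "touch E (A - {f 0}) C" using touch_mono[of E "{f l}" C "A - {f 0}" C] by simp
            then have "mdl p (A - {f 0}) ?B C (D - {v})"
              using m'[of "A - {f 0}"] c0 True True' p_touch[OF m] by (simp add: touch_insert2[of E _ v B])
            then show ?thesis using smaller fin0 by blast
          next
            case False
            have "y = v" if "0 < i" "i < l" "y \<in> D" "E (f i) y" for i y
              using False touchI[of E "f i" y "A - {f 0}" "D - {v}"] that f_in[of i] f_eq[of i 0] by auto
            then show ?thesis using no[OF v(1)] by blast
          qed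
        qed
      qed
      \<comment> \<open>The mirror image, with \<open>C\<close> and the end \<open>f l\<close> in
        the roles of \<open>B\<close> and \<open>f 0\<close>.\<close>
      have CB: "touch E (D - {v}) C" if X: "\<not> touch E (D - {v}) C"
      proof -
        have B: "touch E (D - {v}) B" using nkey X by blast
        have vC: "touch E {v} C" using private_touch[OF _ X] mt(6) touch_sym[of C D] by simp
        let ?C = "insert v C"
        have m': "mdl p X B ?C (D - {v})" if X: "X \<subseteq> A" "conn E X" "touch E X ?C" "touch E X B"
          "touch E X (D - {v})" "touch E {p} X" for X
        proof (rule mdlI)
          show "conn E X \<and> conn E B \<and> conn E ?C \<and> conn E (D - {v})"
            using X(2) v(2) mc conn_insert[OF mc(3), of v] vC touch_sym[of C "{v}"] by simp
          have "touch E B ?C" "touch E ?C (D - {v})" using mt(4) vD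
            by (auto simp: touch_insert1[of E v C] touch_insert2[of E _ v C])
          then show "touch E X B \<and> touch E X ?C \<and> touch E X (D - {v}) \<and> touch E B ?C \<and> touch E B (D - {v})
            \<and> touch E ?C (D - {v})" using X B mt(4) touch_sym[of B "D - {v}"] by simp
          show "X \<inter> B = {} \<and> X \<inter> ?C = {} \<and> X \<inter> (D - {v}) = {} \<and> B \<inter> ?C = {} \<and> B \<inter> (D - {v}) = {} \<and> ?C \<inter> (D - {v}) = {}"
            using X(1) md v(1) by auto
          show "insert p (X \<union> B \<union> ?C \<union> (D - {v})) \<subseteq> V \<and> p \<notin> X \<union> B \<union> ?C \<union> (D - {v})"
            using X(1) ms v(1) by auto
          have "\<not> E p v" "\<not> touch E {p} (D - {v})" using mp(4) v unfolding touch_def by blast+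
          then show "touch E {p} X \<and> \<not> touch E {p} B \<and> \<not> touch E {p} ?C \<and> \<not> touch E {p} (D - {v})"
            using X mp by (simp add: touch_insert2[of E _ v C])
        qed
        have AC: "touch E A ?C" using mt(2) by (simp add: touch_insert2[of E _ v C])
        show ?thesis
        proof (cases "touch E (A - {f l}) {v}")
          case False
          then have "Q B ?C (D - {v})" unfolding Q_def using m'[of A] mc mt AD mp AC pB pC
            by (simp add: touch_insert2[of E _ v C])
          then show ?thesis using qmin cd by blast
        next
          case True
          show ?thesis
          proof (cases "touch E (A - {f l}) (D - {v})")
            case True': True
            have "f 0 \<in> A - {f l}" using f_in f_eq[of l 0] l6 by auto
            moreover have "touch E {f 0} B" using priv_touch[OF m mt(1) pB] by simp
            ultimately have "touch E (A - {f l}) B" using touch_mono[of E "{f 0}" B "A - {f l}" B] by simp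
            then have "mdl p (A - {f l}) B ?C (D - {v})"
              using m'[of "A - {f l}"] cl True True' p_touch[OF m] by (simp add: touch_insert2[of E _ v C])
            then show ?thesis using smaller fin0 by blast
          next
            case False
            have "y = v" if "0 < i" "i < l" "y \<in> D" "E (f i) y" for i y
              using False touchI[of E "f i" y "A - {f l}" "D - {v}"] that f_in[of i] f_eq[of i l] by auto
            then show ?thesis using no[OF v(1)] by blast
          qed
        qed
      qed
      have B: "touch E (D - {v}) B" and C: "touch E (D - {v}) C" using BC CB by blast+
      have "mdl p A B C (D - {v})"
      proof (rule mdlI)
        have "\<not> touch E {p} (D - {v})" using mp(4) unfolding touch_def by blast
        then show "touch E {p} A \<and> \<not> touch E {p} B \<and> \<not> touch E {p} C \<and> \<not> touch E {p} (D - {v})"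
          using mp by simp
        show "touch E A B \<and> touch E A C \<and> touch E A (D - {v}) \<and> touch E B C \<and> touch E B (D - {v}) \<and> touch E C (D - {v})"
          using mt AD B C touch_sym[of B "D - {v}"] touch_sym[of C "D - {v}"] by simp
      qed (use mc v in simp, use md in auto, use ms in auto)
      then have "Q B C (D - {v})" unfolding Q_def using pB pC by simp
      then show False using qmin cd by blast
    qed
    obtain d where "d \<in> D" using conn_nonempty[OF mc(4)] by blast
    have "D \<noteq> {d}" for d
    proof
      assume "D = {d}"
      then show False using no[of d] by simp
    qed
    then have "card D \<ge> 2" using \<open>d \<in> D\<close> fD
      by (metis One_nat_def Suc_1 Suc_leI card_0_eq card_1_singletonE empty_iff le_neq_implies_less not_gr_zero)
    then obtain v w where vw: "v \<in> D" "w \<in> D" "v \<noteq> w" "conn E (D - {v})" "conn E (D - {w})"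
      using two_noncuts[OF mc(4) fD] by metis
    have "touch E {v} B" 
      using private_touch[of E D B v] key[OF vw(1,4)] vw mt(5) touch_sym[of B D] by auto
    then have "touch E (D - {w}) B" using vw(1,3) by (auto simp: touch_def)
    then show False using key[OF vw(2,5)] vw by blast
  qed
qed

end

end

context path_model begin

text \<open>All interior path vertices are adjacent to one vertex \<open>d\<close> of
  \<open>D\<close>, and to nothing else in \<open>D\<close>. The vertex \<open>d\<close> is
  therefore a hub, and the new model is built around it instead of around the path.\<close>

lemma two_ends:
  assumes S0: "E p (f 0)" and Sl: "E p (f l)" and m0: "mdl p A B0 C0 D0" and pB0: "\<not> touch E (A - {f 0}) B0" and pC0: "\<not> touch E (A - {f l}) C0"
  shows False
proof -
  obtain B C D d where m: "mdl p A B C D" and pB: "\<not> touch E (A - {f 0}) B"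
    and pC: "\<not> touch E (A - {f l}) C" and d: "d \<in> D"
    and dun: "\<And>i y. 0 < i \<Longrightarrow> i < l \<Longrightarrow> y \<in> D \<Longrightarrow> E (f i) y \<Longrightarrow> y = d"
    using single_attachment[OF S0 Sl m0 pB0 pC0] by blast
  note mc = mdl_conn[OF m] and mt = mdl_touch[OF m] and md = mdl_disj[OF m] and ms = mdl_sets[OF m]
    and mp = mdl_pend[OF m]
  note nB = nB[OF S0 Sl m pB pC] and nC = nC[OF S0 Sl m pB pC] and fB = B0[OF S0 Sl m pB pC] and fC = Cl[OF S0 Sl m pB pC]
  have fd: "E (f i) d" if "0 < i" "i < l" for i
    using interior_touch[OF S0 Sl m pB pC that] dun[OF that] unfolding touch_def by blast
  have fV: "f i \<in> V" "f i \<notin> B" "f i \<notin> C" "f i \<notin> D" "f i \<noteq> p" "f i \<noteq> d" if "i \<le> l" for i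
    using f_in[OF that] ms md(1-3) d by auto
  have pd: "d \<in> V" "d \<noteq> p" "d \<notin> B" "d \<notin> C" "p \<notin> B" "p \<notin> C" "p \<notin> D" "p \<in> V" "\<not> E p d"
    using ms md d mp(4) by (auto simp: touch_def)
  show False
  proof (cases "E p (f 2) \<and> E p (f 3)")
    case False
    then obtain j where j: "j = 2 \<or> j = 3" "\<not> E p (f j)" by blast
    \<comment> \<open>If \<open>f j\<close> misses \<open>p\<close>, it becomes the pendant of the
      bag around \<open>D\<close>, while \<open>f l\<close> and \<open>p\<close> form the fourth
      bag. Its only neighbour in the new bag is \<open>d\<close>, so \<open>{d}\<close> is a bounded
      attachment; non-adjacency of \<open>f 3\<close> and \<open>f (l - 1)\<close> uses that
      \<open>l\<close> is at least 6.\<close>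
    define A' where "A' = insert (f (l - 1)) D"
    define B' where "B' = insert (f 0) B"
    define X where "X = {f l, p}"
    have nE: "\<not> E (f j) (f 0)" "\<not> E (f j) (f l)" "\<not> E (f j) (f (l - 1))" "\<not> E (f j) p"
    proof -
      have "l - 1 \<noteq> j" "l - 1 \<noteq> Suc j" "j \<noteq> Suc (l - 1)" "j \<le> l" "l - 1 \<le> l" using j l6 by linarith+
      then show "\<not> E (f j) (f (l - 1))" using adjE[of j "l - 1"] by simp
    qed (use j l6 adjE[of j 0] adjE[of j l] E_sym[of "f j" p] in auto)
    have fne: "f j \<noteq> f 0" "f j \<noteq> f l" "f j \<noteq> f (l - 1)" "f 0 \<noteq> f (l - 1)" "f 0 \<noteq> f l" "f l \<noteq> f (l - 1)"
    proof -
      have "j \<le> l" "j \<noteq> 0" "j \<noteq> l" "j \<noteq> l - 1" "0 \<noteq> l - 1" "0 \<noteq> l" "l \<noteq> l - 1" "l - 1 \<le> l"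
        using j l6 by linarith+
      then show "f j \<noteq> f 0" "f j \<noteq> f l" "f j \<noteq> f (l - 1)" "f 0 \<noteq> f (l - 1)" "f 0 \<noteq> f l" "f l \<noteq> f (l - 1)"
        by (simp_all add: f_eq)
    qed
    have jl: "0 < j" "j < l" using j l6 by auto
    have "mdl (f j) A' B' C X"
    proof (rule mdlI)
      have "touch E D {f (l - 1)}" using E_sym[OF fd[of "l - 1"]] d l6 by (intro touchI[of _ d]) auto
      moreover have "touch E B {f 0}" using fB touch_sym by blast
      moreover have "touch E {p} {f l}" using Sl by simp
      ultimately show "conn E A' \<and> conn E B' \<and> conn E C \<and> conn E X"
        using conn_insert mc by (simp add: A'_def B'_def X_def)
      have "touch E A' B'" using mt(5) touch_sym[of B D] touch_mono[of E D B A' B'] by (simp add: A'_def B'_def subset_insertI)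
      moreover have "touch E A' C" using mt(6) touch_sym[of C D] touch_mono[of E D C A' C] by (simp add: A'_def subset_insertI)
      moreover have "E (f (l - 1)) (f l)" using adj[of "l - 1" l] l6 by simp
      then have "touch E A' X" by (intro touchI[of _ "f (l - 1)" "f l"]) (auto simp: A'_def X_def)
      moreover have "touch E B' C" using mt(4) by (simp add: B'_def touch_insert1[of E _ B])
      moreover have "touch E B' X" using E_sym[OF S0] by (intro touchI[of _ "f 0" p]) (auto simp: B'_def X_def)
      moreover have "touch E C X" using fC touch_sym[of "{f l}" C] touch_mono[of E C "{f l}" C X] by (simp add: X_def)
      ultimately show "touch E A' B' \<and> touch E A' C \<and> touch E A' X \<and> touch E B' C \<and> touch E B' X \<and> touch E C X"
        by simp
      show "A' \<inter> B' = {} \<and> A' \<inter> C = {} \<and> A' \<inter> X = {} \<and> B' \<inter> C = {} \<and> B' \<inter> X = {} \<and> C \<inter> X = {}"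
        using md(4-6) pd fV[of 0] fV[of l] fV[of "l - 1"] fne unfolding A'_def B'_def X_def by auto
      show "insert (f j) (A' \<union> B' \<union> C \<union> X) \<subseteq> V \<and> f j \<notin> A' \<union> B' \<union> C \<union> X"
        using ms pd fV[of 0] fV[of l] fV[of "l - 1"] fV[of j] jl fne unfolding A'_def B'_def X_def by auto
      have "touch E {f j} A'" using fd[OF jl] d by (intro touchI[of _ "f j" d]) (auto simp: A'_def)
      then show "touch E {f j} A' \<and> \<not> touch E {f j} B' \<and> \<not> touch E {f j} C \<and> \<not> touch E {f j} X"
        using nB[of j] nC[of j] jl nE by (simp add: B'_def X_def touch_insert2[of E _ _ B] touch_insert2[of E _ _ "{p}"])
    qed
    moreover have "conn E {d}" "{d} \<subseteq> A'" "card {d} \<le> 6" using d by (auto simp: A'_def)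
    ultimately have good
      by (rule goodI) (use nE dun[OF jl] in \<open>auto simp: A'_def\<close>)
    then show False using bad by simp
  next
    case True
    \<comment> \<open>If \<open>p\<close> sees \<open>f 2\<close> and \<open>f 3\<close>, these
      three form a triangle of singleton bags. The bag \<open>{f l, f (l - 1), d}\<close> touches
      all of them, and a neighbour \<open>q\<close> of \<open>d\<close> in \<open>B\<close> or
      \<open>D\<close> is the new pendant.\<close>
    define A' where "A' = {f l, f (l - 1), d}"
    have "\<exists>q. E q d \<and> q \<in> B \<union> D \<and> q \<noteq> d"
    proof (cases "touch E {d} B")
      case True
      then show ?thesis using pd E_sym unfolding touch_def by blast
    next
      case False
      then have "D \<noteq> {d}" using mt(5) touch_sym[of B D] by auto
      then have "touch E {d} (D - {d})" using noncut_touch[OF mc(4) d] by simp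
      then show ?thesis using E_sym unfolding touch_def by blast
    qed
    then obtain q where q: "E q d" "q \<in> B \<union> D" "q \<noteq> d" by blast
    have fne: "f 2 \<noteq> f 3" "f 2 \<noteq> f l" "f 2 \<noteq> f (l - 1)" "f 3 \<noteq> f l" "f 3 \<noteq> f (l - 1)"
    proof -
      have "2 \<noteq> l" "2 \<noteq> l - 1" "3 \<noteq> l" "3 \<noteq> l - 1" "2 \<le> l" "3 \<le> l" "l - 1 \<le> l"
        using l6 by linarith+
      then show "f 2 \<noteq> f 3" "f 2 \<noteq> f l" "f 2 \<noteq> f (l - 1)" "f 3 \<noteq> f l" "f 3 \<noteq> f (l - 1)"
        by (simp_all add: f_eq)
    qed
    have qn: "\<not> E q p" "\<not> E q (f 2)" "\<not> E q (f 3)"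
    proof -
      show "\<not> E q p" using q mp(2,4) E_sym[of q p] by (auto simp: touch_def)
      show "\<not> E q (f 2)" using q E_sym[of q "f 2"] dun[of 2 q] nB[of 2] l6 by (auto simp: touch_def)
      show "\<not> E q (f 3)" using q E_sym[of q "f 3"] dun[of 3 q] nB[of 3] l6 by (auto simp: touch_def)
    qed
    have q': "q \<in> V" "q \<noteq> p" "\<And>i. i \<le> l \<Longrightarrow> q \<noteq> f i" using q ms fV pd by auto
    have "mdl q A' {p} {f 2} {f 3}"
    proof (rule mdlI)
      have "conn E {f (l - 1), d}" using conn_insert[of "{d}"] E_sym[OF fd[of "l - 1"]] l6 by simp
      moreover have "touch E {f (l - 1), d} {f l}" using adj[of "l - 1" l] l6
        by (intro touchI[of _ "f (l - 1)" "f l"]) auto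
      ultimately show "conn E A' \<and> conn E {p} \<and> conn E {f 2} \<and> conn E {f 3}"
        using conn_insert by (simp add: A'_def)
      have "touch E A' {p}" using E_sym[OF Sl] by (intro touchI[of _ "f l"]) (auto simp: A'_def)
      moreover have "touch E A' {f 2}" using E_sym[OF fd[of 2]] l6 by (intro touchI[of _ d]) (auto simp: A'_def)
      moreover have "touch E A' {f 3}" using E_sym[OF fd[of 3]] l6 by (intro touchI[of _ d]) (auto simp: A'_def)
      moreover have "E (f 2) (f 3)" using adj[of 2 3] l6 by simp
      ultimately show "touch E A' {p} \<and> touch E A' {f 2} \<and> touch E A' {f 3} \<and> touch E {p} {f 2} \<and>
        touch E {p} {f 3} \<and> touch E {f 2} {f 3}" using True by simp
      show "A' \<inter> {p} = {} \<and> A' \<inter> {f 2} = {} \<and> A' \<inter> {f 3} = {} \<and> {p} \<inter> {f 2} = {} \<and> {p} \<inter> {f 3} = {} \<and> {f 2} \<inter> {f 3} = {}"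
        using fne pd fV[of 2] fV[of 3] fV[of l] fV[of "l - 1"] l6 by (auto simp: A'_def)
      show "insert q (A' \<union> {p} \<union> {f 2} \<union> {f 3}) \<subseteq> V \<and> q \<notin> A' \<union> {p} \<union> {f 2} \<union> {f 3}"
        using q' q(3) fV[of 2] fV[of 3] fV[of l] fV[of "l - 1"] pd l6 by (auto simp: A'_def)
      have "touch E {q} A'" using q by (intro touchI[of _ q d]) (auto simp: A'_def)
      then show "touch E {q} A' \<and> \<not> touch E {q} {p} \<and> \<not> touch E {q} {f 2} \<and> \<not> touch E {q} {f 3}"
        using qn by simp
    qed
    moreover have "card A' \<le> 3" unfolding A'_def by (simp add: card_insert_if)
    then have "card A' < card A" using card_A_l l6 by simp
    ultimately show False by (rule smaller)
  qed
qed

end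

section \<open>Excluding the minimal counterexample\<close>

context min_model
begin

text \<open>Three bags cannot provide two private bags for each of two non-cut vertices, so one of
  them is adjacent to \<open>p\<close>. The other is either adjacent to \<open>p\<close> too
  (\<open>two_ends\<close>) or private for the two remaining bags (\<open>one_end\<close>).\<close>

lemma no_model:
  assumes m: "mdl p A B C D"
  shows False
proof -
  define P where "P v X = (\<not> touch E (A - {v}) X)" for v X
  note m1 = m mdl_perm[OF m]
  note m2 = m1 mdl_perm(1)[OF m1(3)] mdl_perm(2)[OF m1(2)] mdl_perm(1)[OF mdl_perm(2)[OF m1(2)]]
  have c2: "2 \<le> card A" using card_A[OF m] by simp
  obtain u w where uw: "u \<in> A" "w \<in> A" "u \<noteq> w" and cuw: "conn E (A - {u})" "conn E (A - {w})"
    using two_noncuts[OF mdl_conn(1)[OF m] fin_A[OF m] c2] .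
  have one: "P v B \<or> P v C \<or> P v D" if "v \<in> {u, w}" for v
    using priv1[OF m, of v] that uw cuw unfolding P_def by auto
  have two: "E p v \<or> (P v B \<and> P v C) \<or> (P v B \<and> P v D) \<or> (P v C \<and> P v D)" if "v \<in> {u, w}" for v
  proof -
    have "v \<in> A" "conn E (A - {v})" using that uw cuw by auto
    from priv2[OF m2(1) this] priv2[OF m2(2) this] priv2[OF m2(4) this] one[OF that]
    show ?thesis unfolding P_def by argo
  qed
  have uni: "\<not> (P u X \<and> P w X)" if "X \<in> {B, C, D}" for X
    using priv_unique[OF m _ uw(3), of X] that mdl_touch[OF m] unfolding P_def by auto
  have rot: False if v: "u' = u \<and> w' = w \<or> u' = w \<and> w' = u" and S: "E p u'" for u' w'
  proof -
    have uw': "u' \<in> A" "w' \<in> A" "u' \<noteq> w'" "conn E (A - {u'})" "conn E (A - {w'})" using v uw cuw by auto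
    obtain f l where f: "f 0 = u'" "f l = w'" "f ` {..l} \<subseteq> A" "inj_on f {..l}"
      "\<And>i j. i < j \<Longrightarrow> j \<le> l \<Longrightarrow> E (f i) (f j) \<longleftrightarrow> j = Suc i"
      using induced_path[OF mdl_conn(1)[OF m] uw'(1,2)] by metis
    have cf: "conn E (f ` {..l})"
      using conn_segment[of 0 l f] f(5) by (simp add: atLeast0AtMost)
    \<comment> \<open>A vertex of \<open>A\<close> off the induced path between two non-cut vertices
      would yield a third non-cut vertex.\<close>
    have Af: "A = f ` {..l}"
    proof (rule ccontr)
      assume "A \<noteq> f ` {..l}"
      then obtain z where z: "z \<in> A" "z \<notin> f ` {..l}" "conn E (A - {z})"
        using noncut_outside[OF mdl_conn(1)[OF m] fin_A[OF m] cf] f(3) by auto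
      moreover have "u' \<in> f ` {..l}" "w' \<in> f ` {..l}" using f(1,2) by auto
      ultimately show False using not_three_noncuts[OF m uw'(1,2) z(1) uw'(3) _ _ uw'(4,5) z(3)] by metis
    qed
    have "card A = Suc l" using f(4) by (simp add: Af card_image)
    then have l6: "6 \<le> l" using card_A[OF m] by simp
    interpret path_model E V p A f l
      by unfold_locales (use Af f l6 in auto)
    have k1: "mdl p A X Y Z \<Longrightarrow> \<not> (P u' X \<and> P w' Y \<and> P w' Z \<and> \<not> E p w')" for X Y Z
      using one_end[of X Y Z] S f(1,2) unfolding P_def by metis
    have k2: "mdl p A X Y Z \<Longrightarrow> \<not> (P u' X \<and> P w' Y \<and> E p w')" for X Y Z
      using two_ends[of X Y Z] S f(1,2) unfolding P_def by metis
    have a: "P u' B \<or> P u' C \<or> P u' D" "P w' B \<or> P w' C \<or> P w' D"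
      "E p w' \<or> (P w' B \<and> P w' C) \<or> (P w' B \<and> P w' D) \<or> (P w' C \<and> P w' D)"
      "\<not> (P u' B \<and> P w' B)" "\<not> (P u' C \<and> P w' C)" "\<not> (P u' D \<and> P w' D)"
      using v one[of u] one[of w] two[of u] two[of w] uni[of B] uni[of C] uni[of D] by auto
    show False
      using a k1[OF m2(1)] k1[OF m2(2)] k1[OF m2(4)] k2[OF m2(1)] k2[OF m2(2)] k2[OF m2(3)] k2[OF m2(4)]
        k2[OF m2(5)] k2[OF m2(6)] by argo
  qed
  have "E p u \<or> E p w"
    using two[of u] two[of w] uni[of B] uni[of C] uni[of D] by auto
  then show False using rot by blast
qed

end

context fin_graph
begin

theorem bounded_attachment:
  assumes "mdl p A B C D"
  shows good
proof (rule ccontr)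
  assume bad: "\<not> good"
  define W where "W n \<longleftrightarrow> (\<exists>p A B C D. mdl p A B C D \<and> card A = n)" for n
  have "\<exists>n. W n" using assms unfolding W_def by blast
  then obtain n where n: "W n" "\<And>k. k < n \<Longrightarrow> \<not> W k" using exists_least_iff[of W] by blast
  then obtain p A B C D where m: "mdl p A B C D" "card A = n" unfolding W_def by blast
  have mn: "card A \<le> card A'" if "mdl p' A' B' C' D'" for p' A' B' C' D'
  proof -
    have "W (card A')" using that unfolding W_def by blast
    then show ?thesis using n(2) m(2) not_less by blast
  qed
  interpret min_model E V p A
    by unfold_locales (rule bad, rule mn)
  show False using no_model[OF m(1)] .
qed

end

section \<open>Pairwise inseparable vertices inside a K4 model\<close>

section \<open>K4 minors and inseparable vertices\<close>

text \<open>\<open>x\<close> and \<open>y\<close> may coincide or lie outside \<open>V\<close>, so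
  separation by fewer than two vertices is excluded as well.\<close>

definition insep :: "('a \<Rightarrow> 'a \<Rightarrow> bool) \<Rightarrow> 'a set \<Rightarrow> 'a \<Rightarrow> 'a \<Rightarrow> bool" where
  "insep E V a b \<longleftrightarrow> (\<forall>x y. x \<notin> {a, b} \<longrightarrow> y \<notin> {a, b} \<longrightarrow> reach E (V - {x, y}) a b)"

context sym_graph
begin

text \<open>The vertex \<open>t\<close> plays the part of the centre of a tripod with one leg to
  each set \<open>N i\<close>, stated in cut form: deleting \<open>X\<close> cuts off at most as
  many sets as it has vertices in \<open>A\<close>. By induction a non-cut vertex \<open>v\<close>
  is removed, and the sets that met \<open>A\<close> only in \<open>v\<close> are replaced by the
  neighbourhood of \<open>v\<close>. If \<open>X\<close> contains \<open>v\<close>, at most one set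
  is lost, and \<open>v\<close> itself pays for it.\<close>

lemma tripod:
  assumes "finite A" "conn E A" "finite I" "card I \<le> 3" "\<And>i. i \<in> I \<Longrightarrow> N i \<inter> A \<noteq> {}"
  shows "\<exists>t\<in>A. \<forall>X. t \<notin> X \<longrightarrow>
    card I \<le> card {i \<in> I. \<exists>s \<in> N i \<inter> A - X. reach E (A - X) t s} + card (X \<inter> A)"
  using assms
proof (induction "card A" arbitrary: A N rule: less_induct)
  case less
  let ?R = "\<lambda>A N X t. {i \<in> I. \<exists>s \<in> N i \<inter> A - X. reach E (A - X) t s}"
  show ?case
  proof (cases "card A \<ge> 2")
    case False
    moreover have "card A \<noteq> 0" using conn_nonempty less.prems by auto
    ultimately have "card A = 1" by simp
    then obtain t where t: "A = {t}" using card_1_singletonE by blast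
    have "?R A N X t = I" if "t \<notin> X" for X using less.prems(5) that t by auto
    then show ?thesis using t by auto
  next
    case True
    then obtain u w where uw: "u \<in> A" "w \<in> A" "u \<noteq> w" "conn E (A - {u})" "conn E (A - {w})"
      using two_noncuts[OF less.prems(2,1)] by metis
    \<comment> \<open>The index sets of two non-cut vertices are disjoint subsets of a set of size
      at most 3, so one of them has at most one element. This is where the bound 3 enters.\<close>
    define P where "P v = {i \<in> I. N i \<inter> A = {v}}" for v
    have fP: "finite (P v)" for v using less.prems(3) by (simp add: P_def)
    have "P u \<inter> P w = {}" using uw(3) by (auto simp: P_def)
    then have "card (P u) + card (P w) = card (P u \<union> P w)" using fP by (simp add: card_Un_disjoint)
    also have "\<dots> \<le> card I" using less.prems(3) by (intro card_mono) (auto simp: P_def)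
    finally have "card (P u) \<le> 1 \<or> card (P w) \<le> 1" using less.prems(4) by linarith
    then obtain v where v: "v \<in> A" "conn E (A - {v})" "card (P v) \<le> 1" using uw by blast
    have "A \<noteq> {v}" using True by auto
    define N' where "N' i = (if i \<in> P v then {z. E v z} else N i)" for i
    have ne: "N' i \<inter> (A - {v}) \<noteq> {}" if "i \<in> I" for i
    proof (cases "i \<in> P v")
      case True
      then show ?thesis using noncut_touch[OF less.prems(2) v(1) \<open>A \<noteq> {v}\<close>] by (auto simp: N'_def touch_def)
    next
      case False
      then show ?thesis using less.prems(5)[OF that] that by (auto simp: N'_def P_def)
    qed
    have "card (A - {v}) < card A" using v less.prems(1) by (meson card_Diff1_less)
    from less.hyps[OF this finite_Diff[OF less.prems(1)] v(2) less.prems(3,4), of N'] ne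
    obtain t where t: "t \<in> A - {v}"
      "\<And>X. t \<notin> X \<Longrightarrow> card I \<le> card (?R (A - {v}) N' X t) + card (X \<inter> (A - {v}))"
      by auto
    have fR: "finite (?R A N X t)" for X using less.prems(3) by simp
    have "card I \<le> card (?R A N X t) + card (X \<inter> A)" if tX: "t \<notin> X" for X
    proof (cases "v \<in> X")
      case False
      have "?R (A - {v}) N' X t \<subseteq> ?R A N X t"
      proof
        fix i assume "i \<in> ?R (A - {v}) N' X t"
        then obtain s where s: "i \<in> I" "s \<in> N' i" "s \<in> A - {v} - X" "reach E (A - {v} - X) t s" by auto
        have r: "reach E (A - X) t s" using s(4) by (rule reach_mono) auto
        show "i \<in> ?R A N X t"
        proof (cases "i \<in> P v")
          case True
          then have "E s v" using s E_sym by (auto simp: N'_def)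
          then have "reach E (A - X) t v" using reach_trans[OF r reach_step[of s "A - X" v E]] s v False by auto
          moreover have "v \<in> N i \<inter> A - X" using True v False by (auto simp: P_def)
          ultimately show ?thesis using s(1) by blast
        next
          case False
          then show ?thesis using s r by (auto simp: N'_def)
        qed
      qed
      then have "card (?R (A - {v}) N' X t) \<le> card (?R A N X t)" using fR by (rule card_mono[rotated])
      moreover have "X \<inter> (A - {v}) = X \<inter> A" using False by auto
      ultimately show ?thesis using t(2)[OF tX] by simp
    next
      case True
      then have e: "A - {v} - X = A - X" by auto
      have "?R (A - {v}) N' X t \<subseteq> ?R A N X t \<union> P v"
        unfolding e by (auto simp: N'_def split: if_splits)
      then have "card (?R (A - {v}) N' X t) \<le> card (?R A N X t \<union> P v)"
        using fR fP by (intro card_mono) auto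
      also have "\<dots> \<le> card (?R A N X t) + card (P v)" by (rule card_Un_le)
      finally have "card (?R (A - {v}) N' X t) \<le> card (?R A N X t) + 1" using v(3) by linarith
      moreover have "X \<inter> A = insert v (X \<inter> (A - {v}))" using True v(1) by auto
      then have "card (X \<inter> A) = Suc (card (X \<inter> (A - {v})))" using less.prems(1) by simp
      ultimately show ?thesis using t(2)[OF tX] by linarith
    qed
    then show ?thesis using t(1) by blast
  qed
qed

text \<open>In each bag take the tripod centre for the contacts with the other three bags. After
  deleting at most two vertices, every surviving centre still reaches a bag that has lost nothing,
  and all such bags are linked to each other.\<close>

lemma bags_insep:
  fixes Bg :: "nat \<Rightarrow> 'a set"
  assumes fin: "finite V" and sub: "\<And>i. i < 4 \<Longrightarrow> Bg i \<subseteq> V" and c: "\<And>i. i < 4 \<Longrightarrow> conn E (Bg i)"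
    and disj: "\<And>i j. i < 4 \<Longrightarrow> j < 4 \<Longrightarrow> i \<noteq> j \<Longrightarrow> Bg i \<inter> Bg j = {}"
    and tch: "\<And>i j. i < 4 \<Longrightarrow> j < 4 \<Longrightarrow> i \<noteq> j \<Longrightarrow> touch E (Bg i) (Bg j)"
  shows "\<exists>t. (\<forall>i<4. t i \<in> Bg i) \<and> (\<forall>i<4. \<forall>j<4. i \<noteq> j \<longrightarrow> insep E V (t i) (t j))"
proof -
  define N where "N i j = {s \<in> Bg i. touch E {s} (Bg j)}" for i j
  define R where "R i X t = {j \<in> {..<4} - {i}. \<exists>s \<in> N i j \<inter> Bg i - X. reach E (Bg i - X) t s}" for i X t
  have "\<exists>t\<in>Bg i. \<forall>X. t \<notin> X \<longrightarrow> card ({..<4::nat} - {i}) \<le> card (R i X t) + card (X \<inter> Bg i)" if "i < 4" for i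
    unfolding R_def
  proof (rule tripod)
    show "finite (Bg i)" using sub[OF that] fin by (rule finite_subset)
    fix j :: nat assume "j \<in> {..<4} - {i}"
    then show "N i j \<inter> Bg i \<noteq> {}" using tch[of i j] that by (auto simp: N_def touch_def)
  qed (use c that in auto)
  then obtain t where t: "\<And>i. i < 4 \<Longrightarrow> t i \<in> Bg i"
    "\<And>i X. i < 4 \<Longrightarrow> t i \<notin> X \<Longrightarrow> card ({..<4::nat} - {i}) \<le> card (R i X (t i)) + card (X \<inter> Bg i)"
    by metis
  define Fr where "Fr X j \<longleftrightarrow> j < 4 \<and> Bg j \<inter> X = {}" for X j
  have bag_reach: "reach E (V - X) a b" if "i < 4" "Bg i \<inter> X = {}" "a \<in> Bg i" "b \<in> Bg i" for X i a b
  proof -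
    have "reach E (Bg i) a b" using c that unfolding conn_def by blast
    then show ?thesis by (rule reach_mono) (use sub[OF that(1)] that(2) in auto)
  qed
  have FF: "reach E (V - X) a b" if F: "Fr X i" "Fr X j" "a \<in> Bg i" "b \<in> Bg j" for X i j a b
  proof (cases "i = j")
    case False
    then obtain p q where pq: "p \<in> Bg i" "q \<in> Bg j" "E p q" using tch[of i j] F(1,2) False unfolding Fr_def touch_def by auto
    have "p \<in> V - X" "q \<in> V - X" using pq F sub unfolding Fr_def by auto
    then have "reach E (V - X) p q" using pq(3) by (intro reach_step)
    then show ?thesis using bag_reach[of i X] bag_reach[of j X] pq F unfolding Fr_def by (meson reach_trans)
  qed (use bag_reach F Fr_def in blast)
  have TF: "\<exists>j b. Fr X j \<and> b \<in> Bg j \<and> reach E (V - X) (t i) b"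
    if i: "i < 4" "t i \<notin> X" "finite X" "card X \<le> 2" for X i
  proof (cases "Fr X i")
    case True
    then show ?thesis using t(1) i by (meson reach_refl)
  next
    case False
    have "\<exists>j\<in>R i X (t i). Fr X j"
    proof (rule ccontr)
      assume no: "\<not> ?thesis"
      \<comment> \<open>\<open>h\<close> names the bag of a vertex. Every damaged bag reached from
        \<open>t i\<close> contains a vertex of \<open>X\<close> outside \<open>Bg i\<close>, so
        damaged bags are at most as many as such vertices; the count given by \<open>tripod\<close>
        leaves an undamaged one.\<close>
      define h where "h x = (SOME j. j < 4 \<and> x \<in> Bg j)" for x
      have h: "h x = j" if "j < 4" "x \<in> Bg j" for x j
      proof -
        have "h x < 4 \<and> x \<in> Bg (h x)" unfolding h_def by (rule someI[of _ j]) (use that in simp)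
        then show ?thesis using disj that by blast
      qed
      have "R i X (t i) \<subseteq> h ` (X - Bg i)"
      proof
        fix j assume "j \<in> R i X (t i)"
        then have "j < 4" "j \<noteq> i" "\<not> Fr X j" using no by (auto simp: R_def)
        then obtain x where "x \<in> X" "x \<in> Bg j" unfolding Fr_def by blast
        moreover have "x \<notin> Bg i" using disj \<open>j < 4\<close> \<open>j \<noteq> i\<close> i(1) \<open>x \<in> Bg j\<close> by blast
        ultimately show "j \<in> h ` (X - Bg i)" using h \<open>j < 4\<close> by (intro image_eqI[of _ _ x]) auto
      qed
      then have "card (R i X (t i)) \<le> card (h ` (X - Bg i))" using i(3) by (intro card_mono) auto
      also have "\<dots> \<le> card (X - Bg i)" using i(3) by (intro card_image_le) auto
      finally have "card (R i X (t i)) + card (X \<inter> Bg i) \<le> card (X - Bg i) + card (X \<inter> Bg i)" by simp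
      also have "\<dots> = card X" using i(3) by (metis Int_commute add.commute card_Int_Diff)
      finally show False using t(2)[OF i(1,2)] i(1,4) by simp
    qed
    then obtain j s where j: "Fr X j" "s \<in> N i j" "s \<in> Bg i - X" "reach E (Bg i - X) (t i) s"
      unfolding R_def by blast
    then obtain b where b: "b \<in> Bg j" "E s b" unfolding N_def touch_def by blast
    have "reach E (V - X) (t i) s" using j(4) by (rule reach_mono) (use sub i in auto)
    moreover have "s \<in> V - X" "b \<in> V - X" using j b sub i unfolding Fr_def by auto
    ultimately have "reach E (V - X) (t i) b" using b(2) reach_trans reach_step by metis
    then show ?thesis using j(1) b(1) by blast
  qed
  have "insep E V (t i) (t j)" if ij: "i < 4" "j < 4" for i j
    unfolding insep_def
  proof (intro allI impI)
    fix x y assume xy: "x \<notin> {t i, t j}" "y \<notin> {t i, t j}"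
    have X: "finite {x, y}" "card {x, y} \<le> 2" by (auto simp: card_insert_if)
    obtain a k b k' where "Fr {x, y} k" "a \<in> Bg k" "reach E (V - {x, y}) (t i) a"
      "Fr {x, y} k'" "b \<in> Bg k'" "reach E (V - {x, y}) (t j) b"
      using TF[OF ij(1) _ X] TF[OF ij(2) _ X] xy by auto
    then show "reach E (V - {x, y}) (t i) (t j)"
      using FF[of "{x, y}" k k' a b] reach_sym reach_trans by metis
  qed
  then show ?thesis using t(1) by blast
qed

lemma k4_insep:
  assumes "finite V" "k4 E A B C D" "A \<union> B \<union> C \<union> D \<subseteq> V"
  shows "\<exists>a\<in>A. \<exists>b\<in>B. \<exists>c\<in>C. \<exists>d\<in>D. insep E V a b \<and> insep E V a c \<and> insep E V a d \<and>
    insep E V b c \<and> insep E V b d \<and> insep E V c d"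
proof -
  have k: "conn E A" "conn E B" "conn E C" "conn E D" "touch E A B" "touch E A C" "touch E A D"
     "touch E B C" "touch E B D" "touch E C D" "A \<inter> B = {}" "A \<inter> C = {}" "A \<inter> D = {}" "B \<inter> C = {}" "B \<inter> D = {}" "C \<inter> D = {}"
    using assms(2) unfolding k4_def tri_def by (simp_all add: Int_Un_distrib)
  note k' = k(5-10)[THEN touch_sym[THEN iffD1]]
  define Bg where "Bg i = [A, B, C, D] ! i" for i
  have all: "(\<forall>i<4. P i) \<longleftrightarrow> P 0 \<and> P 1 \<and> P 2 \<and> P 3" for P :: "nat \<Rightarrow> bool"
    by (auto simp: numeral_eq_Suc less_Suc_eq)
  have bg: "Bg 0 = A" "Bg 1 = B" "Bg 2 = C" "Bg 3 = D" by (simp_all add: Bg_def)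
  have "\<forall>i<4. Bg i \<subseteq> V" "\<forall>i<4. conn E (Bg i)" unfolding all bg using k assms(3) by auto
  moreover have "\<forall>i<4. \<forall>j<4. i \<noteq> j \<longrightarrow> touch E (Bg i) (Bg j)" unfolding all bg using k k' by simp
  moreover have "\<forall>i<4. \<forall>j<4. i \<noteq> j \<longrightarrow> Bg i \<inter> Bg j = {}" unfolding all bg using k by (simp add: Int_commute)
  ultimately obtain t where "\<forall>i<4. t i \<in> Bg i" "\<forall>i<4. \<forall>j<4. i \<noteq> j \<longrightarrow> insep E V (t i) (t j)"
    using bags_insep[OF assms(1), of Bg] by auto
  then show ?thesis unfolding all bg
    by (intro bexI[of _ "t 0"] bexI[of _ "t 1"] bexI[of _ "t 2"] bexI[of _ "t 3"]) auto
qed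

end

lemma k4_pull:
  assumes "sym_graph E" "k4 (contr f U E) A B C D" "\<And>a. a \<in> A \<union> B \<union> C \<union> D \<Longrightarrow> conn E (U \<inter> f -` {a})"
  shows "k4 E (U \<inter> f -` A) (U \<inter> f -` B) (U \<inter> f -` C) (U \<inter> f -` D)"
  using assms(2) conn_pull[OF assms(1), of f U A] conn_pull[OF assms(1), of f U B]
    conn_pull[OF assms(1), of f U C] conn_pull[OF assms(1), of f U D] assms(3)
  unfolding k4_def tri_def touch_contr by auto

section \<open>K4 minors in graphs of minimum degree three\<close>

context sym_graph
begin

text \<open>A component in which at most one vertex \<open>y\<close> has small degree contains a
  cycle, here as a triangle of bags: a non-cut vertex \<open>v\<close>, one neighbour
  \<open>s\<close> of it, and the part \<open>L\<close> around a second neighbour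
  \<open>t\<close>.\<close>

lemma tri_if_degree_2:
  assumes fin: "finite U" and card: "card U \<ge> 2"
    and deg: "\<And>v. v \<in> U \<Longrightarrow> v \<noteq> y \<Longrightarrow> \<exists>s\<in>U. \<exists>t\<in>U. s \<noteq> t \<and> s \<noteq> v \<and> t \<noteq> v \<and> E v s \<and> E v t"
  shows "\<exists>B C D. tri E B C D \<and> B \<union> C \<union> D \<subseteq> U"
proof -
  have "\<not> U \<subseteq> {y}" using card card_mono[of "{y}" U] by auto
  then obtain u where u: "u \<in> U" "u \<noteq> y" by blast
  define K where "K = {z \<in> U. reach E U u z}"
  have K: "conn E K" "finite K" "u \<in> K" using conn_component u fin by (auto simp: K_def)
  have nbr: "t \<in> K" if "v \<in> K" "t \<in> U" "E v t" for v t
    using that reach_trans[OF _ reach_step[of v U t E]] by (auto simp: K_def)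
  obtain s0 where "s0 \<in> K" "s0 \<noteq> u" using deg[OF u] nbr K(3) by metis
  then have "card {u, s0} \<le> card K" using K by (intro card_mono) auto
  then have "card K \<ge> 2" using \<open>s0 \<noteq> u\<close> by simp
  then obtain v where v: "v \<in> K" "v \<noteq> y" "conn E (K - {v})" using two_noncuts[OF K(1,2)] by metis
  obtain s t where st: "s \<in> U" "t \<in> U" "s \<noteq> t" "s \<noteq> v" "t \<noteq> v" "E v s" "E v t"
    using deg[of v] v by (auto simp: K_def)
  then have stK: "s \<in> K" "t \<in> K" using nbr v by auto
  define L where "L = {z \<in> K - {v, s}. reach E (K - {v, s}) t z}"
  have tL: "t \<in> K - {v, s}" using stK st by auto
  have L: "conn E L" "t \<in> L" "L \<subseteq> K - {v, s}" using conn_component[OF tL] tL by (auto simp: L_def)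
  have "s \<in> K - {v}" "s \<notin> L" using st stK L by auto
  then obtain p q where pq: "p \<in> L" "q \<in> K - {v} - L" "E p q"
    using conn_crossing[OF v(3), of L] L by (metis Diff_insert2 insert_Diff_if Diff_subset empty_iff subset_trans)
  \<comment> \<open>\<open>L\<close> is a component after the removal of \<open>v\<close> and
    \<open>s\<close>, so an edge leaving it within the connected set \<open>K - {v}\<close> can only
    end in \<open>s\<close>.\<close>
  have "q = s"
  proof (rule ccontr)
    assume "q \<noteq> s"
    then have q: "q \<in> K - {v, s}" using pq by auto
    then have "reach E (K - {v, s}) t q"
      using pq reach_trans[OF _ reach_step[of p "K - {v, s}" q E]] by (auto simp: L_def)
    then show False using q pq by (auto simp: L_def)
  qed
  then have "touch E {s} L" using pq E_sym by (auto simp: touch_def)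
  moreover have "touch E {v} L" using st L by (auto simp: touch_def)
  ultimately have "tri E {v} {s} L" using L st unfolding tri_def by auto
  moreover have "{v} \<union> {s} \<union> L \<subseteq> U" using L v stK by (auto simp: K_def)
  ultimately show ?thesis by blast
qed

lemma triD:
  assumes "tri E B C D"
  shows "conn E B" "conn E C" "conn E D" "B \<inter> C = {}" "B \<inter> D = {}" "C \<inter> D = {}"
    "touch E B C" "touch E B D" "touch E C D"
  using assms unfolding tri_def by auto

text \<open>The bag holding \<open>x\<close> and \<open>y\<close> is made as small as possible while
  the others only grow. A non-cut vertex other than \<open>x\<close>, \<open>y\<close> would then be
  the only contact with both other bags; \<open>x\<close> or \<open>y\<close>, if non-cut, is the
  only contact with at least one, as no triangle model avoids it. Two non-cut vertices can share no
  such bag, so they are \<open>x\<close> and \<open>y\<close> with one bag each, and one of them can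
  change sides.\<close>

lemma split_bag:
  assumes fin: "finite W" and t: "tri E B C D" "B \<union> C \<union> D \<subseteq> W" and xy: "x \<in> B" "y \<in> B" "x \<noteq> y"
    and all: "\<And>B C D. tri E B C D \<Longrightarrow> B \<union> C \<union> D \<subseteq> W \<Longrightarrow> x \<in> B \<union> C \<union> D \<and> y \<in> B \<union> C \<union> D"
  shows "\<exists>B' C' D'. tri E B' C' D' \<and> B' \<union> C' \<union> D' \<subseteq> W \<and> C \<subseteq> C' \<and> D \<subseteq> D' \<and>
    (x \<in> B' \<and> y \<in> D' \<or> y \<in> B' \<and> x \<in> D')"
proof -
  define Q where "Q B' C' D' \<longleftrightarrow> tri E B' C' D' \<and> B' \<union> C' \<union> D' \<subseteq> W \<and> C \<subseteq> C' \<and> D \<subseteq> D' \<and> x \<in> B' \<and> y \<in> B'"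
    for B' C' D'
  have "\<exists>n B C D. Q B C D \<and> card B = n" using t xy unfolding Q_def by blast
  then obtain n where "\<exists>B C D. Q B C D \<and> card B = n" "\<And>k. k < n \<Longrightarrow> \<not> (\<exists>B C D. Q B C D \<and> card B = k)"
    using exists_least_iff[of "\<lambda>n. \<exists>B C D. Q B C D \<and> card B = n"] by blast
  then obtain B' C' D' where q: "Q B' C' D'" and qmin: "\<And>X Y Z. Q X Y Z \<Longrightarrow> card X < card B' \<Longrightarrow> False"
    by blast
  have tr: "tri E B' C' D'" and sub: "B' \<union> C' \<union> D' \<subseteq> W" "C \<subseteq> C'" "D \<subseteq> D'" "x \<in> B'" "y \<in> B'"
    using q unfolding Q_def by auto
  note T = triD[OF tr]
  have fB: "finite B'" using sub fin by (meson finite_subset le_sup_iff)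
  define P where "P v X = (\<not> touch E (B' - {v}) X)" for v X
  have Pt: "touch E {v} X" if "P v X" "touch E B' X" for v X
    using that unfolding P_def touch_def by blast
  have one: "P v C' \<or> P v D'" if v: "v \<in> {x, y}" "conn E (B' - {v})" for v
  proof (rule ccontr)
    assume "\<not> ?thesis"
    then have "tri E (B' - {v}) C' D'" using T v unfolding tri_def P_def by auto
    moreover have "(B' - {v}) \<union> C' \<union> D' \<subseteq> W" using sub by blast
    moreover have "v \<in> B'" using v sub by auto
    then have "v \<notin> C'" "v \<notin> D'" using T(4,5) by auto
    ultimately show False using all[of "B' - {v}" C' D'] v(1) by auto
  qed
  have B'v: "touch E (B' - {v}) {v}" if "v \<in> B'" for v
  proof -
    have "B' \<noteq> {v}" using xy(3) sub by auto
    then show ?thesis using noncut_touch[OF T(1) that] touch_sym[of "{v}" "B' - {v}"] by simp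
  qed
  have move: "tri E (B' - {v}) C' (insert v D')" if "v \<in> B'" "conn E (B' - {v})" "P v D'" "\<not> P v C'" for v
  proof -
    have "touch E {v} D'" using Pt[of v D'] that T by simp
    then have "conn E (insert v D')" using conn_insert[OF T(3), of v] touch_sym[of "{v}" D'] by simp
    moreover have "touch E (B' - {v}) (insert v D')" using B'v[OF that(1)] by (simp add: touch_insert2[of E _ v D'])
    moreover have "touch E C' (insert v D')" using T(9) by (simp add: touch_insert2[of E _ v D'])
    ultimately show ?thesis using that T unfolding tri_def P_def by auto
  qed
  have move': "tri E (B' - {v}) (insert v C') D'" if "v \<in> B'" "conn E (B' - {v})" "P v C'" "\<not> P v D'" for v
  proof -
    have "touch E {v} C'" using Pt[of v C'] that T by simp
    then have "conn E (insert v C')" using conn_insert[OF T(2), of v] touch_sym[of "{v}" C'] by simp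
    moreover have "touch E (B' - {v}) (insert v C')" using B'v[OF that(1)] by (simp add: touch_insert2[of E _ v C'])
    moreover have "touch E (insert v C') D'" using T(9) by (simp add: touch_insert1[of E v C'])
    ultimately show ?thesis using that T unfolding tri_def P_def by auto
  qed
  have two: "P v C' \<and> P v D'" if v: "v \<in> B'" "v \<notin> {x, y}" "conn E (B' - {v})" for v
  proof (rule ccontr)
    assume n: "\<not> ?thesis"
    have c: "card (B' - {v}) < card B'" using v fB by (meson card_Diff1_less)
    have "tri E (B' - {v}) C' D' \<or> tri E (B' - {v}) (insert v C') D' \<or> tri E (B' - {v}) C' (insert v D')"
    proof (cases "P v C' \<or> P v D'")
      case False
      then have "tri E (B' - {v}) C' D'" using T v unfolding tri_def P_def by auto
      then show ?thesis by simp
    next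
      case True
      then show ?thesis using n move[OF v(1,3)] move'[OF v(1,3)] by blast
    qed
    then have "Q (B' - {v}) C' D' \<or> Q (B' - {v}) (insert v C') D' \<or> Q (B' - {v}) C' (insert v D')"
      unfolding Q_def using sub v by auto
    then show False using qmin c by blast
  qed
  have uni: "\<not> (P v X \<and> P w X)" if "v \<noteq> w" "touch E B' X" for v w X
    using that unfolding P_def touch_def by blast
  have "card {x, y} \<le> card B'" using fB sub by (intro card_mono) auto
  then have "card B' \<ge> 2" using xy(3) by simp
  then obtain v w where vw: "v \<in> B'" "w \<in> B'" "v \<noteq> w" "conn E (B' - {v})" "conn E (B' - {w})"
    using two_noncuts[OF T(1) fB] by metis
  have u: "\<not> (P v C' \<and> P w C')" "\<not> (P v D' \<and> P w D')" using uni[OF vw(3)] T by auto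
  have xyvw: "v \<in> {x, y}" "w \<in> {x, y}"
    using two[OF vw(1) _ vw(4)] two[OF vw(2) _ vw(5)] one[OF _ vw(4)] one[OF _ vw(5)] u by metis+
  have "(P v D' \<and> \<not> P v C') \<or> (P w D' \<and> \<not> P w C')"
    using u one[OF xyvw(1) vw(4)] one[OF xyvw(2) vw(5)] by blast
  then obtain z where z: "z \<in> {x, y}" "conn E (B' - {z})" "P z D'" "\<not> P z C'" using xyvw vw by blast
  then have "tri E (B' - {z}) C' (insert z D')" using move sub by blast
  moreover have "(B' - {z}) \<union> C' \<union> insert z D' \<subseteq> W" using sub z by auto
  moreover have "x \<in> B' - {z} \<and> y \<in> insert z D' \<or> y \<in> B' - {z} \<and> x \<in> insert z D'" using z xy sub by auto
  ultimately show ?thesis using sub by blast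
qed

text \<open>Two applications of \<open>split_bag\<close> suffice: it never removes anything from the
  two other bags, so separating \<open>z\<close> leaves \<open>x\<close> and \<open>y\<close> in
  different bags.\<close>

lemma distribute:
  assumes fin: "finite W" and t: "tri E B C D" "B \<union> C \<union> D \<subseteq> W"
    and N: "x \<in> N" "y \<in> N" "z \<in> N" "x \<noteq> y" "x \<noteq> z" "y \<noteq> z"
    and all: "\<And>B C D v. tri E B C D \<Longrightarrow> B \<union> C \<union> D \<subseteq> W \<Longrightarrow> v \<in> N \<Longrightarrow> v \<in> B \<union> C \<union> D"
  shows "\<exists>B C D. tri E B C D \<and> B \<union> C \<union> D \<subseteq> W \<and> B \<inter> N \<noteq> {} \<and> C \<inter> N \<noteq> {} \<and> D \<inter> N \<noteq> {}"
proof -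
  define T where "T B C D \<longleftrightarrow> tri E B C D \<and> B \<union> C \<union> D \<subseteq> W" for B C D
  have perm: "T B C D \<Longrightarrow> T C B D" "T B C D \<Longrightarrow> T B D C" for B C D
    unfolding T_def using tri_perm[of B C D] by auto
  have split: "\<exists>B' C' D'. T B' C' D' \<and> C \<subseteq> C' \<and> D \<subseteq> D' \<and> (u \<in> B' \<and> v \<in> D' \<or> v \<in> B' \<and> u \<in> D')"
    if "T B C D" "u \<in> B" "v \<in> B" "u \<noteq> v" "u \<in> N" "v \<in> N" for B C D u v
  proof -
    have "x \<in> X \<union> Y \<union> Z" if "tri E X Y Z" "X \<union> Y \<union> Z \<subseteq> W" "x \<in> {u, v}" for X Y Z x
      using all that \<open>u \<in> N\<close> \<open>v \<in> N\<close> by blast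
    then have "\<exists>B' C' D'. tri E B' C' D' \<and> B' \<union> C' \<union> D' \<subseteq> W \<and> C \<subseteq> C' \<and> D \<subseteq> D' \<and>
        (u \<in> B' \<and> v \<in> D' \<or> v \<in> B' \<and> u \<in> D')"
      using that by (intro split_bag[OF fin, of B C D u v]) (auto simp: T_def)
    then show ?thesis unfolding T_def by blast
  qed
  have "\<exists>B C D. T B C D \<and> x \<in> B \<and> y \<in> C"
  proof -
    have "T B C D" using t by (simp add: T_def)
    moreover have "x \<in> B \<union> C \<union> D" using all t N by blast
    ultimately obtain B C D where 1: "T B C D" "x \<in> B" using perm by blast
    then consider "y \<in> B" | "y \<in> C" | "y \<in> D" using all[of B C D y] N unfolding T_def by blast
    then show ?thesis
    proof cases
      case 1
      then show ?thesis using split[of B C D x y] \<open>T B C D\<close> \<open>x \<in> B\<close> N perm by meson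
    qed (use 1 perm in blast)+
  qed
  then obtain B C D where xyT: "T B C D" "x \<in> B" "y \<in> C" by blast
  consider "z \<in> B" | "z \<in> C" | "z \<in> D" using all[of B C D z] N xyT unfolding T_def by blast
  then have "\<exists>B C D. T B C D \<and> B \<inter> N \<noteq> {} \<and> C \<inter> N \<noteq> {} \<and> D \<inter> N \<noteq> {}"
  proof cases
    case 1
    then obtain B' C' D' where "T B' C' D'" "C \<subseteq> C'" "x \<in> B' \<and> z \<in> D' \<or> z \<in> B' \<and> x \<in> D'"
      using split[of B C D x z] xyT N by blast
    then show ?thesis using xyT N by blast
  next
    case 2
    then obtain B' C' D' where "T B' C' D'" "B \<subseteq> C'" "y \<in> B' \<and> z \<in> D' \<or> z \<in> B' \<and> y \<in> D'"
      using split[of C B D y z] perm(1)[OF xyT(1)] xyT N by blast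
    then show ?thesis using xyT N by blast
  next
    case 3
    then show ?thesis using xyT N by blast
  qed
  then show ?thesis unfolding T_def by blast
qed

lemma card_3_obtain:
  assumes "card S \<ge> 3" obtains x y z where "x \<in> S" "y \<in> S" "z \<in> S" "x \<noteq> y" "x \<noteq> z" "y \<noteq> z"
proof -
  obtain T where "T \<subseteq> S" "card T = 3" using obtain_subset_with_card_n[OF assms] by metis
  then show thesis using that unfolding card_3_iff by auto
qed

lemma two_nbrs_avoiding:
  assumes "card {u \<in> U. u \<noteq> v \<and> E v u} \<ge> 3"
  shows "\<exists>s\<in>U - {a}. \<exists>t\<in>U - {a}. s \<noteq> t \<and> s \<noteq> v \<and> t \<noteq> v \<and> E v s \<and> E v t"
proof -
  obtain x y z where xyz: "x \<in> {u \<in> U. u \<noteq> v \<and> E v u}" "y \<in> {u \<in> U. u \<noteq> v \<and> E v u}"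
    "z \<in> {u \<in> U. u \<noteq> v \<and> E v u}" "x \<noteq> y" "x \<noteq> z" "y \<noteq> z"
    by (rule card_3_obtain[OF assms])
  then have "\<exists>s t. {s, t} \<subseteq> {x, y, z} - {a} \<and> s \<noteq> t" by (cases "x = a"; cases "y = a") auto
  then show ?thesis using xyz by (auto; blast)
qed

text \<open>Dirac's theorem for K4. Take the largest connected \<open>A\<close> whose complement
  contains a triangle model, and let \<open>N\<close> be its neighbours there. By maximality every
  triangle model uses all of \<open>N\<close>. With three or more vertices in \<open>N\<close> the
  model can be distributed over them and joined to \<open>A\<close>; with one or two, a cycle
  avoiding one of them exists after all; with none, induction applies to the complement.\<close>

lemma k4_if_degree_3:
  assumes "finite V" "V \<noteq> {}" "\<And>v. v \<in> V \<Longrightarrow> card {u \<in> V. u \<noteq> v \<and> E v u} \<ge> 3"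
  shows "\<exists>A B C D. k4 E A B C D \<and> A \<union> B \<union> C \<union> D \<subseteq> V"
  using assms
proof (induction "card V" arbitrary: V rule: less_induct)
  case less
  note fin = less.prems(1) and deg = less.prems(3)
  define G where "G A \<longleftrightarrow> conn E A \<and> A \<subseteq> V \<and> (\<exists>B C D. tri E B C D \<and> B \<union> C \<union> D \<subseteq> V - A)" for A
  have "\<exists>A. G A"
  proof -
    obtain a where a: "a \<in> V" using less.prems by blast
    have nb: "\<exists>s\<in>V - {a}. \<exists>t\<in>V - {a}. s \<noteq> t \<and> s \<noteq> v \<and> t \<noteq> v \<and> E v s \<and> E v t" if "v \<in> V" for v
      using two_nbrs_avoiding[OF deg[OF that]] .
    obtain s t where "s \<in> V - {a}" "t \<in> V - {a}" "s \<noteq> t" using nb[OF a] by blast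
    then have "card {s, t} \<le> card (V - {a})" using fin by (intro card_mono) auto
    then have "\<exists>B C D. tri E B C D \<and> B \<union> C \<union> D \<subseteq> V - {a}"
      using fin \<open>s \<noteq> t\<close> nb by (intro tri_if_degree_2[of _ a]) auto
    then have "G {a}" using a by (simp add: G_def)
    then show ?thesis by blast
  qed
  then obtain A where A: "G A" "\<And>A'. G A' \<Longrightarrow> card A' \<le> card A"
    using ex_has_greatest_nat[of G _ card "Suc (card V)"] card_mono[OF fin] unfolding G_def
    by (metis le_imp_less_Suc)
  then obtain B C D where tr: "tri E B C D" "B \<union> C \<union> D \<subseteq> V - A" and cA: "conn E A" and AV: "A \<subseteq> V"
    unfolding G_def by blast
  define W where "W = V - A"
  define N where "N = {w \<in> W. touch E A {w}}"
  have fW: "finite W" and fN: "finite N" using fin by (auto simp: W_def N_def)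
  have all: "v \<in> B \<union> C \<union> D" if B: "tri E B C D" "B \<union> C \<union> D \<subseteq> W" and v: "v \<in> N" for B C D v
  proof (rule ccontr)
    assume "v \<notin> B \<union> C \<union> D"
    then have "B \<union> C \<union> D \<subseteq> V - insert v A" using B by (auto simp: W_def)
    then have "G (insert v A)" using conn_insert[OF cA, of v] v AV B(1) by (auto simp: N_def W_def G_def)
    moreover have "card (insert v A) > card A"
      using v finite_subset[OF AV fin] by (auto simp: N_def W_def)
    ultimately show False using A(2) by (meson not_le)
  qed
  have Wdeg: "card {u \<in> W. u \<noteq> v \<and> E v u} \<ge> 3" if v: "v \<in> W - N" for v
  proof -
    have "u \<in> W" if "u \<in> V" "E v u" for u
      using v that E_sym by (auto simp: N_def W_def touch_def)
    then have "{u \<in> V. u \<noteq> v \<and> E v u} = {u \<in> W. u \<noteq> v \<and> E v u}" by (auto simp: W_def)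
    then show ?thesis using deg[of v] v by (auto simp: W_def)
  qed
  note T = triD[OF tr(1)]
  consider "N = {}" | "card N \<ge> 3" | "card N \<ge> 1" "card N \<le> 2"
    using fN by (metis One_nat_def Suc_leI card_gt_0_iff not_less_eq_eq numeral_2_eq_2 numeral_3_eq_3)
  then show ?case
  proof cases
    case 1
    have "W \<subset> V" using AV conn_nonempty[OF cA] by (auto simp: W_def)
    then have "card W < card V" using fin by (rule psubset_card_mono[rotated])
    moreover have "W \<noteq> {}" using conn_nonempty[OF T(1)] tr(2) by (auto simp: W_def)
    ultimately have "\<exists>A B C D. k4 E A B C D \<and> A \<union> B \<union> C \<union> D \<subseteq> W"
      using less.hyps[of W] fW Wdeg 1 by blast
    then show ?thesis unfolding W_def by blast
  next
    case 2
    then obtain x y z where "x \<in> N" "y \<in> N" "z \<in> N" "x \<noteq> y" "x \<noteq> z" "y \<noteq> z" by (rule card_3_obtain)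
    then obtain B C D where d: "tri E B C D" "B \<union> C \<union> D \<subseteq> W" "B \<inter> N \<noteq> {}" "C \<inter> N \<noteq> {}" "D \<inter> N \<noteq> {}"
      using distribute[OF fW tr(1) tr(2)[folded W_def], of x N y z] all by blast
    have tN: "touch E A X" if "X \<inter> N \<noteq> {}" for X
      using that unfolding N_def touch_def by blast
    have "A \<inter> (B \<union> C \<union> D) = {}" using d(2) by (auto simp: W_def)
    then have "k4 E A B C D" unfolding k4_def using cA d tN by simp
    moreover have "A \<union> B \<union> C \<union> D \<subseteq> V" using d(2) AV by (auto simp: W_def)
    ultimately show ?thesis by blast
  next
    case 3
    obtain x where x: "x \<in> N" using 3 by fastforce
    have "card (N - {x}) \<le> 1" using 3 x fN by (simp add: card_Diff_singleton)
    then obtain y where y: "N \<subseteq> {x, y}"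
    proof (cases "N - {x} = {}")
      case False
      then obtain y where "N - {x} = {y}" using \<open>card (N - {x}) \<le> 1\<close> fN
        by (metis card_1_singletonE card_gt_0_iff finite_Diff le_antisym less_eq_Suc_le One_nat_def)
      then show thesis using that by blast
    qed (use that in blast)
    \<comment> \<open>A vertex of \<open>W\<close> outside \<open>N\<close> has all its neighbours
      in \<open>W\<close>, hence two besides \<open>x\<close>. So \<open>y\<close> is the only
      possible exception to the degree condition in \<open>W - {x}\<close>.\<close>
    have nb: "\<exists>s\<in>W - {x}. \<exists>t\<in>W - {x}. s \<noteq> t \<and> s \<noteq> v \<and> t \<noteq> v \<and> E v s \<and> E v t" if v: "v \<in> W - {x}" "v \<noteq> y" for v
    proof -
      have "v \<in> W - N" using v y by blast
      then show ?thesis using two_nbrs_avoiding[OF Wdeg] by blast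
    qed
    obtain b c d where bcd: "b \<in> B" "c \<in> C" "d \<in> D" 
      using conn_nonempty[OF T(1)] conn_nonempty[OF T(2)] conn_nonempty[OF T(3)] by blast
    then have "b \<noteq> c" "b \<noteq> d" "c \<noteq> d" using bcd T(4-6) by (metis disjoint_iff)+
    then have "card {b, c, d} = 3" by simp
    moreover have "{b, c, d} \<subseteq> W" using bcd tr(2) unfolding W_def by blast
    ultimately have "card W \<ge> 3" using fW card_mono[of W "{b, c, d}"] by simp
    then have "card (W - {x}) \<ge> 2" using x by (auto simp: N_def card_Diff_singleton)
    then obtain B C D where "tri E B C D" "B \<union> C \<union> D \<subseteq> W - {x}"
      using tri_if_degree_2[of "W - {x}" y] fW nb by blast
    then show ?thesis using all[of B C D x] x by blast
  qed
qed

end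

text \<open>A vertex \<open>v\<close> with at most two neighbours is deleted or contracted into a
  neighbour, and inseparability of the four vertices survives; when no such vertex is left, minimum
  degree three gives the minor.\<close>

lemma k4_if_insep:
  fixes E :: "'a \<Rightarrow> 'a \<Rightarrow> bool"
  assumes "sym_graph E" "finite V" "U \<subseteq> V" "card U = 4"
    and "\<And>a b. a \<in> U \<Longrightarrow> b \<in> U \<Longrightarrow> a \<noteq> b \<Longrightarrow> insep E V a b"
  shows "\<exists>A B C D. k4 E A B C D \<and> A \<union> B \<union> C \<union> D \<subseteq> V"
  using assms
proof (induction "card V" arbitrary: V E rule: less_induct)
  case less
  interpret sym_graph E by (rule less.prems(1))
  note fin = less.prems(2) and UV = less.prems(3) and cU = less.prems(4) and ins = less.prems(5)
  have fU: "finite U" using UV fin by (rule finite_subset)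
  show ?case
  proof (cases "\<forall>v\<in>V. card {u \<in> V. u \<noteq> v \<and> E v u} \<ge> 3")
    case True
    moreover have "V \<noteq> {}" using UV cU by auto
    ultimately show ?thesis using k4_if_degree_3[OF fin] by blast
  next
    case False
    then obtain v where v: "v \<in> V" and c2: "\<not> 3 \<le> card {u \<in> V. u \<noteq> v \<and> E v u}" by blast
    define M where "M = {u \<in> V. u \<noteq> v \<and> E v u}"
    have fM: "finite M" and cM: "card M \<le> 2" using fin c2 by (auto simp: M_def)
    have M: "w \<in> M" if "E v w" "w \<in> V" "w \<noteq> v" for w using that by (auto simp: M_def)
    have shape: "M = {} \<or> (\<exists>x y. M = {x, y})"
    proof -
      have "card M = 0 \<or> card M = 1 \<or> card M = 2" using cM by linarith
      then show ?thesis using fM by (metis card_0_eq card_1_singletonE card_2_iff insert_absorb2)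
    qed
    \<comment> \<open>Some other vertex of \<open>U\<close> is not adjacent to \<open>v\<close>, and
      the at most two neighbours of \<open>v\<close> would separate the two.\<close>
    have vU: "v \<notin> U"
    proof
      assume vU: "v \<in> U"
      have "card (U - {v}) = 3" using cU fU vU by simp
      then obtain b where b: "b \<in> U" "b \<noteq> v" "b \<notin> M"
        using card_mono[OF fM, of "U - {v}"] cM by fastforce
      have "card (U - {v, b}) = 2" using cU fU vU b by (simp add: card_Diff_subset)
      then obtain c where c: "c \<in> U" "c \<noteq> v" "c \<noteq> b" by (metis card.empty Diff_iff all_not_in_conv insertI1 insertCI zero_neq_numeral)
      \<comment> \<open>If \<open>v\<close> has no neighbour, any vertex besides \<open>v\<close>
        and \<open>b\<close> can be deleted instead; \<open>c\<close> serves as this dummy.\<close>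
      obtain x y where xy: "M \<subseteq> {x, y}" "x \<notin> {v, b}" "y \<notin> {v, b}"
      proof (cases "M = {}")
        case True
        then show thesis using that[of c c] c by simp
      next
        case False
        then obtain x y where xy: "M = {x, y}" using shape by blast
        then have "x \<in> M" "y \<in> M" by auto
        then show thesis using that[of x y] b xy by (auto simp: M_def)
      qed
      then have "reach E (V - {x, y}) v b" using ins[OF vU b(1)] b(2) unfolding insep_def by blast
      then obtain w where "E v w" "w \<noteq> v" "w \<in> V - {x, y}" using reach_exit[of E _ v b "{v}"] b by auto
      then show False using M xy by blast
    qed
    define V1 where "V1 = V - {v}"
    have V1: "finite V1" "card V1 < card V" "U \<subseteq> V1" 
      using fin v vU UV card_Diff1_less[OF fin v] by (auto simp: V1_def)
    show ?thesis
    proof (cases "M = {}")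
      case True
      have "insep E V1 a b" if ab: "a \<in> U" "b \<in> U" "a \<noteq> b" for a b
        unfolding insep_def
      proof (intro allI impI)
        fix x y assume "x \<notin> {a, b}" "y \<notin> {a, b}"
        then have r: "reach E (V - {x, y}) a b" using ins[OF ab] unfolding insep_def by blast
        have step: "s = t \<or> s \<in> V1 - {x, y} \<and> t \<in> V1 - {x, y} \<and> E s t"
          if "s \<in> V - {x, y}" "t \<in> V - {x, y}" "E s t" for s t
          using M[of s] M[of t] E_sym[of s t] that True by (auto simp: V1_def)
        show "reach E (V1 - {x, y}) a b" using reach_map[OF r, of "\<lambda>x. x"] step by blast
      qed
      then have "\<exists>A B C D. k4 E A B C D \<and> A \<union> B \<union> C \<union> D \<subseteq> V1"
        using less.hyps[OF V1(2) less.prems(1) V1(1,3) cU] by blast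
      then show ?thesis unfolding V1_def by blast
    next
      case False
      then obtain x0 y0 where x0: "M = {x0, y0}" using shape by blast
      then have x0V: "x0 \<in> V" "x0 \<noteq> v" "E v x0" "x0 \<in> V1" and y0V: "y0 \<in> V" "y0 \<noteq> v" "E v y0"
        by (auto simp: M_def V1_def)
      define f where "f a = (if a = v then x0 else a)" for a
      let ?E = "contr f V E"
      have Es: "sym_graph ?E" by (rule contr_sym_graph) (rule less.prems(1))
      have "insep ?E V1 a b" if ab: "a \<in> U" "b \<in> U" "a \<noteq> b" for a b
        unfolding insep_def
      proof (intro allI impI)
        fix x y assume "x \<notin> {a, b}" "y \<notin> {a, b}"
        then have r: "reach E (V - {x, y}) a b" using ins[OF ab] unfolding insep_def by blast
        \<comment> \<open>Walks through \<open>v\<close> are rerouted to \<open>x0\<close>, into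
          which \<open>v\<close> is contracted. If \<open>x0\<close> is among the deleted vertices,
          then \<open>y0\<close> is the only way into and out of \<open>v\<close>, and the detour
          collapses to \<open>y0\<close>.\<close>
        define g where "g a = (if a = v then if x0 \<in> {x, y} then y0 else x0 else a)" for a
        have half: "g t = x0 \<and> x0 \<notin> {x, y} \<and> ?E x0 s \<or> g t = s"
          if "s \<in> V - {x, y}" "E s t" "t = v" "s \<noteq> v" for s t
        proof (cases "x0 \<in> {x, y}")
          case True
          have "s \<in> M" using M E_sym that by auto
          then have "s = y0" using that True x0 by auto
          then show ?thesis using True that by (simp add: g_def)
        next
          case False
          have "E v s" using E_sym that by blast
          then have "?E x0 s" using that v unfolding contr_def f_def by auto
          then show ?thesis using False that by (auto simp: g_def)
        qed
        have step: "g s = g t \<or> g s \<in> V1 - {x, y} \<and> g t \<in> V1 - {x, y} \<and> ?E (g s) (g t)"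
          if st: "s \<in> V - {x, y}" "t \<in> V - {x, y}" "E s t" for s t
        proof -
          consider "s = v" "t = v" | "s \<noteq> v" "t \<noteq> v" | "s \<noteq> v" "t = v" | "s = v" "t \<noteq> v" by blast
          then show ?thesis
          proof cases
            case 2
            then have "?E s t" using st unfolding contr_def f_def by auto
            then show ?thesis using 2 st by (auto simp: g_def V1_def)
          next
            case 3
            then have "g s = s" "s \<in> V1 - {x, y}" using st by (auto simp: g_def V1_def)
            then show ?thesis using half[OF st(1,3) 3(2,1)] x0V sym_graph.E_sym[OF Es, of x0 s] by auto
          next
            case 4
            then have "g t = t" "t \<in> V1 - {x, y}" using st by (auto simp: g_def V1_def)
            then show ?thesis using half[OF st(2) E_sym[OF st(3)] 4(1,2)] x0V by auto
          qed simp
        qed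
        have "g a = a" "g b = b" using ab vU by (auto simp: g_def)
        then show "reach ?E (V1 - {x, y}) a b" using reach_map[OF r, of g] step by metis
      qed
      then obtain A B C D where k: "k4 ?E A B C D" "A \<union> B \<union> C \<union> D \<subseteq> V1"
        using less.hyps[OF V1(2) Es V1(1,3) cU] by blast
      have "conn E (V \<inter> f -` {a})" if "a \<in> V1" for a
      proof (cases "a = x0")
        case True
        then have "V \<inter> f -` {a} = insert v {x0}" using v x0V by (auto simp: f_def split: if_splits)
        moreover have "conn E (insert v {x0})" using E_sym[OF x0V(3)] conn_insert[of "{x0}" v] by simp
        ultimately show ?thesis by simp
      next
        case False
        then have "V \<inter> f -` {a} = {a}" using that by (auto simp: f_def V1_def split: if_splits)
        then show ?thesis by simp
      qed
      then have "k4 E (V \<inter> f -` A) (V \<inter> f -` B) (V \<inter> f -` C) (V \<inter> f -` D)"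
        using k4_pull[OF less.prems(1) k(1)] k(2) by blast
      then show ?thesis by blast
    qed
  qed
qed

section \<open>Induced minors as families of disjoint connected bags\<close>

section \<open>Induced minor models\<close>

lemma conn_cong_neq:
  assumes "conn E A" "\<And>a b. a \<in> A \<Longrightarrow> b \<in> A \<Longrightarrow> a \<noteq> b \<Longrightarrow> E a b \<Longrightarrow> E' a b"
  shows "conn E' A"
proof (rule connI_crossing)
  fix P assume P: "P \<subseteq> A" "P \<noteq> {}" "P \<noteq> A"
  from conn_crossing[OF assms(1) this] obtain u w where "u \<in> P" "w \<in> A - P" "E u w" by blast
  then show "\<exists>u\<in>P. \<exists>w\<in>A - P. E' u w" using assms(2)[of u w] P by blast
qed (use assms conn_nonempty in blast)

abbreviation adj :: "'a ugraph \<Rightarrow> 'a \<Rightarrow> 'a \<Rightarrow> bool" where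
  "adj G u v \<equiv> {u, v} \<in> edges G"

lemma sym_graph_adj: "sym_graph (adj G)"
  by (simp add: sym_graph_def insert_commute)

lemma adj_simple: "simple_graph G \<Longrightarrow> adj G u v \<Longrightarrow> u \<in> verts G \<and> v \<in> verts G \<and> u \<noteq> v"
  unfolding simple_graph_def by (metis card_2_iff' insert_subset insertI1 insert_absorb2 singletonD)

lemma edge_obtain:
  assumes "simple_graph G" "e \<in> edges G"
  obtains x y where "e = {x, y}" "x \<noteq> y" "x \<in> verts G" "y \<in> verts G"
proof -
  have "card e = 2" "e \<subseteq> verts G" using assms by (simp_all add: simple_graph_def)
  then show thesis using that unfolding card_2_iff by auto
qed

lemma adj_delete: "a \<noteq> v \<Longrightarrow> b \<noteq> v \<Longrightarrow> adj (delete_vertex v G) a b \<longleftrightarrow> adj G a b"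
  by (auto simp: delete_vertex_def)

lemma adj_contract:
  assumes G: "simple_graph G" "{u, w} \<in> edges G" "u \<noteq> w"
  shows "adj (contract_edge u w G) a b \<longleftrightarrow>
    a \<noteq> b \<and> contr (\<lambda>x. if x = w then u else x) (verts G) (adj G) a b" (is "?l \<longleftrightarrow> ?r")
proof
  let ?f = "\<lambda>x. if x = w then u else x"
  assume l: ?l
  then obtain e where e: "e \<in> edges G" "e \<noteq> {u, w}" "{a, b} = ?f ` e" by (auto simp: contract_edge_def)
  obtain x y where xy: "e = {x, y}" "x \<noteq> y" "x \<in> verts G" "y \<in> verts G" using edge_obtain[OF G(1) e(1)] .
  have ab: "a \<noteq> b" using adj_simple[OF simple_graph_contract_edge[OF G] l] by simp
  have "{a, b} = {?f x, ?f y}" using e(3) xy(1) by simp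
  then have "?f x = a \<and> ?f y = b \<or> ?f y = a \<and> ?f x = b" unfolding doubleton_eq_iff by blast
  moreover have "adj G x y" "adj G y x" using e(1) xy(1) by (simp_all add: insert_commute)
  ultimately show ?r using ab xy unfolding contr_def by blast
next
  let ?f = "\<lambda>x. if x = w then u else x"
  assume r: ?r
  then obtain x y where xy: "?f x = a" "?f y = b" "adj G x y" "a \<noteq> b" unfolding contr_def by blast
  then have "{x, y} \<noteq> {u, w}" by (auto simp: doubleton_eq_iff split: if_splits)
  moreover have "{a, b} = ?f ` {x, y}" by (simp only: image_insert image_empty xy(1,2))
  ultimately show ?l using xy(3) unfolding contract_edge_def snd_conv by blast
qed

definition im_model :: "'a ugraph \<Rightarrow> 'b ugraph \<Rightarrow> ('b \<Rightarrow> 'a set) \<Rightarrow> bool" where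
  "im_model G H \<phi> \<longleftrightarrow> (\<forall>x\<in>verts H. \<phi> x \<subseteq> verts G \<and> conn (adj G) (\<phi> x)) \<and>
     (\<forall>x\<in>verts H. \<forall>y\<in>verts H. x \<noteq> y \<longrightarrow> \<phi> x \<inter> \<phi> y = {} \<and> (adj H x y \<longleftrightarrow> touch (adj G) (\<phi> x) (\<phi> y)))"

lemma im_modelD:
  assumes "im_model G H \<phi>"
  shows "x \<in> verts H \<Longrightarrow> \<phi> x \<subseteq> verts G" "x \<in> verts H \<Longrightarrow> conn (adj G) (\<phi> x)"
    "x \<in> verts H \<Longrightarrow> y \<in> verts H \<Longrightarrow> x \<noteq> y \<Longrightarrow> \<phi> x \<inter> \<phi> y = {}"
    "x \<in> verts H \<Longrightarrow> y \<in> verts H \<Longrightarrow> x \<noteq> y \<Longrightarrow> adj H x y \<longleftrightarrow> touch (adj G) (\<phi> x) (\<phi> y)"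
  using assms unfolding im_model_def by auto

text \<open>Deleting a vertex discards its bag, and contracting an edge merges the bags of its
  ends.\<close>

lemma minor_steps_im_model:
  assumes "minor_step\<^sup>*\<^sup>* G G'" "simple_graph G"
  shows "\<exists>\<phi>. im_model G G' \<phi>"
  using assms(1)
proof (induction rule: rtranclp_induct)
  case base
  have "im_model G G (\<lambda>x. {x})" by (simp add: im_model_def)
  then show ?case by blast
next
  case (step G1 G2)
  then obtain \<phi> where \<phi>: "im_model G G1 \<phi>" by blast
  have s1: "simple_graph G1" using step assms simple_graph_minor_steps by blast
  interpret sym_graph "adj G" by (rule sym_graph_adj)
  from step(2) show ?case
  proof cases
    case (delete v)
    have V2: "x \<in> verts G1 \<and> x \<noteq> v" if "x \<in> verts G2" for x using that by (simp add: delete(1) delete_vertex_def)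
    have "adj G2 x y \<longleftrightarrow> adj G1 x y" if "x \<in> verts G2" "y \<in> verts G2" for x y
      unfolding delete(1) using V2 that by (intro adj_delete) auto
    then have "im_model G G2 \<phi>" using im_modelD[OF \<phi>] V2 unfolding im_model_def by simp
    then show ?thesis by blast
  next
    case (contract u v)
    define \<psi> where "\<psi> x = (if x = u then \<phi> u \<union> \<phi> v else \<phi> x)" for x
    have uv: "u \<in> verts G1" "v \<in> verts G1" using adj_simple[OF s1 contract(2)] by auto
    have V2: "verts G2 = verts G1 - {v}" by (simp add: contract contract_edge_def)
    have cuv: "conn (adj G) (\<phi> u \<union> \<phi> v)"
      using im_modelD(2)[OF \<phi>] im_modelD(4)[OF \<phi> uv] uv contract by (intro conn_Un) auto
    have "im_model G G2 \<psi>"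
      unfolding im_model_def V2
    proof (intro conjI ballI impI)
      fix x assume x: "x \<in> verts G1 - {v}"
      show "\<psi> x \<subseteq> verts G" using im_modelD(1)[OF \<phi>] uv x by (auto simp: \<psi>_def)
      show "conn (adj G) (\<psi> x)" using cuv im_modelD(2)[OF \<phi>] x by (simp add: \<psi>_def)
    next
      fix x y assume xy: "x \<in> verts G1 - {v}" "y \<in> verts G1 - {v}" "x \<noteq> y"
      note D = im_modelD(3)[OF \<phi>] and T = im_modelD(4)[OF \<phi>]
      show "\<psi> x \<inter> \<psi> y = {}"
        using D[of x y] D[of u y] D[of v y] D[of x u] D[of x v] xy uv by (auto simp: \<psi>_def)
      have "adj G2 x y \<longleftrightarrow> (\<exists>s\<in>verts G1. \<exists>t\<in>verts G1. (if s = v then u else s) = x \<and>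
          (if t = v then u else t) = y \<and> adj G1 s t)"
        using adj_contract[OF s1 contract(2,3)] xy(3) unfolding contract(1) contr_def by blast
      also have "\<dots> \<longleftrightarrow> adj G1 x y \<or> x = u \<and> adj G1 v y \<or> y = u \<and> adj G1 x v"
        using xy uv by (auto split: if_splits)
      also have "\<dots> \<longleftrightarrow> touch (adj G) (\<psi> x) (\<psi> y)"
        using T[of x y] T[of v y] T[of x v] xy uv by (auto simp: \<psi>_def)
      finally show "adj G2 x y \<longleftrightarrow> touch (adj G) (\<psi> x) (\<psi> y)" .
    qed
    then show ?thesis by blast
  qed
qed

text \<open>By induction on the number of vertices: a vertex in no bag is deleted, an edge inside a
  bag is contracted, and when all bags are singletons covering the graph, the model is an
  isomorphism.\<close>

lemma im_model_minor:
  assumes "simple_graph G" "simple_graph H" "im_model G H \<phi>"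
  shows "contains_induced_minor G H"
  using assms(1,3)
proof (induction "card (verts G)" arbitrary: G \<phi> rule: less_induct)
  case (less G \<phi>)
  note G = less.prems(1) and m = less.prems(2)
  note D = im_modelD[OF m]
  have fin: "finite (verts G)" using G by (simp add: simple_graph_def)
  have smaller: "contains_induced_minor G H"
    if "minor_step G G'" "verts G' = verts G - {v}" "v \<in> verts G" "im_model G' H \<psi>" for G' v \<psi>
  proof -
    have "card (verts G') < card (verts G)" using that fin by (metis card_Diff1_less)
    then have "contains_induced_minor G' H"
      using less.hyps simple_graph_minor_step[OF that(1) G] that(4) by blast
    then show ?thesis using that(1) unfolding contains_induced_minor_def
      by (meson converse_rtranclp_into_rtranclp)
  qed
  show ?case
  proof (cases "verts G \<subseteq> (\<Union>x\<in>verts H. \<phi> x)")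
    case False
    then obtain v where v: "v \<in> verts G" "\<And>x. x \<in> verts H \<Longrightarrow> v \<notin> \<phi> x" by blast
    let ?G = "delete_vertex v G"
    have c: "conn (adj ?G) (\<phi> x)" if "x \<in> verts H" for x
      by (rule conn_cong_neq[OF D(2)[OF that]]) (metis adj_delete v(2) that)
    have t: "touch (adj ?G) (\<phi> x) (\<phi> y) \<longleftrightarrow> touch (adj G) (\<phi> x) (\<phi> y)" if "x \<in> verts H" "y \<in> verts H" for x y
      unfolding touch_def using adj_delete v(2) that by metis
    have V: "verts ?G = verts G - {v}" by (simp add: delete_vertex_def)
    have "\<phi> x \<subseteq> verts ?G" if "x \<in> verts H" for x using D(1)[OF that] v(2)[OF that] unfolding V by blast
    then have "im_model ?G H \<phi>" unfolding im_model_def using c t D(3,4) by metis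
    then show ?thesis using smaller[OF minor_step.delete[OF v(1)] V v(1)] by blast
  next
    case cover: True
    show ?thesis
    proof (cases "\<forall>x\<in>verts H. \<exists>v. \<phi> x = {v}")
      case False
      then obtain x where x: "x \<in> verts H" "\<And>v. \<phi> x \<noteq> {v}" by blast
      obtain u where u: "u \<in> \<phi> x" using conn_nonempty[OF D(2)[OF x(1)]] by blast
      then obtain w where w: "w \<in> \<phi> x" "w \<noteq> u" "adj G u w"
        using conn_crossing[OF D(2)[OF x(1)], of "{u}"] x(2)[of u] by auto
      let ?G = "contract_edge u w G"
      define f where "f = (\<lambda>x. if x = w then u else x)"
      define \<psi> where "\<psi> y = f ` \<phi> y" for y
      have uw: "u \<in> verts G" "w \<in> verts G" "u \<noteq> w" using adj_simple[OF G w(3)] by auto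
      have V: "verts ?G = verts G - {w}" by (simp add: contract_edge_def)
      have a: "adj ?G a b \<longleftrightarrow> a \<noteq> b \<and> contr f (verts G) (adj G) a b" for a b
        unfolding f_def by (rule adj_contract[OF G w(3) uw(3)])
      have notin: "u \<notin> \<phi> y" "w \<notin> \<phi> y" if "y \<in> verts H" "y \<noteq> x" for y
        using D(3)[OF that(1) x(1) that(2)] u w(1) by auto
      have pre: "verts G \<inter> f -` \<psi> y = \<phi> y" if y: "y \<in> verts H" for y
      proof (cases "y = x")
        case True
        then show ?thesis using D(1)[OF y] u w(1) by (auto simp: \<psi>_def f_def split: if_splits)
      next
        case False
        then show ?thesis using D(1)[OF y] notin[OF y] by (auto simp: \<psi>_def f_def split: if_splits)
      qed
      have c: "conn (adj ?G) (\<psi> y)" if y: "y \<in> verts H" for y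
      proof -
        have "conn (contr f (verts G) (adj G)) (\<psi> y)" unfolding \<psi>_def by (rule conn_push[OF D(2)[OF y] D(1)[OF y]])
        then show ?thesis by (rule conn_cong_neq) (simp add: a)
      qed
      have disj: "\<psi> y \<inter> \<psi> z = {}" if "y \<in> verts H" "z \<in> verts H" "y \<noteq> z" for y z
      proof -
        have "\<psi> y \<subseteq> f ` verts G" using D(1)[OF that(1)] by (auto simp: \<psi>_def)
        then show ?thesis using D(3)[OF that] pre[OF that(1)] pre[OF that(2)] by blast
      qed
      have t: "touch (adj ?G) (\<psi> y) (\<psi> z) \<longleftrightarrow> touch (adj G) (\<phi> y) (\<phi> z)"
        if "y \<in> verts H" "z \<in> verts H" "y \<noteq> z" for y z
      proof -
        have "touch (adj ?G) (\<psi> y) (\<psi> z) \<longleftrightarrow> touch (contr f (verts G) (adj G)) (\<psi> y) (\<psi> z)"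
          unfolding touch_def a using disj[OF that] by (metis disjoint_iff)
        then show ?thesis unfolding touch_contr pre[OF that(1)] pre[OF that(2)] .
      qed
      have sub: "\<psi> y \<subseteq> verts ?G" if "y \<in> verts H" for y
        using D(1)[OF that] uw by (auto simp: \<psi>_def f_def V)
      have "im_model ?G H \<psi>" unfolding im_model_def using c t D(4) disj sub by simp
      then show ?thesis using smaller[OF minor_step.contract[OF w(3) uw(3)] V uw(2)] by blast
    next
      case True
      then obtain g where g: "\<And>x. x \<in> verts H \<Longrightarrow> \<phi> x = {g x}" by metis
      have inj: "inj_on g (verts H)" using D(3) g by (intro inj_onI) (metis Int_absorb insert_not_empty)
      have img: "g ` verts H = verts G" using cover D(1) g by fastforce
      have bij: "bij_betw g (verts H) (verts G)" using inj img by (simp add: bij_betw_def)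
      define h where "h = inv_into (verts H) g"
      have h: "h (g x) = x" if "x \<in> verts H" for x using inj that by (simp add: h_def)
      have a: "adj H x y \<longleftrightarrow> adj G (g x) (g y)" if "x \<in> verts H" "y \<in> verts H" "x \<noteq> y" for x y
        using D(4)[OF that] g that by simp
      have "edges H = (\<lambda>e. h ` e) ` edges G"
      proof (intro equalityI subsetI)
        fix e assume e: "e \<in> edges H"
        obtain x y where xy: "e = {x, y}" "x \<noteq> y" "x \<in> verts H" "y \<in> verts H" using edge_obtain[OF assms(2) e] .
        then have "e = h ` {g x, g y}" "{g x, g y} \<in> edges G" using h a e by auto
        then show "e \<in> (\<lambda>e. h ` e) ` edges G" by (rule image_eqI)
      next
        fix e assume "e \<in> (\<lambda>e. h ` e) ` edges G"
        then obtain e' where e': "e' \<in> edges G" "e = h ` e'" by blast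
        obtain x' y' where x'y': "e' = {x', y'}" "x' \<noteq> y'" "x' \<in> verts G" "y' \<in> verts G"
          using edge_obtain[OF G e'(1)] .
        then obtain x y where xy: "x' = g x" "y' = g y" "x \<in> verts H" "y \<in> verts H" using img by blast
        then have "x \<noteq> y" "e = {x, y}" using x'y' e' h by auto
        then show "e \<in> edges H" using a xy x'y' e' by auto
      qed
      moreover have "bij_betw h (verts G) (verts H)" unfolding h_def by (rule bij_betw_inv_into[OF bij])
      ultimately have "graph_iso G H" unfolding graph_iso_def by blast
      then show ?thesis unfolding contains_induced_minor_def by blast
    qed
  qed
qed

lemma contains_induced_minor_iff:
  assumes "simple_graph G" "simple_graph H"
  shows "contains_induced_minor G H \<longleftrightarrow> (\<exists>\<phi>. im_model G H \<phi>)"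
proof
  assume "contains_induced_minor G H"
  then obtain G' f where G': "minor_step\<^sup>*\<^sup>* G G'" and f: "bij_betw f (verts G') (verts H)"
    and e: "edges H = (\<lambda>e. f ` e) ` edges G'"
    unfolding contains_induced_minor_def graph_iso_def by blast
  obtain \<phi> where \<phi>: "im_model G G' \<phi>" using minor_steps_im_model[OF G' assms(1)] by blast
  have s: "simple_graph G'" using G' assms(1) by (rule simple_graph_minor_steps)
  define g where "g = inv_into (verts G') f"
  have g: "g x \<in> verts G'" "f (g x) = x" if "x \<in> verts H" for x
    using bij_betw_inv_into[OF f] f that unfolding g_def bij_betw_def by (auto simp: f_inv_into_f)
  have inj: "inj_on f (verts G')" using f by (simp add: bij_betw_def)
  have a: "adj H x y \<longleftrightarrow> adj G' (g x) (g y)" if "x \<in> verts H" "y \<in> verts H" for x y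
  proof
    assume "adj H x y"
    then obtain e' where e': "e' \<in> edges G'" "{x, y} = f ` e'" unfolding e by blast
    have "f ` e' = f ` {g x, g y}" using g that e'(2) by simp
    moreover have "e' \<subseteq> verts G'" using s e'(1) by (simp add: simple_graph_def)
    ultimately have "e' = {g x, g y}" using inj g that by (metis empty_subsetI inj_on_image_eq_iff insert_subset)
    then show "adj G' (g x) (g y)" using e'(1) by simp
  next
    assume "adj G' (g x) (g y)"
    then have "f ` {g x, g y} \<in> edges H" unfolding e by blast
    then show "adj H x y" using g that by simp
  qed
  have "g x \<noteq> g y" if "x \<in> verts H" "y \<in> verts H" "x \<noteq> y" for x y using g that by metis
  then have "im_model G H (\<lambda>x. \<phi> (g x))"
    unfolding im_model_def using im_modelD[OF \<phi>] g a by simp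
  then show "\<exists>\<phi>. im_model G H \<phi>" by blast
qed (use im_model_minor assms in blast)

text \<open>The bag of the pendant vertex may be replaced by any one of its vertices that sees the
  bag of 2: non-adjacency to the other three bags is inherited.\<close>

lemma F1_minor_iff:
  assumes "simple_graph G"
  shows "contains_induced_minor G F1 \<longleftrightarrow> (\<exists>p A B C D. fin_graph.mdl (adj G) (verts G) p A B C D)"
proof -
  interpret fin_graph "adj G" "verts G"
    using sym_graph_adj assms by (simp add: fin_graph_def fin_graph_axioms_def simple_graph_def)
  have V: "verts F1 = {1, 2, 3, 4, 5}" by (simp add: F1_def)
  have E: "adj F1 1 2" "\<not> adj F1 1 3" "\<not> adj F1 1 4" "\<not> adj F1 1 5" "adj F1 2 3" "adj F1 2 4" "adj F1 2 5"
    "adj F1 3 4" "adj F1 3 5" "adj F1 4 5"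
    by (simp_all add: F1_def doubleton_eq_iff)
  show ?thesis
    unfolding contains_induced_minor_iff[OF assms simple_graph_F1]
  proof
    assume "\<exists>\<phi>. im_model G F1 \<phi>"
    then obtain \<phi> where m: "im_model G F1 \<phi>" by blast
    note D = im_modelD[OF m, unfolded V]
    have "touch (adj G) (\<phi> 1) (\<phi> 2)" using D(4)[of 1 2] E by simp
    then obtain p where p: "p \<in> \<phi> 1" "touch (adj G) {p} (\<phi> 2)" unfolding touch_def by blast
    have n: "\<not> touch (adj G) {p} (\<phi> i)" if "i = 3 \<or> i = 4 \<or> i = 5" for i
    proof -
      have "\<not> touch (adj G) (\<phi> 1) (\<phi> i)" using D(4)[of 1 i] that E by auto
      then show ?thesis using p(1) unfolding touch_def by blast
    qed
    have "mdl p (\<phi> 2) (\<phi> 3) (\<phi> 4) (\<phi> 5)"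
    proof (rule mdlI)
      show "touch (adj G) (\<phi> 2) (\<phi> 3) \<and> touch (adj G) (\<phi> 2) (\<phi> 4) \<and> touch (adj G) (\<phi> 2) (\<phi> 5) \<and>
        touch (adj G) (\<phi> 3) (\<phi> 4) \<and> touch (adj G) (\<phi> 3) (\<phi> 5) \<and> touch (adj G) (\<phi> 4) (\<phi> 5)"
        using D(4)[of 2 3] D(4)[of 2 4] D(4)[of 2 5] D(4)[of 3 4] D(4)[of 3 5] D(4)[of 4 5] E by simp
      show "\<phi> 2 \<inter> \<phi> 3 = {} \<and> \<phi> 2 \<inter> \<phi> 4 = {} \<and> \<phi> 2 \<inter> \<phi> 5 = {} \<and> \<phi> 3 \<inter> \<phi> 4 = {} \<and> \<phi> 3 \<inter> \<phi> 5 = {} \<and> \<phi> 4 \<inter> \<phi> 5 = {}"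
        using D(3)[of 2 3] D(3)[of 2 4] D(3)[of 2 5] D(3)[of 3 4] D(3)[of 3 5] D(3)[of 4 5] by simp
      show "insert p (\<phi> 2 \<union> \<phi> 3 \<union> \<phi> 4 \<union> \<phi> 5) \<subseteq> verts G \<and> p \<notin> \<phi> 2 \<union> \<phi> 3 \<union> \<phi> 4 \<union> \<phi> 5"
        using D(1)[of 1] D(1)[of 2] D(1)[of 3] D(1)[of 4] D(1)[of 5] p(1)
          D(3)[of 1 2] D(3)[of 1 3] D(3)[of 1 4] D(3)[of 1 5] by auto
    qed (use D(2) p(2) n in simp_all)
    then show "\<exists>p A B C D. mdl p A B C D" by blast
  next
    assume "\<exists>p A B C D. mdl p A B C D"
    then obtain p A B C D where m: "mdl p A B C D" by blast
    note M = mdlD[OF m]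
    note M' = mdl_touch[OF m, THEN touch_sym[THEN iffD1]]
    have p': "touch (adj G) A {p}" "\<not> touch (adj G) B {p}" "\<not> touch (adj G) C {p}" "\<not> touch (adj G) D {p}"
      using mdl_pend[OF m] touch_sym[of A "{p}"] touch_sym[of B "{p}"] touch_sym[of C "{p}"] touch_sym[of D "{p}"]
      by simp_all
    have E': "adj F1 2 1" "\<not> adj F1 3 1" "\<not> adj F1 4 1" "\<not> adj F1 5 1" "adj F1 3 2" "adj F1 4 2" "adj F1 5 2"
      "adj F1 4 3" "adj F1 5 3" "adj F1 5 4"
      by (simp_all add: F1_def doubleton_eq_iff)
    define \<phi> where "\<phi> = (\<lambda>x::nat. if x = 1 then {p} else if x = 2 then A else if x = 3 then B else if x = 4 then C else D)"
    have \<phi>: "\<phi> 1 = {p}" "\<phi> 2 = A" "\<phi> 3 = B" "\<phi> 4 = C" "\<phi> 5 = D" by (simp_all add: \<phi>_def)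
    have ball: "(\<forall>x\<in>{1, 2, 3, 4, 5}. P x) \<longleftrightarrow> P 1 \<and> P 2 \<and> P 3 \<and> P 4 \<and> P 5" for P :: "nat \<Rightarrow> bool" by simp
    have "im_model G F1 \<phi>"
      unfolding im_model_def V ball \<phi> using M M' E E' p' by (simp add: Int_commute)
    then show "\<exists>\<phi>. im_model G F1 \<phi>" by blast
  qed
qed

section \<open>From models with bounded attachment to first-order certificates\<close>

section \<open>Certificates\<close>

lemma touch_push:
  "touch E A B \<Longrightarrow> A \<subseteq> U \<Longrightarrow> B \<subseteq> U \<Longrightarrow> touch (contr f U E) (f ` A) (f ` B)"
  unfolding touch_def contr_def by blast

lemma reach_closed:
  assumes "reach E U a b" "a \<in> C" "\<And>u v. u \<in> U \<Longrightarrow> v \<in> U \<Longrightarrow> u \<in> C \<Longrightarrow> E u v \<Longrightarrow> v \<in> C"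
  shows "reach E (U \<inter> C) a b \<and> b \<in> C"
  using assms(1) unfolding reach_def
proof (induction rule: rtranclp_induct)
  case (step y z)
  then have "z \<in> C" "y \<in> U \<inter> C \<and> z \<in> U \<inter> C \<and> E y z" using assms(3) by auto
  then show ?case using step.IH rtranclp.rtrancl_into_rtrancl[of _ a y z] by simp
qed (use assms(2) in simp)

text \<open>Adding an adjacent vertex to a bag destroys no contact, so the bags can absorb all of
  \<open>W\<close>. This is what forces the contracted vertex \<open>r\<close> into a bag.\<close>

lemma (in sym_graph) k4_spanning:
  assumes "conn E W" "finite W" "k4 E A B C D" "A \<union> B \<union> C \<union> D \<subseteq> W"
  shows "\<exists>A B C D. k4 E A B C D \<and> A \<union> B \<union> C \<union> D = W"
  using assms(3,4)
proof (induction "card (W - (A \<union> B \<union> C \<union> D))" arbitrary: A B C D rule: less_induct)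
  case less
  let ?U = "A \<union> B \<union> C \<union> D"
  note k = less.prems(1)
  show ?case
  proof (cases "?U = W")
    case False
    have "?U \<noteq> {}" using k conn_nonempty unfolding k4_def by blast
    then obtain u w where uw: "u \<in> ?U" "w \<in> W - ?U" "E u w"
      using conn_crossing[OF assms(1) less.prems(2) _ False] by blast
    have grow: "k4 E (insert w A) B C D" if "u \<in> A" "k4 E A B C D" "w \<notin> B \<union> C \<union> D" for A B C D
    proof -
      have "touch E A {w}" using that uw by (auto simp: touch_def)
      then have "conn E (insert w A)" using that conn_insert unfolding k4_def by blast
      then show ?thesis using that(2,3) unfolding k4_def by (auto simp: touch_insert1[of E w A])
    qed
    have w: "w \<notin> A" "w \<notin> B" "w \<notin> C" "w \<notin> D" using uw by auto
    have card: "card (W - insert w ?U) < card (W - ?U)"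
      using uw assms(2) by (intro psubset_card_mono) auto
    consider "u \<in> A" | "u \<in> B" | "u \<in> C" | "u \<in> D" using uw by blast
    then show ?thesis
    proof cases
      case 1
      then have "k4 E (insert w A) B C D" using grow k w by simp
      then show ?thesis using less.hyps[of "insert w A" B C D] card uw less.prems(2) by simp
    next
      case 2
      then have "k4 E (insert w B) A C D" using grow[of B A C D] k4_perm(3)[OF k] w by simp
      then have "k4 E A (insert w B) C D" by (rule k4_perm(3))
      then show ?thesis using less.hyps[of A "insert w B" C D] card uw less.prems(2) by simp
    next
      case 3
      then have "k4 E (insert w C) A B D" using grow[of C A B D] k4_perm(3)[OF k4_perm(1)[OF k]] w by simp
      then have "k4 E A B (insert w C) D" using k4_perm(1)[OF k4_perm(3)] by blast
      then show ?thesis using less.hyps[of A B "insert w C" D] card uw less.prems(2) by simp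
    next
      case 4
      then have "k4 E (insert w D) A B C"
        using grow[of D A B C] k4_perm(3)[OF k4_perm(1)[OF k4_perm(2)[OF k]]] w by simp
      then have "k4 E A B C (insert w D)" using k4_perm(2)[OF k4_perm(1)[OF k4_perm(3)]] by blast
      then show ?thesis using less.hyps[of A B C "insert w D"] card uw less.prems(2) by simp
    qed
  qed (use k in blast)
qed

context fin_graph
begin

text \<open>Contracting the connected set \<open>A0\<close> to \<open>r\<close> and deleting \<open>p\<close> and its other neighbours.\<close>

definition rverts :: "'a \<Rightarrow> 'a set \<Rightarrow> 'a \<Rightarrow> 'a set" where
  "rverts p A0 r = insert r {v \<in> V. v \<noteq> p \<and> \<not> E p v \<and> v \<notin> A0}"

definition radj :: "'a set \<Rightarrow> 'a \<Rightarrow> 'a \<Rightarrow> 'a \<Rightarrow> bool" where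
  "radj A0 r a b \<longleftrightarrow> E a b \<or> (a = r \<and> (\<exists>x\<in>A0. E x b)) \<or> (b = r \<and> (\<exists>x\<in>A0. E a x))"

text \<open>Only \<open>u1\<close> is required to be in the component of \<open>r\<close>; the other
  three are there because they cannot be separated from \<open>u1\<close>.\<close>

definition certified :: bool where
  "certified \<longleftrightarrow> (\<exists>p A0 r u1 u2 u3 u4. p \<in> V \<and> A0 \<subseteq> V \<and> r \<in> A0 \<and> card A0 \<le> 6 \<and> p \<notin> A0 \<and>
     conn E A0 \<and> (\<exists>a\<in>A0. E p a) \<and>
     {u1, u2, u3, u4} \<subseteq> rverts p A0 r \<and> distinct [u1, u2, u3, u4] \<and>
     reach (radj A0 r) (rverts p A0 r) r u1 \<and>
     insep (radj A0 r) (rverts p A0 r) u1 u2 \<and> insep (radj A0 r) (rverts p A0 r) u1 u3 \<and>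
     insep (radj A0 r) (rverts p A0 r) u1 u4 \<and> insep (radj A0 r) (rverts p A0 r) u2 u3 \<and>
     insep (radj A0 r) (rverts p A0 r) u2 u4 \<and> insep (radj A0 r) (rverts p A0 r) u3 u4)"

context
  fixes p :: 'a and A0 :: "'a set" and r :: 'a
  assumes A0V: "A0 \<subseteq> V" and rA0: "r \<in> A0"
begin

text \<open>The vertices that remain before the contraction: all of \<open>A0\<close>, where
  \<open>rverts\<close> keeps only \<open>r\<close>.\<close>

definition rdom where "rdom = A0 \<union> rverts p A0 r"

definition rmap where "rmap x = (if x \<in> A0 then r else x)"

lemma radj_contr:
  assumes "a \<in> rverts p A0 r" "b \<in> rverts p A0 r" "a \<noteq> b"
  shows "radj A0 r a b \<longleftrightarrow> contr rmap rdom E a b"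
proof
  have ab: "a \<in> A0 \<Longrightarrow> a = r" "b \<in> A0 \<Longrightarrow> b = r" using assms by (auto simp: rverts_def)
  show "contr rmap rdom E a b" if "radj A0 r a b"
    using that ab assms rA0 unfolding radj_def contr_def rdom_def rmap_def by auto
  assume "contr rmap rdom E a b"
  then obtain x y where xy: "rmap x = a" "rmap y = b" "E x y" unfolding contr_def by blast
  then show "radj A0 r a b" using assms(3) unfolding radj_def rmap_def by (auto split: if_splits)
qed

lemma sym_radj: "sym_graph (radj A0 r)"
  unfolding sym_graph_def radj_def using E_sym by blast

lemma conn_radj: "A \<subseteq> rverts p A0 r \<Longrightarrow> conn (radj A0 r) A \<longleftrightarrow> conn (contr rmap rdom E) A"
  using conn_cong_neq[of "radj A0 r" A "contr rmap rdom E"] conn_cong_neq[of "contr rmap rdom E" A "radj A0 r"] radj_contr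
  by blast

lemma touch_radj:
  assumes "A \<subseteq> rverts p A0 r" "B \<subseteq> rverts p A0 r" "A \<inter> B = {}"
  shows "touch (radj A0 r) A B \<longleftrightarrow> touch (contr rmap rdom E) A B"
proof -
  have "radj A0 r a b \<longleftrightarrow> contr rmap rdom E a b" if "a \<in> A" "b \<in> B" for a b
    using radj_contr[of a b] that assms by blast
  then show ?thesis unfolding touch_def by blast
qed

lemma k4_radj:
  assumes "A \<union> B \<union> C \<union> D \<subseteq> rverts p A0 r"
  shows "k4 (radj A0 r) A B C D \<longleftrightarrow> k4 (contr rmap rdom E) A B C D"
proof -
  have s: "A \<subseteq> rverts p A0 r" "B \<subseteq> rverts p A0 r" "C \<subseteq> rverts p A0 r" "D \<subseteq> rverts p A0 r"
    using assms by auto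
  show ?thesis
    unfolding k4_def tri_def using conn_radj[OF s(1)] conn_radj[OF s(2)] conn_radj[OF s(3)] conn_radj[OF s(4)]
      touch_radj[OF s(1,2)] touch_radj[OF s(1,3)] touch_radj[OF s(1,4)] touch_radj[OF s(2,3)]
      touch_radj[OF s(2,4)] touch_radj[OF s(3,4)] by (auto simp: Int_Un_distrib)
qed

lemma rmap_fiber: "a \<in> rverts p A0 r \<Longrightarrow> rdom \<inter> rmap -` {a} = (if a = r then A0 else {a})"
  unfolding rdom_def rmap_def rverts_def using rA0 by auto

end

text \<open>In a model with bounded attachment no bag loses a vertex: \<open>B\<close>,
  \<open>C\<close>, \<open>D\<close> avoid the neighbours of \<open>p\<close>, and those in
  \<open>A\<close> belong to \<open>A0\<close>. The model is pushed through the contraction, and its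
  inseparable vertices are the certificate, with \<open>u1\<close> in the bag of
  \<open>r\<close>.\<close>

lemma certified_if_mdl:
  assumes "mdl p A B C D"
  shows certified
proof -
  obtain p A B C D A0 where m: "mdl p A B C D" and c0: "conn E A0" and A0: "A0 \<subseteq> A" "card A0 \<le> 6"
    and nb: "\<And>x. x \<in> A \<Longrightarrow> E p x \<Longrightarrow> x \<in> A0"
    using bounded_attachment[OF assms] unfolding good_def by blast
  note M = mdlD[OF m] and ms = mdl_sets[OF m] and md = mdl_disj[OF m]
  obtain r where r: "r \<in> A0" using conn_nonempty[OF c0] by blast
  have A0V: "A0 \<subseteq> V" using A0 ms by blast
  note ctx = A0V r
  let ?V = "rverts p A0 r" and ?E = "radj A0 r"
  let ?rmap = "rmap A0 r" and ?rdom = "rdom p A0 r"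
  have nE: "\<not> E p x" if "x \<in> B \<union> C \<union> D" for x
    using mdl_pend[OF m] that unfolding touch_def by blast
  have sub: "B \<subseteq> ?V" "C \<subseteq> ?V" "D \<subseteq> ?V" "A \<subseteq> ?rdom"
  proof -
    have "x \<in> ?V" if "x \<in> B \<union> C \<union> D" for x
      using that nE[OF that] ms md(1-3) A0(1) unfolding rverts_def by blast
    then show "B \<subseteq> ?V" "C \<subseteq> ?V" "D \<subseteq> ?V" by blast+
    show "A \<subseteq> ?rdom" using nb ms unfolding rdom_def[OF ctx] rverts_def by blast
  qed
  then have subU: "B \<subseteq> ?rdom" "C \<subseteq> ?rdom" "D \<subseteq> ?rdom" unfolding rdom_def[OF ctx] by blast+
  have id: "?rmap ` X = X" if "X \<inter> A = {}" for X
    using that A0(1) by (auto simp: rmap_def[OF ctx] image_iff)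
  have idX: "?rmap ` B = B" "?rmap ` C = C" "?rmap ` D = D" using id md(1-3) by (simp_all add: Int_commute)
  have fA: "?rmap ` A \<subseteq> ?V" "r \<in> ?rmap ` A" "?rmap ` A \<subseteq> A"
    using A0(1) r sub(4) by (auto simp: rmap_def[OF ctx] rdom_def[OF ctx] rverts_def)
  have "k4 (contr ?rmap ?rdom E) (?rmap ` A) B C D"
    unfolding k4_def tri_def
    using conn_push[OF mdl_conn(1)[OF m] sub(4), of ?rmap] conn_push[OF mdl_conn(2)[OF m] subU(1), of ?rmap]
      conn_push[OF mdl_conn(3)[OF m] subU(2), of ?rmap] conn_push[OF mdl_conn(4)[OF m] subU(3), of ?rmap]
      touch_push[OF mdl_touch(1)[OF m] sub(4) subU(1), of ?rmap] touch_push[OF mdl_touch(2)[OF m] sub(4) subU(2), of ?rmap]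
      touch_push[OF mdl_touch(3)[OF m] sub(4) subU(3), of ?rmap] touch_push[OF mdl_touch(4)[OF m] subU(1) subU(2), of ?rmap]
      touch_push[OF mdl_touch(5)[OF m] subU(1) subU(3), of ?rmap] touch_push[OF mdl_touch(6)[OF m] subU(2) subU(3), of ?rmap]
      md fA(3) unfolding idX by blast
  moreover have all: "?rmap ` A \<union> B \<union> C \<union> D \<subseteq> ?V" using fA sub by blast
  ultimately have k: "k4 ?E (?rmap ` A) B C D" using k4_radj[OF ctx all] by simp
  have finV: "finite ?V" using fin_V A0V r by (auto simp: rverts_def)
  interpret R: sym_graph ?E by (rule sym_radj[OF ctx])
  obtain a b c d where t: "a \<in> ?rmap ` A" "b \<in> B" "c \<in> C" "d \<in> D"
    and i: "insep ?E ?V a b" "insep ?E ?V a c" "insep ?E ?V a d" "insep ?E ?V b c" "insep ?E ?V b d" "insep ?E ?V c d"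
    using R.k4_insep[OF finV k all] by blast
  have "reach ?E (?rmap ` A) r a" using k fA(2) t(1) unfolding k4_def conn_def by blast
  then have rr: "reach ?E ?V r a" using fA(1) by (rule reach_mono)
  have "a \<in> A" using t fA by blast
  then have "distinct [a, b, c, d]" using t md by auto
  moreover have "{a, b, c, d} \<subseteq> ?V" using t fA sub by blast
  moreover have "\<exists>a\<in>A0. E p a" using mdl_pend(1)[OF m] nb unfolding touch_def by blast
  moreover have "p \<in> V" "p \<notin> A0" using ms A0 by auto
  ultimately show ?thesis unfolding certified_def
    using A0V r A0(2) c0 rr i by blast
qed

text \<open>A K4 model spanning the component of \<open>r\<close> is relabelled so that
  \<open>r\<close> lies in \<open>A\<close>, and pulled back. The preimage of \<open>A\<close>
  contains \<open>A0\<close>, hence a neighbour of \<open>p\<close>, and the other bags consist of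
  vertices that are not adjacent to \<open>p\<close>.\<close>

lemma mdl_if_certified:
  assumes certified
  shows "\<exists>p A B C D. mdl p A B C D"
proof -
  obtain p A0 r u1 u2 u3 u4 where p: "p \<in> V" "p \<notin> A0" and A0V: "A0 \<subseteq> V" and r: "r \<in> A0" and c0: "conn E A0"
    and pA: "\<exists>a\<in>A0. E p a" and u: "{u1, u2, u3, u4} \<subseteq> rverts p A0 r" "distinct [u1, u2, u3, u4]"
    and r1: "reach (radj A0 r) (rverts p A0 r) r u1"
    and i: "insep (radj A0 r) (rverts p A0 r) u1 u2" "insep (radj A0 r) (rverts p A0 r) u1 u3"
     "insep (radj A0 r) (rverts p A0 r) u1 u4" "insep (radj A0 r) (rverts p A0 r) u2 u3"
     "insep (radj A0 r) (rverts p A0 r) u2 u4" "insep (radj A0 r) (rverts p A0 r) u3 u4"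
    using assms unfolding certified_def by (elim exE conjE) (rule that; assumption)
  note ctx = A0V r
  let ?V = "rverts p A0 r" and ?E = "radj A0 r"
  let ?rmap = "rmap A0 r" and ?rdom = "rdom p A0 r"
  interpret R: sym_graph ?E by (rule sym_radj[OF ctx])
  define W where "W = {z \<in> ?V. reach ?E ?V r z}"
  have finV: "finite ?V" using fin_V A0V r by (auto simp: rverts_def)
  have rV: "r \<in> ?V" by (simp add: rverts_def)
  have W: "conn ?E W" "finite W" "r \<in> W" "W \<subseteq> ?V"
    using R.conn_component[OF rV] finV rV by (auto simp: W_def)
  have closed: "v \<in> W" if "u \<in> W" "v \<in> ?V" "?E u v" for u v
    using that reach_trans[OF _ reach_step[of u ?V v ?E]] by (auto simp: W_def)
  have uW: "u1 \<in> W" using u r1 by (auto simp: W_def)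
  \<comment> \<open>Deleting the same vertex \<open>c\<close> twice turns inseparability into plain
    reachability.\<close>
  have sepV: "reach ?E ?V a b" if ab: "insep ?E ?V a b" "c \<notin> {a, b}" for a b c
  proof -
    have "reach ?E (?V - {c, c}) a b" using ab unfolding insep_def by blast
    then show ?thesis by (rule reach_mono) auto
  qed
  have "u2 \<in> W" "u3 \<in> W" "u4 \<in> W"
    using sepV[OF i(1), of u3] sepV[OF i(2), of u2] sepV[OF i(3), of u2] u r1 reach_trans[OF r1]
    by (auto simp: W_def)
  then have UW: "{u1, u2, u3, u4} \<subseteq> W" using uW by simp
  \<comment> \<open>A walk starting in a component cannot leave it, so restricting the graph to
    \<open>W\<close> keeps the vertices inseparable.\<close>
  have insW: "insep ?E W a b" if ab: "a \<in> W" "insep ?E ?V a b" for a b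
    unfolding insep_def
  proof (intro allI impI)
    fix x y assume "x \<notin> {a, b}" "y \<notin> {a, b}"
    then have "reach ?E (?V - {x, y}) a b" using ab unfolding insep_def by blast
    then have "reach ?E ((?V - {x, y}) \<inter> W) a b" using reach_closed[OF _ ab(1)] closed by blast
    then show "reach ?E (W - {x, y}) a b" by (rule reach_mono) auto
  qed
  have insW': "insep ?E W b a" if "insep ?E W a b" for a b
    using that R.reach_sym unfolding insep_def by blast
  note iW = insW[OF _ i(1)] insW[OF _ i(2)] insW[OF _ i(3)] insW[OF _ i(4)] insW[OF _ i(5)] insW[OF _ i(6)]
  have "\<exists>A B C D. k4 ?E A B C D \<and> A \<union> B \<union> C \<union> D \<subseteq> W"
  proof (rule k4_if_insep[OF sym_radj[OF ctx] W(2) UW])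
    show "card {u1, u2, u3, u4} = 4" using u(2) by simp
    fix a b assume "a \<in> {u1, u2, u3, u4}" "b \<in> {u1, u2, u3, u4}" "a \<noteq> b"
    then show "insep ?E W a b" using iW iW[THEN insW'] UW by auto
  qed
  then obtain A B C D where k: "k4 ?E A B C D" "A \<union> B \<union> C \<union> D = W"
    using R.k4_spanning[OF W(1,2)] by blast
  have "\<exists>A B C D. k4 ?E A B C D \<and> A \<union> B \<union> C \<union> D = W \<and> r \<in> A"
  proof -
    consider "r \<in> A" | "r \<in> B" | "r \<in> C" | "r \<in> D" using k(2) W(3) by blast
    then show ?thesis
    proof cases
      case 2
      then show ?thesis using R.k4_perm(3)[OF k(1)] k(2) by (intro exI[of _ B] exI[of _ A] exI[of _ C] exI[of _ D]) auto
    next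
      case 3
      then show ?thesis using R.k4_perm(3)[OF R.k4_perm(1)[OF k(1)]] k(2)
        by (intro exI[of _ C] exI[of _ A] exI[of _ B] exI[of _ D]) auto
    next
      case 4
      then show ?thesis using R.k4_perm(3)[OF R.k4_perm(1)[OF R.k4_perm(2)[OF k(1)]]] k(2)
        by (intro exI[of _ D] exI[of _ A] exI[of _ B] exI[of _ C]) auto
    qed (use k in blast)
  qed
  then obtain A B C D where k: "k4 ?E A B C D" and un: "A \<union> B \<union> C \<union> D = W" and rA: "r \<in> A" by blast
  have all: "A \<union> B \<union> C \<union> D \<subseteq> ?V" using un W(4) by simp
  have "k4 (contr ?rmap ?rdom E) A B C D" using k k4_radj[OF ctx all] by simp
  moreover have "conn E (?rdom \<inter> ?rmap -` {a})" if "a \<in> A \<union> B \<union> C \<union> D" for a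
    using rmap_fiber[OF ctx, of a p] that all c0 by auto
  ultimately have k': "k4 E (?rdom \<inter> ?rmap -` A) (?rdom \<inter> ?rmap -` B) (?rdom \<inter> ?rmap -` C) (?rdom \<inter> ?rmap -` D)"
    by (intro k4_pull sym_graph_axioms) auto
  have rn: "r \<notin> B" "r \<notin> C" "r \<notin> D" using k rA unfolding k4_def by auto
  have sub: "A \<subseteq> ?V" "B \<subseteq> ?V" "C \<subseteq> ?V" "D \<subseteq> ?V" using all by auto
  have pre: "?rdom \<inter> ?rmap -` X = X" "\<not> touch E {p} X" "p \<notin> X" "X \<subseteq> V" if "X \<subseteq> ?V" "r \<notin> X" for X
  proof -
    have X: "x \<in> V \<and> x \<noteq> p \<and> \<not> E p x \<and> x \<notin> A0" if "x \<in> X" for x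
      using that \<open>X \<subseteq> ?V\<close> \<open>r \<notin> X\<close> unfolding rverts_def by auto
    show "\<not> touch E {p} X" "p \<notin> X" "X \<subseteq> V" using X by (auto simp: touch_def)
    show "?rdom \<inter> ?rmap -` X = X" using X that by (auto simp: rdom_def[OF ctx] rmap_def[OF ctx] split: if_splits)
  qed
  note PB = pre[OF sub(2) rn(1)] and PC = pre[OF sub(3) rn(2)] and PD = pre[OF sub(4) rn(3)]
  have A': "A0 \<subseteq> ?rdom \<inter> ?rmap -` A" "p \<notin> ?rdom" "?rdom \<subseteq> V"
    using rA p A0V r by (auto simp: rdom_def[OF ctx] rmap_def[OF ctx] rverts_def)
  have "touch E {p} (?rdom \<inter> ?rmap -` A)" using pA A'(1) unfolding touch_def by blast
  then have "mdl p (?rdom \<inter> ?rmap -` A) B C D"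
    using k' PB PC PD A' p unfolding mdl_def PB(1) PC(1) PD(1) by auto
  then show ?thesis by blast
qed

theorem mdl_iff_certified: "(\<exists>p A B C D. mdl p A B C D) \<longleftrightarrow> certified"
  using certified_if_mdl mdl_if_certified by blast

end

section \<open>From structured programs to Turing machines\<close>

section \<open>Structured programs and Turing machines\<close>

datatype instr =
    Act nat "nat \<Rightarrow> nat \<times> direction"
  | Cond "nat list \<Rightarrow> bool" "instr list" "instr list"
  | Loop "nat list \<Rightarrow> bool" "instr list"
  | Halt bool

text \<open>Reduction modulo 8 keeps every written symbol in the finite alphabet, whatever function
  an \<open>Act\<close> carries.\<close>

definition clip :: "nat \<times> direction \<Rightarrow> nat \<times> direction" where
  "clip a = (fst a mod 8, snd a)"

fun pstep :: "instr list \<times> tape list \<Rightarrow> instr list \<times> tape list" where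
  "pstep ([], ts) = ([], ts)"
| "pstep (Halt b # k, ts) = (Halt b # k, ts)"
| "pstep (Act j f # k, ts) = (k, ts[j := act_tape (clip (f (read_tape (ts ! j)))) (ts ! j)])"
| "pstep (Cond P c d # k, ts) = ((if P (map read_tape ts) then c else d) @ k, ts)"
| "pstep (Loop P c # k, ts) = ((if P (map read_tape ts) then c @ Loop P c # k else k), ts)"

text \<open>The control states of the machine running a program are the instruction lists that are still
  to be executed; there are only finitely many of them.\<close>

fun succs :: "instr list \<Rightarrow> instr list set" where
  "succs [] = {[]}"
| "succs (Halt b # k) = {Halt b # k}"
| "succs (Act j f # k) = {k}"
| "succs (Cond P c d # k) = {c @ k, d @ k}"
| "succs (Loop P c # k) = {c @ Loop P c # k, k}"

lemma fst_pstep: "fst (pstep (c, ts)) \<in> succs c"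
  by (cases "(c, ts)" rule: pstep.cases) auto

lemma succs_append: "c \<noteq> [] \<Longrightarrow> succs (c @ k) = (\<lambda>x. x @ k) ` succs c"
  by (cases c rule: succs.cases) auto

definition closed_conts :: "instr list \<Rightarrow> instr list set \<Rightarrow> bool" where
  "closed_conts c S \<longleftrightarrow> finite S \<and> c \<in> S \<and> [] \<in> S \<and> (\<forall>d\<in>S. succs d \<subseteq> S)"

lemma closed_conts_append:
  assumes "closed_conts c S" "closed_conts d T"
  shows "closed_conts (c @ d) ((\<lambda>x. x @ d) ` S \<union> T)"
  unfolding closed_conts_def
proof (intro conjI ballI)
  fix e assume "e \<in> (\<lambda>x. x @ d) ` S \<union> T"
  then consider "e \<in> T" | x where "x \<in> S" "x \<noteq> []" "e = x @ d"
    using assms(2) unfolding closed_conts_def by force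
  then show "succs e \<subseteq> (\<lambda>x. x @ d) ` S \<union> T"
  proof cases
    case 2
    then show ?thesis using assms(1) succs_append[of x d] unfolding closed_conts_def by blast
  qed (use assms(2) closed_conts_def in blast)
qed (use assms in \<open>auto simp: closed_conts_def\<close>)

lemma closed_conts_list:
  assumes "\<And>i. i \<in> set c \<Longrightarrow> \<exists>S. closed_conts [i] S"
  shows "\<exists>S. closed_conts c S"
  using assms
proof (induction c)
  case Nil
  have "closed_conts [] {[]}" by (simp add: closed_conts_def)
  then show ?case by blast
next
  case (Cons i c)
  then obtain S T where "closed_conts [i] S" "closed_conts c T" by fastforce
  then have "closed_conts (i # c) ((\<lambda>x. x @ c) ` S \<union> T)" using closed_conts_append[of "[i]" S c T] by simp
  then show ?case by blast
qed

lemma closed_conts_instr: "\<exists>S. closed_conts [i] S"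
proof (induction i)
  case (Act j f)
  have "closed_conts [Act j f] {[Act j f], []}" by (simp add: closed_conts_def)
  then show ?case by blast
next
  case (Cond P c d)
  obtain S T where S: "closed_conts c S" and T: "closed_conts d T"
    using closed_conts_list[of c] closed_conts_list[of d] Cond by blast
  have "closed_conts [Cond P c d] (insert [Cond P c d] (S \<union> T))"
    using S T unfolding closed_conts_def by auto
  then show ?case by blast
next
  case (Loop P c)
  obtain S where S: "closed_conts c S" using closed_conts_list[of c] Loop by blast
  \<comment> \<open>While the body runs, the loop itself waits behind it; the body's empty
    continuation thus becomes the loop, which may also be left for \<open>[]\<close>.\<close>
  let ?T = "insert [] ((\<lambda>x. x @ [Loop P c]) ` S)"
  have "closed_conts [Loop P c] ?T"
    unfolding closed_conts_def
  proof (intro conjI ballI)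
    fix e assume "e \<in> ?T"
    then consider "e = []" | "e = [Loop P c]" | x where "x \<in> S" "x \<noteq> []" "e = x @ [Loop P c]" by force
    then show "succs e \<subseteq> ?T"
    proof cases
      case 3
      then show ?thesis using S succs_append[of x "[Loop P c]"] unfolding closed_conts_def by blast
    qed (use S in \<open>auto simp: closed_conts_def\<close>)
  qed (use S in \<open>force simp: closed_conts_def\<close>)+
  then show ?case by blast
next
  case (Halt b)
  have "closed_conts [Halt b] {[Halt b], []}" by (simp add: closed_conts_def)
  then show ?case by blast
qed

lemma ex_closed_conts: "\<exists>S. closed_conts c S"
  using closed_conts_list closed_conts_instr by blast

context
  fixes e :: "instr list \<Rightarrow> nat" and S :: "instr list set"
begin

text \<open>Continuations are numbered by \<open>e\<close> below \<open>card S\<close>. Those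
  starting with \<open>Halt\<close> are identified with the accepting state \<open>card S\<close> or
  the rejecting state \<open>Suc (card S)\<close>, so the machine stops as soon as
  \<open>Halt\<close> comes to the front. An exhausted program rejects.\<close>

fun st :: "instr list \<Rightarrow> nat" where
  "st [] = Suc (card S)"
| "st (Halt b # k) = (if b then card S else Suc (card S))"
| "st (Act j f # k) = e (Act j f # k)"
| "st (Cond P c d # k) = e (Cond P c d # k)"
| "st (Loop P c # k) = e (Loop P c # k)"

definition prog_delta :: "nat \<Rightarrow> nat list \<Rightarrow> nat \<times> (nat \<times> direction) list" where
  "prog_delta q rs = (let stay = map (\<lambda>s. (s, Stay)) rs in
     if q \<ge> card S then (Suc (card S), stay) else case the_inv_into S e q of
       Act j f # k \<Rightarrow> (st k, stay[j := clip (f (rs ! j))])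
     | Cond P c d # k \<Rightarrow> (st ((if P rs then c else d) @ k), stay)
     | Loop P c # k \<Rightarrow> (st (if P rs then c @ Loop P c # k else k), stay)
     | _ \<Rightarrow> (Suc (card S), stay))"

definition prog_tm :: "nat \<Rightarrow> instr list \<Rightarrow> tm" where
  "prog_tm n c = \<lparr>num_tapes = n, num_syms = 8, num_states = card S + 2, start_state = st c,
     accept_state = card S, reject_state = Suc (card S), delta = prog_delta\<rparr>"

context
  assumes bij: "bij_betw e S {..<card S}" and fin: "finite S"
    and closed: "\<And>d. d \<in> S \<Longrightarrow> succs d \<subseteq> S"
begin

lemma st_le: "c \<in> S \<Longrightarrow> st c \<le> Suc (card S)"
proof -
  assume "c \<in> S"
  then have "e c < card S" using bij by (auto simp: bij_betw_def)
  then show ?thesis by (cases c rule: succs.cases) auto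
qed

lemma the_inv_e: "c \<in> S \<Longrightarrow> the_inv_into S e (e c) = c"
  using bij by (simp add: bij_betw_def the_inv_into_f_f)

lemma map2_stay: "map2 act_tape (map (\<lambda>s. (s, Stay)) (map read_tape ts)) ts = ts"
proof (rule nth_equalityI)
  fix i assume "i < length (map2 act_tape (map (\<lambda>s. (s, Stay)) (map read_tape ts)) ts)"
  then show "map2 act_tape (map (\<lambda>s. (s, Stay)) (map read_tape ts)) ts ! i = ts ! i"
    by (cases "ts ! i") simp
qed simp

lemma map2_act:
  "map2 act_tape ((map (\<lambda>s. (s, Stay)) (map read_tape ts))[j := a]) ts = ts[j := act_tape a (ts ! j)]"
proof (rule nth_equalityI)
  fix i assume "i < length (map2 act_tape ((map (\<lambda>s. (s, Stay)) (map read_tape ts))[j := a]) ts)"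
  then show "map2 act_tape ((map (\<lambda>s. (s, Stay)) (map read_tape ts))[j := a]) ts ! i
    = ts[j := act_tape a (ts ! j)] ! i"
    by (cases "ts ! i"; cases "i = j") simp_all
qed simp

text \<open>One step of the program is exactly one step of the machine, so time bounds carry over
  unchanged.\<close>

lemma prog_tm_step:
  assumes "c \<in> S"
  shows "tm_step (prog_tm n p) (st c, ts) = (st (fst (pstep (c, ts))), snd (pstep (c, ts)))"
proof -
  have "e c < card S" using bij assms by (auto simp: bij_betw_def)
  then have ne: "e c \<noteq> card S" "e c \<noteq> Suc (card S)" "\<not> card S \<le> e c" by auto
  show ?thesis
  proof (cases c rule: succs.cases)
    case (3 j f k)
    show ?thesis
    proof (cases "j < length ts")
      case True
      then show ?thesis using 3 ne the_inv_e[OF assms] map2_act[of ts j]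
        by (simp add: prog_tm_def prog_delta_def Let_def)
    next
      case False
      then show ?thesis using 3 ne the_inv_e[OF assms] map2_stay[of ts]
        by (simp add: prog_tm_def prog_delta_def Let_def list_update_beyond)
    qed
  qed (use ne the_inv_e[OF assms] map2_stay[of ts] in \<open>simp_all add: prog_tm_def prog_delta_def Let_def\<close>)
qed

lemma prog_tm_steps:
  assumes "c \<in> S"
  shows "(tm_step (prog_tm n p) ^^ t) (st c, ts) = (st (fst ((pstep ^^ t) (c, ts))), snd ((pstep ^^ t) (c, ts)))
    \<and> fst ((pstep ^^ t) (c, ts)) \<in> S"
proof (induction t)
  case (Suc t)
  obtain d us where d: "(pstep ^^ t) (c, ts) = (d, us)" by fastforce
  then have "d \<in> S" using Suc by simp
  then have "fst (pstep (d, us)) \<in> S" using fst_pstep closed by blast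
  then show ?case using Suc prog_tm_step[OF \<open>d \<in> S\<close>] d by simp
qed (use assms in simp)

lemma wf_prog_tm:
  assumes "c \<in> S" "n \<ge> 1"
  shows "wf_tm (prog_tm n c)"
proof -
  have "fst (prog_delta q rs) < card S + 2 \<and> length (snd (prog_delta q rs)) = n \<and>
    fst ` set (snd (prog_delta q rs)) \<subseteq> {..<8}"
    if q: "q < card S + 2" and rs: "length rs = n \<and> set rs \<subseteq> {..<8}" for q rs
  proof -
    let ?d = "the_inv_into S e q"
    have stay: "fst ` set (map (\<lambda>s. (s, Stay)) rs) \<subseteq> {..<8}" using rs by auto
    have upd: "fst ` set ((map (\<lambda>s. (s, Stay)) rs)[j := clip a]) \<subseteq> {..<8}" for j a
    proof -
      have "set ((map (\<lambda>s. (s, Stay)) rs)[j := clip a]) \<subseteq> insert (clip a) (set (map (\<lambda>s. (s, Stay)) rs))"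
        by (rule set_update_subset_insert)
      then have "fst ` set ((map (\<lambda>s. (s, Stay)) rs)[j := clip a])
          \<subseteq> insert (fst (clip a)) (fst ` set (map (\<lambda>s. (s, Stay)) rs))"
        unfolding image_insert[symmetric] by (rule image_mono)
      also have "\<dots> \<subseteq> {..<8}" using stay by (simp add: clip_def)
      finally show ?thesis .
    qed
    show ?thesis
    proof (cases "q < card S")
      case True
      then have dS: "?d \<in> S" using bij by (metis bij_betw_def lessThan_iff the_inv_into_into order_refl)
      have le: "st x < card S + 2" if "x \<in> succs ?d" for x
        using st_le[of x] closed[OF dS] that by auto
      show ?thesis
        by (cases ?d rule: succs.cases)
          (use le stay upd rs in \<open>auto simp: prog_delta_def Let_def\<close>)
    next
      case False
      then show ?thesis using rs stay by (simp add: prog_delta_def Let_def)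
    qed
  qed
  then show ?thesis using st_le[OF assms(1)] assms(2) unfolding wf_tm_def prog_tm_def by simp
qed

end

end

text \<open>The number of steps is the same for every continuation \<open>k\<close>, which makes
  runs compose by appending programs.\<close>

definition runs :: "instr list \<Rightarrow> tape list \<Rightarrow> nat \<Rightarrow> tape list \<Rightarrow> bool" where
  "runs c ts T us \<longleftrightarrow> (\<exists>t\<le>T. \<forall>k. (pstep ^^ t) (c @ k, ts) = (k, us))"

lemma runs_mono: "runs c ts T us \<Longrightarrow> T \<le> T' \<Longrightarrow> runs c ts T' us"
  unfolding runs_def by (meson order_trans)

lemma runs_Nil [simp]: "runs [] ts T ts"
  unfolding runs_def by (auto intro: exI[of _ 0])

lemma runs_append:
  assumes "runs c ts T us" "runs d us T' vs"
  shows "runs (c @ d) ts (T + T') vs"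
proof -
  obtain t t' where t: "t \<le> T" "\<And>k. (pstep ^^ t) (c @ k, ts) = (k, us)"
    and t': "t' \<le> T'" "\<And>k. (pstep ^^ t') (d @ k, us) = (k, vs)"
    using assms unfolding runs_def by blast
  have "(pstep ^^ (t' + t)) ((c @ d) @ k, ts) = (k, vs)" for k
    by (simp only: funpow_add o_apply append_assoc t(2) t'(2))
  then show ?thesis using t(1) t'(1) unfolding runs_def by (intro exI[of _ "t' + t"]) auto
qed

lemma runs_step:
  assumes "\<And>k. pstep (i # k, ts) = (d @ k, us)" "runs d us T vs"
  shows "runs [i] ts (Suc T) vs"
proof -
  obtain t where t: "t \<le> T" "\<And>k. (pstep ^^ t) (d @ k, us) = (k, vs)" using assms(2) unfolding runs_def by blast
  have "(pstep ^^ Suc t) ([i] @ k, ts) = (k, vs)" for k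
    by (simp only: funpow_Suc_right o_apply append_Cons append_Nil assms(1) t(2))
  then show ?thesis using t(1) unfolding runs_def by (intro exI[of _ "Suc t"]) auto
qed

lemma runs_Act: "runs [Act j f] ts 1 (ts[j := act_tape (clip (f (read_tape (ts ! j)))) (ts ! j)])"
  using runs_step[of "Act j f" ts "[]" _ 0] by simp

lemma runs_Cond:
  "runs (if P (map read_tape ts) then c else d) ts T us \<Longrightarrow> runs [Cond P c d] ts (Suc T) us"
  by (rule runs_step) simp_all

lemma runs_Loop_stop: "\<not> P (map read_tape ts) \<Longrightarrow> runs [Loop P c] ts 1 ts"
  using runs_step[of "Loop P c" ts "[]" ts 0] by simp

lemma runs_Loop_go:
  assumes "P (map read_tape ts)" "runs c ts T us" "runs [Loop P c] us T' vs"
  shows "runs [Loop P c] ts (Suc (T + T')) vs"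
  by (rule runs_step[OF _ runs_append[OF assms(2,3)]]) (use assms(1) in simp)

lemma runs_Cons: "runs [i] ts T us \<Longrightarrow> runs c us T' vs \<Longrightarrow> runs (i # c) ts (T + T') vs"
  using runs_append[of "[i]"] by simp

text \<open>Success means that \<open>Halt b\<close> comes to the front; what remains behind it is
  irrelevant.\<close>

definition halts :: "instr list \<Rightarrow> tape list \<Rightarrow> nat \<Rightarrow> bool \<Rightarrow> bool" where
  "halts c ts T b \<longleftrightarrow> (\<exists>t\<le>T. \<forall>k. \<exists>k' us. (pstep ^^ t) (c @ k, ts) = (Halt b # k', us))"

lemma halts_mono: "halts c ts T b \<Longrightarrow> T \<le> T' \<Longrightarrow> halts c ts T' b"
  unfolding halts_def by (meson order_trans)

lemma halts_Halt: "halts [Halt b] ts T b"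
  unfolding halts_def by (auto intro: exI[of _ 0])

lemma halts_append: "halts c ts T b \<Longrightarrow> halts (c @ d) ts T b"
  unfolding halts_def by (metis append.assoc)

lemma runs_halts:
  assumes "runs c ts T us" "halts d us T' b"
  shows "halts (c @ d) ts (T + T') b"
proof -
  obtain t t' where t: "t \<le> T" "\<And>k. (pstep ^^ t) (c @ k, ts) = (k, us)"
    and t': "t' \<le> T'" "\<And>k. \<exists>k' vs. (pstep ^^ t') (d @ k, us) = (Halt b # k', vs)"
    using assms unfolding runs_def halts_def by blast
  have "\<exists>k' vs. (pstep ^^ (t' + t)) ((c @ d) @ k, ts) = (Halt b # k', vs)" for k
    using t'(2)[of k] by (simp only: funpow_add o_apply append_assoc t(2))
  then show ?thesis using t(1) t'(1) unfolding halts_def by (intro exI[of _ "t' + t"]) auto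
qed

lemma halts_Cond:
  assumes "halts (if P (map read_tape ts) then c else d) ts T b"
  shows "halts [Cond P c d] ts (Suc T) b"
proof -
  let ?c = "if P (map read_tape ts) then c else d"
  obtain t where t: "t \<le> T" "\<And>k. \<exists>k' us. (pstep ^^ t) (?c @ k, ts) = (Halt b # k', us)"
    using assms unfolding halts_def by blast
  have "(pstep ^^ Suc t) ([Cond P c d] @ k, ts) = (pstep ^^ t) (?c @ k, ts)" for k
    by (simp add: funpow_Suc_right del: funpow.simps)
  then show ?thesis using t unfolding halts_def by (intro exI[of _ "Suc t"]) auto
qed

lemma decides_prog:
  assumes n: "n \<ge> 1"
    and c: "\<And>w. halts c (input_tape w # replicate (n - 1) ((\<lambda>_. 0), 0)) (T (length w)) (w \<in> L)"
  shows "\<exists>M. wf_tm M \<and> decides_in_time M L T"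
proof -
  obtain S where S: "closed_conts c S" using ex_closed_conts by blast
  then have fin: "finite S" and cl: "\<And>x. x \<in> S \<Longrightarrow> succs x \<subseteq> S" and cS: "c \<in> S"
    unfolding closed_conts_def by auto
  obtain e where e: "bij_betw e S {..<card S}"
    using ex_bij_betw_finite_nat[OF fin] by (auto simp: lessThan_atLeast0)
  let ?M = "prog_tm e S n c"
  have "wf_tm ?M" by (rule wf_prog_tm[OF e fin cl cS n])
  moreover have "decides_in_time ?M L T"
    unfolding decides_in_time_def
  proof
    fix w
    let ?ts = "input_tape w # replicate (n - 1) ((\<lambda>_. 0), 0)"
    have init: "init_config ?M w = (st e S c, ?ts)" by (simp add: init_config_def prog_tm_def)
    obtain t k' vs where t: "t \<le> T (length w)" "(pstep ^^ t) (c @ [], ?ts) = (Halt (w \<in> L) # k', vs)"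
      using c[of w] unfolding halts_def by blast
    then have "fst ((tm_step ?M ^^ t) (init_config ?M w)) =
        (if w \<in> L then accept_state ?M else reject_state ?M)"
      unfolding init using prog_tm_steps[OF e fin cl cS, where t = t and n = n and p = c and ts = ?ts]
      by (simp add: prog_tm_def)
    then show "\<exists>t\<le>T (length w). fst ((tm_step ?M ^^ t) (init_config ?M w)) =
        (if w \<in> L then accept_state ?M else reject_state ?M)"
      using t(1) by blast
  qed
  ultimately show ?thesis by blast
qed

lemma runs_Loop_iter:
  assumes "\<And>i. i < m \<Longrightarrow> P (map read_tape (s i)) \<and> runs c (s i) T (s (Suc i))"
    and "\<not> P (map read_tape (s m))"
  shows "runs [Loop P c] (s 0) (m * (T + 1) + 1) (s m)"
  using assms
proof (induction m arbitrary: s)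
  case 0
  then show ?case using runs_Loop_stop by simp
next
  case (Suc m)
  have "runs [Loop P c] (s (Suc 0)) (m * (T + 1) + 1) (s (Suc m))"
    using Suc.IH[of "\<lambda>i. s (Suc i)"] Suc.prems by simp
  from runs_Loop_go[OF _ _ this] Suc.prems(1)[of 0]
  have "runs [Loop P c] (s 0) (Suc (T + (m * (T + 1) + 1))) (s (Suc m))" by simp
  then show ?case by (rule runs_mono) simp
qed

section \<open>Counters, bit arrays and matrix lookup on work tapes\<close>

section \<open>Programs on counters and bit arrays\<close>

definition inp :: "bool list \<Rightarrow> nat \<Rightarrow> nat" where
  "inp w = fst (input_tape w)"

text \<open>A work tape holds a bit array (weight 2) together with marks at the cells \<open>0\<close> (weight 1) and
  \<open>n\<close> (weight 4), so that its head position serves as a counter with tests for \<open>0\<close> and \<open>n\<close>.\<close>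

definition cell :: "nat \<Rightarrow> (nat \<Rightarrow> bool) \<Rightarrow> nat \<Rightarrow> nat" where
  "cell n a c = (if c = 0 then 1 else 0) + (if a c then 2 else 0) + (if c = n then 4 else 0)"

definition zeroT :: "nat \<Rightarrow> nat list \<Rightarrow> bool" where "zeroT j rs \<longleftrightarrow> odd (rs ! Suc j)"
definition endT :: "nat \<Rightarrow> nat list \<Rightarrow> bool" where "endT j rs \<longleftrightarrow> rs ! Suc j \<ge> 4"
definition bitT :: "nat \<Rightarrow> nat list \<Rightarrow> bool" where "bitT j rs \<longleftrightarrow> rs ! Suc j mod 4 \<ge> 2"
definition inT :: "nat \<Rightarrow> nat list \<Rightarrow> bool" where "inT s rs \<longleftrightarrow> rs ! 0 = s"

lemma cell_tests [simp]:
  "odd (cell n a c) \<longleftrightarrow> c = 0" "4 \<le> cell n a c \<longleftrightarrow> c = n" "2 \<le> cell n a c mod 4 \<longleftrightarrow> a c" "cell n a c < 8"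
  by (auto simp: cell_def)

definition right :: "nat \<Rightarrow> instr" where "right j = Act (Suc j) (\<lambda>s. (s, Go_Right))"
definition left :: "nat \<Rightarrow> instr" where "left j = Act (Suc j) (\<lambda>s. (s, Go_Left))"
definition put :: "nat \<Rightarrow> bool \<Rightarrow> instr" where
  "put j b = Act (Suc j) (\<lambda>s. (s - (if s mod 4 \<ge> 2 then 2 else 0) + (if b then 2 else 0), Stay))"
definition inR :: instr where "inR = Act 0 (\<lambda>s. (s, Go_Right))"
definition inL :: instr where "inL = Act 0 (\<lambda>s. (s, Go_Left))"

definition rewind :: "nat \<Rightarrow> instr list" where
  "rewind j = [Loop (\<lambda>rs. \<not> zeroT j rs) [left j]]"

text \<open>Counts \<open>x\<close> down to 0 and executes \<open>c\<close> once for each unit; this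
  is how counters are copied and added.\<close>

definition move :: "nat \<Rightarrow> instr list \<Rightarrow> instr list" where
  "move x c = [Loop (\<lambda>rs. \<not> zeroT x rs) (left x # c)]"

text \<open>Both counters are decreased together while tape 0 counts the rounds; they were equal
  exactly if both are 0 when the loop stops. Tape 0 then restores them.\<close>

definition eqI :: "nat \<Rightarrow> nat \<Rightarrow> instr list \<Rightarrow> instr list \<Rightarrow> instr list" where
  "eqI x y c d = [Loop (\<lambda>rs. \<not> zeroT x rs \<and> \<not> zeroT y rs) [left x, left y, right 0],
     Cond (\<lambda>rs. zeroT x rs \<and> zeroT y rs)
       (move 0 [right x, right y] @ c) (move 0 [right x, right y] @ d)]"

text \<open>The head of \<open>a\<close> is moved to the cell given by \<open>x\<close>, which
  destroys \<open>x\<close>; the copy on tape 0 undoes both movements after the bit has been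
  read.\<close>

definition memI :: "nat \<Rightarrow> nat \<Rightarrow> instr list \<Rightarrow> instr list \<Rightarrow> instr list" where
  "memI a x c d = move x [right a, right 0] @
     [Cond (bitT a) (move 0 [right x, left a] @ c) (move 0 [right x, left a] @ d)]"

definition putI :: "nat \<Rightarrow> nat \<Rightarrow> bool \<Rightarrow> instr list" where
  "putI a x b = move x [right a, right 0] @ [put a b] @ move 0 [right x, left a]"

definition skip_row :: "instr \<Rightarrow> instr list" where
  "skip_row i = [Loop (\<lambda>rs. \<not> endT 0 rs) [right 0, i]] @ rewind 0"

text \<open>The head passes the \<open>n\<close> unary bits, the separator, \<open>x\<close> rows
  and \<open>y\<close> further cells. The input tape has no mark at its start, so
  \<open>back\<close> makes \<open>n + 1\<close> times \<open>n + 1\<close> moves to the left, which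
  is enough because a head at cell 0 stays there.\<close>

definition inI :: "nat \<Rightarrow> nat \<Rightarrow> nat \<Rightarrow> instr list \<Rightarrow> instr list \<Rightarrow> instr list" where
  "inI x y s c d =
    (let back = (inL # skip_row inL) @ [Loop (\<lambda>rs. \<not> endT 1 rs) (right 1 # inL # skip_row inL)] @ rewind 1 in
     skip_row inR @ [inR] @ move x (right 1 # skip_row inR) @ move 1 [right x] @
     move y [right 1, inR] @ move 1 [right y] @
     [Cond (inT s) (back @ c) (back @ d)])"

definition forI :: "nat \<Rightarrow> instr list \<Rightarrow> instr list" where
  "forI x c = [Loop (\<lambda>rs. \<not> endT x rs) (c @ [right x])] @ rewind x"

locale store =
  fixes w :: "bool list" and n K :: nat
  assumes K: "2 \<le> K"
begin

definition cfg :: "nat \<Rightarrow> (nat \<Rightarrow> tape) \<Rightarrow> tape list" where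
  "cfg i T = (inp w, i) # map T [0..<K]"

text \<open>Input head at \<open>i\<close>, bit arrays \<open>A\<close> and counter values
  \<open>h\<close>; work tape \<open>j\<close> is machine tape \<open>Suc j\<close>.\<close>

definition conf :: "nat \<Rightarrow> (nat \<Rightarrow> nat \<Rightarrow> bool) \<Rightarrow> (nat \<Rightarrow> nat) \<Rightarrow> tape list" where
  "conf i A h = cfg i (\<lambda>j. (cell n (A j), h j))"

lemma nth_cfg: "j < K \<Longrightarrow> cfg i T ! Suc j = T j" "cfg i T ! 0 = (inp w, i)"
  by (simp_all add: cfg_def)

lemma update_cfg: "(cfg i T)[Suc j := t] = cfg i (T(j := t))"
proof -
  have "(map T [0..<K])[j := t] = map (T(j := t)) [0..<K]" by (rule nth_equalityI) auto
  then show ?thesis by (simp add: cfg_def)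
qed

lemma read_cfg: "j < K \<Longrightarrow> map read_tape (cfg i T) ! Suc j = read_tape (T j)" "map read_tape (cfg i T) ! 0 = inp w i"
  by (simp_all add: cfg_def)

lemma read_conf [simp]:
  "j < K \<Longrightarrow> zeroT j (map read_tape (conf i A h)) \<longleftrightarrow> h j = 0"
  "j < K \<Longrightarrow> endT j (map read_tape (conf i A h)) \<longleftrightarrow> h j = n"
  "j < K \<Longrightarrow> bitT j (map read_tape (conf i A h)) \<longleftrightarrow> A j (h j)"
  "inT s (map read_tape (conf i A h)) \<longleftrightarrow> inp w i = s"
  by (simp_all only: zeroT_def endT_def bitT_def inT_def conf_def read_cfg read_tape.simps cell_tests)

lemma runs_cfg:
  assumes "j < K"
  shows "runs [Act (Suc j) g] (cfg i T) 1 (cfg i (T(j := act_tape (clip (g (read_tape (T j)))) (T j))))"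
  using runs_Act[of "Suc j" g "cfg i T"] by (simp add: nth_cfg(1)[OF assms] update_cfg)

lemma runs_right: "j < K \<Longrightarrow> runs [right j] (conf i A h) 1 (conf i A (h(j := Suc (h j))))"
  and runs_left: "j < K \<Longrightarrow> runs [left j] (conf i A h) 1 (conf i A (h(j := h j - 1)))"
proof -
  assume j: "j < K"
  have e: "(\<lambda>k. (cell n (A k), h k))(j := (cell n (A j), x)) = (\<lambda>k. (cell n (A k), (h(j := x)) k))" for x by auto
  show "runs [right j] (conf i A h) 1 (conf i A (h(j := Suc (h j))))"
    using runs_cfg[OF j, of "\<lambda>s. (s, Go_Right)" i "\<lambda>j. (cell n (A j), h j)"]
    by (simp add: right_def conf_def clip_def e)
  show "runs [left j] (conf i A h) 1 (conf i A (h(j := h j - 1)))"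
    using runs_cfg[OF j, of "\<lambda>s. (s, Go_Left)" i "\<lambda>j. (cell n (A j), h j)"]
    by (simp add: left_def conf_def clip_def e)
qed

lemma runs_put:
  assumes j: "j < K"
  shows "runs [put j b] (conf i A h) 1 (conf i (A(j := (A j)(h j := b))) h)"
proof -
  let ?g = "\<lambda>s::nat. (s - (if s mod 4 \<ge> 2 then 2 else 0) + (if b then 2 else 0), Stay)"
  have "(cell n (A j))(h j := fst (clip (?g (cell n (A j) (h j))))) = cell n ((A j)(h j := b))"
    by (auto simp: cell_def clip_def fun_eq_iff)
  moreover have "snd (clip (?g (cell n (A j) (h j)))) = Stay" by (simp add: clip_def)
  moreover have "act_tape a (t, k) = (t(k := fst a), move_head (snd a) k)" for a t k by (cases a) simp
  ultimately have act: "act_tape (clip (?g (cell n (A j) (h j)))) (cell n (A j), h j) = (cell n ((A j)(h j := b)), h j)"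
    by (simp only: move_head.simps)
  have "(\<lambda>k. (cell n (A k), h k))(j := (cell n ((A j)(h j := b)), h j))
     = (\<lambda>k. (cell n ((A(j := (A j)(h j := b))) k), h k))" by auto
  then show ?thesis
    using runs_cfg[OF j, of ?g i "\<lambda>j. (cell n (A j), h j)"]
    unfolding put_def conf_def read_tape.simps act by simp
qed

lemma inp_less: "inp w i < 8"
proof -
  have "bit_sym b < 8" for b by (cases b) auto
  then show ?thesis by (simp add: inp_def input_tape_def)
qed

lemma runs_in: "runs [inR] (cfg i T) 1 (cfg (Suc i) T)" "runs [inL] (cfg i T) 1 (cfg (i - 1) T)"
  using runs_Act[of 0 "\<lambda>s. (s, Go_Right)" "cfg i T"] runs_Act[of 0 "\<lambda>s. (s, Go_Left)" "cfg i T"] inp_less[of i]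
  by (simp_all add: inR_def inL_def cfg_def clip_def)

lemma runs_inR: "runs [inR] (conf i A h) 1 (conf (Suc i) A h)"
  and runs_inL: "runs [inL] (conf i A h) 1 (conf (i - 1) A h)"
  unfolding conf_def by (rule runs_in)+

lemma runs_rewind: "j < K \<Longrightarrow> runs (rewind j) (conf i A h) (2 * h j + 1) (conf i A (h(j := 0)))"
proof -
  assume j: "j < K"
  have "runs (rewind j) (conf i A (h(j := h j - 0))) (h j * (1 + 1) + 1) (conf i A (h(j := h j - h j)))"
    unfolding rewind_def
  proof (rule runs_Loop_iter[where s = "\<lambda>m. conf i A (h(j := h j - m))"])
    fix m assume "m < h j"
    then show "\<not> zeroT j (map read_tape (conf i A (h(j := h j - m)))) \<and>
      runs [left j] (conf i A (h(j := h j - m))) 1 (conf i A (h(j := h j - Suc m)))"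
      using j runs_left[OF j, of i A "h(j := h j - m)"] by simp
  qed (use j in simp)
  then show ?thesis by (simp add: mult_2 mult_2_right)
qed

text \<open>The effect of the body may vary with the round \<open>m\<close>: it is described by the
  input position \<open>ii m\<close> and the other counters \<open>g m\<close>.\<close>

lemma runs_move:
  assumes x: "x < K"
    and c: "\<And>m. m < v \<Longrightarrow> runs c (conf (ii m) A ((g m)(x := v - Suc m))) T
      (conf (ii (Suc m)) A ((g (Suc m))(x := v - Suc m)))"
  shows "runs (move x c) (conf (ii 0) A ((g 0)(x := v))) (v * (T + 2) + 1) (conf (ii v) A ((g v)(x := 0)))"
proof -
  define s where "s m = conf (ii m) A ((g m)(x := v - m))" for m
  have "runs (move x c) (s 0) (v * (Suc T + 1) + 1) (s v)"
    unfolding move_def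
  proof (rule runs_Loop_iter)
    fix m assume m: "m < v"
    have "runs [left x] (s m) 1 (conf (ii m) A ((g m)(x := v - Suc m)))"
      using runs_left[OF x, of "ii m" A "(g m)(x := v - m)"] by (simp add: s_def)
    then have "runs (left x # c) (s m) (1 + T) (s (Suc m))"
      using c[OF m] unfolding s_def by (rule runs_Cons)
    then show "\<not> zeroT x (map read_tape (s m)) \<and> runs (left x # c) (s m) (Suc T) (s (Suc m))"
      using m x by (simp add: s_def)
  qed (use x in \<open>simp add: s_def\<close>)
  then show ?thesis by (simp add: s_def)
qed

lemma runs_two:
  assumes "runs [a] s 1 s'" "runs [b] s' 1 s''"
  shows "runs [a, b] s 2 s''"
  using runs_Cons[OF assms] by (simp add: numeral_2_eq_2)

lemma runs_eqI:
  assumes xy: "x < K" "y < K" "x \<noteq> y" "x \<noteq> 0" "y \<noteq> 0" and h0: "h 0 = 0" and le: "h x \<le> n" "h y \<le> n"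
    and r: "runs (if h x = h y then c else d) (conf i A h) T us"
  shows "runs (eqI x y c d) (conf i A h) (8 * n + 8 + T) us"
proof -
  define m where "m = min (h x) (h y)"
  define g where "g k = h(x := h x - k, y := h y - k, 0 := k)" for k
  define s where "s k = conf i A (g k)" for k
  have K0: "0 < K" using K by simp
  have s0: "s 0 = conf i A h" using h0 by (auto simp: s_def g_def fun_eq_iff intro!: arg_cong[of _ _ "conf i A"])
  let ?c = "[left x, left y, right 0]"
  have "runs [Loop (\<lambda>rs. \<not> zeroT x rs \<and> \<not> zeroT y rs) ?c] (s 0) (m * (3 + 1) + 1) (s m)"
  proof (rule runs_Loop_iter)
    fix k assume k: "k < m"
    have e: "(g k)(x := g k x - 1, y := g k y - 1, 0 := Suc (g k 0)) = g (Suc k)"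
      using xy by (auto simp: g_def fun_eq_iff)
    have "runs ?c (s k) (1 + (1 + 1)) (conf i A ((g k)(x := g k x - 1, y := g k y - 1, 0 := Suc (g k 0))))"
      unfolding s_def
      using runs_Cons[OF runs_left[OF xy(1)] runs_Cons[OF runs_left[OF xy(2)] runs_right[OF K0]],
          of i A "g k"] xy by simp
    then show "(\<not> zeroT x (map read_tape (s k)) \<and> \<not> zeroT y (map read_tape (s k))) \<and> runs ?c (s k) 3 (s (Suc k))"
      using k xy unfolding e by (simp add: s_def g_def m_def numeral_3_eq_3)
  qed (use xy in \<open>auto simp: s_def g_def m_def\<close>)
  then have loop: "runs [Loop (\<lambda>rs. \<not> zeroT x rs \<and> \<not> zeroT y rs) ?c] (conf i A h) (4 * m + 1) (s m)"
    by (simp add: s0 mult.commute)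
  have restore: "runs (move 0 [right x, right y]) (s m) (m * (2 + 2) + 1) (conf i A h)"
  proof -
    define g' where "g' k = h(x := h x - m + k, y := h y - m + k)" for k
    have "runs (move 0 [right x, right y]) (conf i A ((g' 0)(0 := m))) (m * (2 + 2) + 1)
        (conf i A ((g' m)(0 := 0)))"
    proof (rule runs_move[OF K0, where ii = "\<lambda>_. i"])
      fix k
      have e: "(g' k)(0 := m - Suc k, x := Suc (g' k x), y := Suc (g' k y)) = (g' (Suc k))(0 := m - Suc k)"
        using xy by (auto simp: g'_def fun_eq_iff)
      show "runs [right x, right y] (conf i A ((g' k)(0 := m - Suc k))) 2
          (conf i A ((g' (Suc k))(0 := m - Suc k)))"
        using runs_two[OF runs_right[OF xy(1)] runs_right[OF xy(2)], of i A "(g' k)(0 := m - Suc k)"] xy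
        unfolding e[symmetric] by simp
    qed
    moreover have "(g' 0)(0 := m) = g m" using xy by (auto simp: g'_def g_def fun_eq_iff)
    moreover have "(g' m)(0 := 0) = h" using xy h0 by (auto simp: g'_def m_def fun_eq_iff)
    ultimately show ?thesis by (simp add: s_def)
  qed
  have "runs (if h x = h y then move 0 [right x, right y] @ c else move 0 [right x, right y] @ d)
      (s m) (m * (2 + 2) + 1 + T) us"
    using runs_append[OF restore r] by (simp split: if_splits)
  moreover have "zeroT x (map read_tape (s m)) \<and> zeroT y (map read_tape (s m)) \<longleftrightarrow> h x = h y"
    using xy by (auto simp: s_def g_def m_def)
  ultimately have "runs [Cond (\<lambda>rs. zeroT x rs \<and> zeroT y rs) (move 0 [right x, right y] @ c)
      (move 0 [right x, right y] @ d)] (s m) (Suc (m * (2 + 2) + 1 + T)) us"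
    by (intro runs_Cond) simp
  from runs_Cons[OF loop this] have "runs (eqI x y c d) (conf i A h) (4 * m + 1 + Suc (m * (2 + 2) + 1 + T)) us"
    unfolding eqI_def .
  then show ?thesis by (rule runs_mono) (use le in \<open>simp add: m_def\<close>)
qed

lemma runs_seek:
  assumes "x < K" "a < K" "x \<noteq> a" "x \<noteq> 0" "a \<noteq> 0" "h 0 = 0" "h a = 0" "h x \<le> n"
  shows "runs (move x [right a, right 0]) (conf i A h) (4 * n + 1) (conf i A (h(x := 0, a := h x, 0 := h x)))"
    and "runs (move 0 [right x, left a]) (conf i A (h(x := 0, a := h x, 0 := h x))) (4 * n + 1) (conf i A h)"
proof -
  have K0: "0 < K" using K by simp
  define g where "g k = h(a := k, 0 := k)" for k
  have "runs (move x [right a, right 0]) (conf i A ((g 0)(x := h x))) (h x * (2 + 2) + 1)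
      (conf i A ((g (h x))(x := 0)))"
  proof (rule runs_move[OF assms(1), where ii = "\<lambda>_. i"])
    fix k
    have e: "(g k)(x := h x - Suc k, a := Suc (g k a), 0 := Suc (g k 0)) = (g (Suc k))(x := h x - Suc k)"
      using assms by (auto simp: g_def fun_eq_iff)
    show "runs [right a, right 0] (conf i A ((g k)(x := h x - Suc k))) 2
          (conf i A ((g (Suc k))(x := h x - Suc k)))"
      using runs_two[OF runs_right[OF assms(2)] runs_right[OF K0], of i A "(g k)(x := h x - Suc k)"] assms
      unfolding e[symmetric] by simp
  qed
  moreover have "(g 0)(x := h x) = h" "(g (h x))(x := 0) = h(x := 0, a := h x, 0 := h x)"
    using assms by (auto simp: g_def fun_eq_iff)
  ultimately have "runs (move x [right a, right 0]) (conf i A h) (h x * (2 + 2) + 1)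
      (conf i A (h(x := 0, a := h x, 0 := h x)))" by simp
  then show "runs (move x [right a, right 0]) (conf i A h) (4 * n + 1) (conf i A (h(x := 0, a := h x, 0 := h x)))"
    by (rule runs_mono) (use assms in simp)
  define g where "g k = h(x := k, a := h x - k)" for k
  have "runs (move 0 [right x, left a]) (conf i A ((g 0)(0 := h x))) (h x * (2 + 2) + 1)
      (conf i A ((g (h x))(0 := 0)))"
  proof (rule runs_move[OF K0, where ii = "\<lambda>_. i"])
    fix k
    have e: "(g k)(0 := h x - Suc k, x := Suc (g k x), a := g k a - 1) = (g (Suc k))(0 := h x - Suc k)"
      using assms by (auto simp: g_def fun_eq_iff)
    show "runs [right x, left a] (conf i A ((g k)(0 := h x - Suc k))) 2
          (conf i A ((g (Suc k))(0 := h x - Suc k)))"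
      using runs_two[OF runs_right[OF assms(1)] runs_left[OF assms(2)], of i A "(g k)(0 := h x - Suc k)"] assms
      unfolding e[symmetric] by simp
  qed
  moreover have "(g (h x))(0 := 0) = h" "(g 0)(0 := h x) = h(x := 0, a := h x, 0 := h x)"
    using assms by (auto simp: g_def fun_eq_iff)
  ultimately have "runs (move 0 [right x, left a]) (conf i A (h(x := 0, a := h x, 0 := h x))) (h x * (2 + 2) + 1)
      (conf i A h)" by simp
  then show "runs (move 0 [right x, left a]) (conf i A (h(x := 0, a := h x, 0 := h x))) (4 * n + 1) (conf i A h)"
    by (rule runs_mono) (use assms in simp)
qed

lemma runs_memI:
  assumes "x < K" "a < K" "x \<noteq> a" "x \<noteq> 0" "a \<noteq> 0" "h 0 = 0" "h a = 0" "h x \<le> n"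
    and r: "runs (if A a (h x) then c else d) (conf i A h) T us"
  shows "runs (memI a x c d) (conf i A h) (8 * n + 8 + T) us"
proof -
  let ?h = "h(x := 0, a := h x, 0 := h x)" and ?m = "move 0 [right x, left a]"
  have "runs (if A a (h x) then ?m @ c else ?m @ d) (conf i A ?h) (4 * n + 1 + T) us"
    using runs_append[OF runs_seek(2)[OF assms(1-8)] r] by (simp split: if_splits)
  moreover have "bitT a (map read_tape (conf i A ?h)) \<longleftrightarrow> A a (h x)" using assms by simp
  ultimately have "runs [Cond (bitT a) (?m @ c) (?m @ d)] (conf i A ?h) (Suc (4 * n + 1 + T)) us"
    by (intro runs_Cond) simp
  from runs_append[OF runs_seek(1)[OF assms(1-8)] this] show ?thesis
    unfolding memI_def by (rule runs_mono) simp
qed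

lemma runs_putI:
  assumes "x < K" "a < K" "x \<noteq> a" "x \<noteq> 0" "a \<noteq> 0" "h 0 = 0" "h a = 0" "h x \<le> n"
  shows "runs (putI a x b) (conf i A h) (8 * n + 8) (conf i (A(a := (A a)(h x := b))) h)"
proof -
  let ?h = "h(x := 0, a := h x, 0 := h x)"
  have p: "runs [put a b] (conf i A ?h) 1 (conf i (A(a := (A a)(h x := b))) ?h)"
    using runs_put[OF assms(2), of b i A ?h] assms by simp
  from runs_append[OF runs_seek(1)[OF assms(1-8)] runs_append[OF p runs_seek(2)[OF assms(1-8)]]]
  show ?thesis unfolding putI_def by (rule runs_mono) simp
qed

end

context store
begin

lemma K0: "0 < K" and K1: "1 < K"
  using K by simp_all

lemma runs_skip_row:
  assumes d: "\<And>i h. runs [d] (conf i A h) 1 (conf (F i) A h)" and h0: "h 0 = 0"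
  shows "runs (skip_row d) (conf i A h) (5 * n + 2) (conf ((F ^^ n) i) A h)"
proof -
  define s where "s k = conf ((F ^^ k) i) A (h(0 := k))" for k
  have "runs [Loop (\<lambda>rs. \<not> endT 0 rs) [right 0, d]] (s 0) (n * (2 + 1) + 1) (s n)"
  proof (rule runs_Loop_iter)
    fix k assume "k < n"
    then show "\<not> endT 0 (map read_tape (s k)) \<and> runs [right 0, d] (s k) 2 (s (Suc k))"
      using runs_two[OF runs_right[OF K0] d, of "(F ^^ k) i" "h(0 := k)"] K0 by (simp add: s_def)
  qed (use K0 in \<open>simp add: s_def\<close>)
  moreover have "runs (rewind 0) (s n) (2 * n + 1) (conf ((F ^^ n) i) A h)"
    using runs_rewind[OF K0, of "(F ^^ n) i" A "h(0 := n)"] h0 by (simp add: s_def fun_upd_idem)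
  ultimately have "runs (skip_row d) (s 0) (n * (2 + 1) + 1 + (2 * n + 1)) (conf ((F ^^ n) i) A h)"
    unfolding skip_row_def by (rule runs_append)
  moreover have "s 0 = conf i A h" using h0 by (simp add: s_def fun_upd_idem)
  ultimately have "runs (skip_row d) (conf i A h) (n * (2 + 1) + 1 + (2 * n + 1)) (conf ((F ^^ n) i) A h)" by simp
  then show ?thesis by (rule runs_mono) simp
qed

lemma runs_row_right: "h 0 = 0 \<Longrightarrow> runs (skip_row inR) (conf i A h) (5 * n + 2) (conf (i + n) A h)"
  using runs_skip_row[of inR A Suc h i] runs_inR by (simp add: add.commute)

lemma runs_row_left: "h 0 = 0 \<Longrightarrow> runs (inL # skip_row inL) (conf i A h) (5 * n + 3) (conf (i - Suc n) A h)"
proof -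
  assume h0: "h 0 = 0"
  have "((\<lambda>i. i - 1) ^^ k) i = i - k" for k i :: nat by (induction k) auto
  then have "runs (skip_row inL) (conf (i - 1) A h) (5 * n + 2) (conf (i - 1 - n) A h)"
    using runs_skip_row[of inL A "\<lambda>i. i - 1" h "i - 1"] runs_inL h0 by simp
  from runs_mono[OF runs_Cons[OF runs_inL this], of "5 * n + 3"] show ?thesis by simp
qed

lemma runs_back:
  assumes h: "h 0 = 0" "h 1 = 0" and i: "i \<le> Suc n * Suc n"
  shows "runs ((inL # skip_row inL) @ [Loop (\<lambda>rs. \<not> endT 1 rs) (right 1 # inL # skip_row inL)] @ rewind 1)
    (conf i A h) (5 * n * n + 12 * n + 5) (conf 0 A h)"
proof -
  define s where "s k = conf (i - Suc k * Suc n) A (h(1 := k))" for k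
  have "runs [Loop (\<lambda>rs. \<not> endT 1 rs) (right 1 # inL # skip_row inL)] (s 0) (n * (5 * n + 4 + 1) + 1) (s n)"
  proof (rule runs_Loop_iter)
    fix k assume k: "k < n"
    have "runs [right 1] (s k) 1 (conf (i - Suc k * Suc n) A (h(1 := Suc k)))"
      using runs_right[OF K1, of _ A "h(1 := k)"] by (simp add: s_def)
    moreover have "runs (inL # skip_row inL) (conf (i - Suc k * Suc n) A (h(1 := Suc k))) (5 * n + 3) (s (Suc k))"
      using runs_row_left[of "h(1 := Suc k)" "i - Suc k * Suc n" A] h
      by (simp add: s_def diff_diff_left ac_simps)
    ultimately have "runs (right 1 # inL # skip_row inL) (s k) (1 + (5 * n + 3)) (s (Suc k))" by (rule runs_Cons)
    then have "runs (right 1 # inL # skip_row inL) (s k) (5 * n + 4) (s (Suc k))" by (rule runs_mono) simp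
    then show "\<not> endT 1 (map read_tape (s k)) \<and> runs (right 1 # inL # skip_row inL) (s k) (5 * n + 4) (s (Suc k))"
      using k K1 by (simp add: s_def)
  qed (use K1 in \<open>simp add: s_def\<close>)
  moreover have "runs (rewind 1) (s n) (2 * n + 1) (conf 0 A h)"
    using runs_rewind[OF K1, of 0 A "h(1 := n)"] i h by (simp add: s_def fun_upd_idem)
  moreover have "runs (inL # skip_row inL) (conf i A h) (5 * n + 3) (s 0)"
    using runs_row_left[of h i A] h by (simp add: s_def fun_upd_idem)
  ultimately have "runs ((inL # skip_row inL) @ [Loop (\<lambda>rs. \<not> endT 1 rs) (right 1 # inL # skip_row inL)] @ rewind 1)
    (conf i A h) (5 * n + 3 + (n * (5 * n + 4 + 1) + 1 + (2 * n + 1))) (conf 0 A h)"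
    by (intro runs_append)
  then show ?thesis by (rule runs_mono) (simp add: algebra_simps)
qed

lemma runs_inI:
  assumes xy: "x < K" "y < K" "1 < x" "1 < y" and h: "h 0 = 0" "h 1 = 0" and le: "h x \<le> n" "h y \<le> n"
    and r: "runs (if inp w (n + 1 + h x * n + h y) = s then c else d) (conf 0 A h) T us"
  shows "runs (inI x y s c d) (conf 0 A h) (10 * n * n + 32 * n + 20 + T) us"
proof -
  define bk where "bk = (inL # skip_row inL) @ [Loop (\<lambda>rs. \<not> endT 1 rs) (right 1 # inL # skip_row inL)] @ rewind 1"
  let ?I = "n + 1 + h x * n"
  have id: "h(1 := 0) = h" "h(1 := 0, x := h x) = h" "h(1 := 0, y := h y) = h" "h(x := h x, 1 := 0) = h"
    "h(y := h y, 1 := 0) = h"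
    using h by (auto simp: fun_eq_iff)
  have "runs (skip_row inR) (conf 0 A h) (5 * n + 2) (conf n A h)" using runs_row_right[of h 0 A] h by simp
  moreover have "runs [inR] (conf n A h) 1 (conf (n + 1) A h)" using runs_inR[of n A h] by simp
  moreover have "runs (move x (right 1 # skip_row inR)) (conf (n + 1 + 0 * n) A (h(1 := 0, x := h x)))
      (h x * (5 * n + 3 + 2) + 1) (conf ?I A (h(1 := h x, x := 0)))"
  proof (rule runs_move[OF xy(1), where ii = "\<lambda>m. n + 1 + m * n" and g = "\<lambda>m. h(1 := m)"])
    fix m
    have e: "h(1 := m, x := h x - Suc m, 1 := Suc m) = h(1 := Suc m, x := h x - Suc m)"
      using xy by (auto simp: fun_eq_iff)
    have "runs [right 1] (conf (n + 1 + m * n) A (h(1 := m, x := h x - Suc m))) 1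
      (conf (n + 1 + m * n) A (h(1 := Suc m, x := h x - Suc m)))"
      using runs_right[OF K1, of "n + 1 + m * n" A "h(1 := m, x := h x - Suc m)"] xy unfolding e[symmetric] by simp
    moreover have "runs (skip_row inR) (conf (n + 1 + m * n) A (h(1 := Suc m, x := h x - Suc m))) (5 * n + 2)
      (conf (n + 1 + Suc m * n) A (h(1 := Suc m, x := h x - Suc m)))"
      using runs_row_right[of "h(1 := Suc m, x := h x - Suc m)" "n + 1 + m * n" A] h xy by (simp add: ac_simps)
    ultimately have "runs (right 1 # skip_row inR) (conf (n + 1 + m * n) A (h(1 := m, x := h x - Suc m))) (1 + (5 * n + 2))
      (conf (n + 1 + Suc m * n) A (h(1 := Suc m, x := h x - Suc m)))" by (rule runs_Cons)
    then show "runs (right 1 # skip_row inR) (conf (n + 1 + m * n) A (h(1 := m, x := h x - Suc m))) (5 * n + 3)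
      (conf (n + 1 + Suc m * n) A (h(1 := Suc m, x := h x - Suc m)))" by (rule runs_mono) simp
  qed
  moreover have "runs (move 1 [right x]) (conf ?I A (h(x := 0, 1 := h x))) (h x * (1 + 2) + 1)
      (conf ?I A (h(x := h x, 1 := 0)))"
  proof (rule runs_move[OF K1, where ii = "\<lambda>m. ?I" and g = "\<lambda>m. h(x := m)"])
    fix m
    have e: "h(x := m, 1 := h x - Suc m, x := Suc m) = h(x := Suc m, 1 := h x - Suc m)"
      using xy by (auto simp: fun_eq_iff)
    show "runs [right x] (conf ?I A (h(x := m, 1 := h x - Suc m))) 1 (conf ?I A (h(x := Suc m, 1 := h x - Suc m)))"
      using runs_right[OF xy(1), of ?I A "h(x := m, 1 := h x - Suc m)"] xy unfolding e[symmetric] by simp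
  qed
  moreover have "h(1 := h x, x := 0) = h(x := 0, 1 := h x)" using xy by (auto simp: fun_eq_iff)
  moreover have "runs (move y [right 1, inR]) (conf (?I + 0) A (h(1 := 0, y := h y))) (h y * (2 + 2) + 1)
      (conf (?I + h y) A (h(1 := h y, y := 0)))"
  proof (rule runs_move[OF xy(2), where ii = "\<lambda>m. ?I + m" and g = "\<lambda>m. h(1 := m)"])
    fix m
    have e: "h(1 := m, y := h y - Suc m, 1 := Suc m) = h(1 := Suc m, y := h y - Suc m)"
      using xy by (auto simp: fun_eq_iff)
    show "runs [right 1, inR] (conf (?I + m) A (h(1 := m, y := h y - Suc m))) 2
      (conf (?I + Suc m) A (h(1 := Suc m, y := h y - Suc m)))"
      using runs_two[OF runs_right[OF K1] runs_inR, of "?I + m" A "h(1 := m, y := h y - Suc m)"] xy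
      unfolding e[symmetric] by simp
  qed
  moreover have "runs (move 1 [right y]) (conf (?I + h y) A (h(y := 0, 1 := h y))) (h y * (1 + 2) + 1)
      (conf (?I + h y) A (h(y := h y, 1 := 0)))"
  proof (rule runs_move[OF K1, where ii = "\<lambda>m. ?I + h y" and g = "\<lambda>m. h(y := m)"])
    fix m
    have e: "h(y := m, 1 := h y - Suc m, y := Suc m) = h(y := Suc m, 1 := h y - Suc m)"
      using xy by (auto simp: fun_eq_iff)
    show "runs [right y] (conf (?I + h y) A (h(y := m, 1 := h y - Suc m))) 1
        (conf (?I + h y) A (h(y := Suc m, 1 := h y - Suc m)))"
      using runs_right[OF xy(2), of "?I + h y" A "h(y := m, 1 := h y - Suc m)"] xy unfolding e[symmetric] by simp
  qed
  moreover have "h(1 := h y, y := 0) = h(y := 0, 1 := h y)" using xy by (auto simp: fun_eq_iff)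
  moreover have "runs [Cond (inT s) (bk @ c) (bk @ d)] (conf (?I + h y) A h) (Suc (5 * n * n + 12 * n + 5 + T)) us"
  proof (rule runs_Cond)
    \<comment> \<open>The bound is attained if both counters hold \<open>n\<close>: the position is
      then exactly \<open>(n + 1) * (n + 1)\<close>.\<close>
    have "h x * n + h y \<le> n * n + n" using le by (intro add_mono mult_right_mono) auto
    then have "?I + h y \<le> Suc n * Suc n" by simp
    then have "runs bk (conf (?I + h y) A h) (5 * n * n + 12 * n + 5) (conf 0 A h)"
      unfolding bk_def by (rule runs_back[OF h])
    from runs_append[OF this r]
    show "runs (if inT s (map read_tape (conf (?I + h y) A h)) then bk @ c else bk @ d) (conf (?I + h y) A h)
      (5 * n * n + 12 * n + 5 + T) us" by (simp split: if_splits)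
  qed
  ultimately have "runs (skip_row inR @ [inR] @ move x (right 1 # skip_row inR) @ move 1 [right x] @
     move y [right 1, inR] @ move 1 [right y] @ [Cond (inT s) (bk @ c) (bk @ d)]) (conf 0 A h)
     (5 * n + 2 + (1 + (h x * (5 * n + 3 + 2) + 1 + (h x * (1 + 2) + 1 + (h y * (2 + 2) + 1 + (h y * (1 + 2) + 1 +
      (Suc (5 * n * n + 12 * n + 5 + T)))))))) us"
    unfolding id by (intro runs_append) (simp_all add: id)
  then have "runs (inI x y s c d) (conf 0 A h)
     (5 * n + 2 + (1 + (h x * (5 * n + 3 + 2) + 1 + (h x * (1 + 2) + 1 + (h y * (2 + 2) + 1 + (h y * (1 + 2) + 1 +
      (Suc (5 * n * n + 12 * n + 5 + T)))))))) us"
    by (simp add: inI_def Let_def bk_def)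
  moreover have "h x * (5 * n + 5) \<le> n * (5 * n + 5)" using le by (intro mult_right_mono) auto
  ultimately show ?thesis
    by (elim runs_mono) (use le in \<open>simp add: algebra_simps\<close>)
qed

text \<open>Loop bodies leave unspecified contents on some tapes, so the contents after each round
  are only known to exist; this collects them into one sequence.\<close>

lemma invariant_chain:
  fixes P :: "nat \<Rightarrow> 'b \<Rightarrow> bool"
  assumes "P 0 A" "\<And>i A. i < m \<Longrightarrow> P i A \<Longrightarrow> \<exists>B. R i A B \<and> P (Suc i) B"
  shows "\<exists>f. f 0 = A \<and> P m (f m) \<and> (\<forall>i<m. R i (f i) (f (Suc i)))"
  using assms
proof (induction m)
  case 0
  then show ?case by (intro exI[of _ "\<lambda>_. A"]) simp
next
  case (Suc m)
  then obtain f where f: "f 0 = A" "P m (f m)" "\<forall>i<m. R i (f i) (f (Suc i))" by auto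
  then obtain B where B: "R m (f m) B" "P (Suc m) B" using Suc.prems(2)[of m "f m"] by auto
  show ?case
    by (rule exI[of _ "f(Suc m := B)"]) (use f B in \<open>auto simp: less_Suc_eq\<close>)
qed

lemma runs_forI:
  assumes x: "x < K" "h x = 0" and P0: "P 0 A"
    and step: "\<And>i A. i < n \<Longrightarrow> P i A \<Longrightarrow>
      \<exists>B. runs c (conf j A (h(x := i))) T (conf j B (h(x := i))) \<and> P (Suc i) B"
  shows "\<exists>B. runs (forI x c) (conf j A h) (n * (T + 4) + 2) (conf j B h) \<and> P n B"
proof -
  obtain f where f: "f 0 = A" "P n (f n)"
    "\<And>i. i < n \<Longrightarrow> runs c (conf j (f i) (h(x := i))) T (conf j (f (Suc i)) (h(x := i)))"
    using invariant_chain[of P A n "\<lambda>i A B. runs c (conf j A (h(x := i))) T (conf j B (h(x := i)))", OF P0 step]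
    by blast
  define s where "s i = conf j (f i) (h(x := i))" for i
  have "runs [Loop (\<lambda>rs. \<not> endT x rs) (c @ [right x])] (s 0) (n * (T + 1 + 1) + 1) (s n)"
  proof (rule runs_Loop_iter)
    fix i assume i: "i < n"
    have "runs [right x] (conf j (f (Suc i)) (h(x := i))) 1 (s (Suc i))"
      using runs_right[OF x(1), of j "f (Suc i)" "h(x := i)"] by (simp add: s_def)
    with f(3)[OF i] have "runs (c @ [right x]) (s i) (T + 1) (s (Suc i))" unfolding s_def by (rule runs_append)
    then show "\<not> endT x (map read_tape (s i)) \<and> runs (c @ [right x]) (s i) (T + 1) (s (Suc i))"
      using i x by (simp add: s_def)
  qed (use x in \<open>simp add: s_def\<close>)
  moreover have "runs (rewind x) (s n) (2 * n + 1) (conf j (f n) h)"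
    using runs_rewind[OF x(1), of j "f n" "h(x := n)"] x(2) by (simp add: s_def fun_upd_idem)
  ultimately have "runs (forI x c) (s 0) (n * (T + 1 + 1) + 1 + (2 * n + 1)) (conf j (f n) h)"
    unfolding forI_def by (rule runs_append)
  moreover have "s 0 = conf j A h" using f(1) x(2) by (simp add: s_def fun_upd_idem)
  ultimately have "runs (forI x c) (conf j A h) (n * (T + 4) + 2) (conf j (f n) h)"
    by (auto intro: runs_mono simp: algebra_simps)
  then show ?thesis using f(2) by blast
qed

end

section \<open>Evaluating formulas with reachability in polynomial time\<close>

section \<open>Formulas with reachability\<close>

datatype fm = Eq nat nat | InS nat nat nat | Neg fm | Conj fm fm | Ex nat fm | Reach nat nat nat nat nat fm

text \<open>The number of consecutive tapes, from the result tape on, that an evaluation occupies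
  besides the variables and the scratch counters. A reachability formula takes one for its result
  and one for the set of reached vertices.\<close>

fun depth :: "fm \<Rightarrow> nat" where
  "depth (Eq x y) = 1"
| "depth (InS x y s) = 1"
| "depth (Neg \<phi>) = depth \<phi>"
| "depth (Conj \<phi> \<psi>) = max (depth \<phi>) (depth \<psi>)"
| "depth (Ex x \<phi>) = 1 + depth \<phi>"
| "depth (Reach x y u v c \<phi>) = 2 + depth \<phi>"

text \<open>Bound variables are tape numbers from \<open>3\<close> up to \<open>m\<close>; tapes \<open>0\<close> and \<open>1\<close> are scratch counters, and
  variable \<open>2\<close> is free and holds \<open>n\<close>. The set \<open>B\<close> contains the variables that are in scope. In
  \<open>Reach x y u v c \<phi>\<close> the variable \<open>c\<close> only counts rounds and does not occur in \<open>\<phi>\<close>.\<close>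

fun wf_fm :: "nat \<Rightarrow> nat set \<Rightarrow> fm \<Rightarrow> bool" where
  "wf_fm m B (Eq x y) \<longleftrightarrow> x \<noteq> y \<and> x \<in> B \<and> y \<in> B"
| "wf_fm m B (InS x y s) \<longleftrightarrow> x \<in> insert 2 B \<and> y \<in> insert 2 B"
| "wf_fm m B (Neg \<phi>) \<longleftrightarrow> wf_fm m B \<phi>"
| "wf_fm m B (Conj \<phi> \<psi>) \<longleftrightarrow> wf_fm m B \<phi> \<and> wf_fm m B \<psi>"
| "wf_fm m B (Ex x \<phi>) \<longleftrightarrow> x \<notin> B \<and> 3 \<le> x \<and> x < m \<and> wf_fm m (insert x B) \<phi>"
| "wf_fm m B (Reach x y u v c \<phi>) \<longleftrightarrow> x \<in> B \<and> y \<in> B \<and> u \<notin> B \<and> v \<notin> B \<and> c \<notin> B \<and> distinct [u, v, c] \<and>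
     3 \<le> u \<and> 3 \<le> v \<and> 3 \<le> c \<and> u < m \<and> v < m \<and> c < m \<and>
     wf_fm m (insert v (insert u B)) \<phi> \<and> wf_fm m (insert v (insert u (insert c B))) \<phi>"

text \<open>The truth value is left in cell 0 of tape \<open>k\<close>. Reachability is computed on
  tape \<open>k + 1\<close> as a growing set of vertices, in \<open>n\<close> rounds over all
  pairs.\<close>

fun compile :: "nat \<Rightarrow> fm \<Rightarrow> instr list" where
  "compile k (Eq x y) = eqI x y [put k True] [put k False]"
| "compile k (InS x y s) = inI x y s [put k True] [put k False]"
| "compile k (Neg \<phi>) = compile k \<phi> @ [Cond (bitT k) [put k False] [put k True]]"
| "compile k (Conj \<phi> \<psi>) = compile k \<phi> @ [Cond (bitT k) (compile k \<psi>) []]"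
| "compile k (Ex x \<phi>) = put k False # forI x (compile (k + 1) \<phi> @ [Cond (bitT (k + 1)) [put k True] []])"
| "compile k (Reach x y u v c \<phi>) = forI u (putI (k + 1) u False) @ putI (k + 1) x True @
     forI c (forI u (forI v (memI (k + 1) u
       (compile (k + 2) \<phi> @ [Cond (bitT (k + 2)) (putI (k + 1) v True) []]) []))) @
     memI (k + 1) y [put k True] [put k False]"

fun tp :: "fm \<Rightarrow> nat poly" where
  "tp (Eq x y) = [:9, 8:]"
| "tp (InS x y s) = [:21, 32, 10:]"
| "tp (Neg \<phi>) = tp \<phi> + [:2:]"
| "tp (Conj \<phi> \<psi>) = tp \<phi> + tp \<psi> + [:1:]"
| "tp (Ex x \<phi>) = [:0, 1:] * ([:6:] + tp \<phi>) + [:3:]"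
| "tp (Reach x y u v c \<phi>) =
     [:0, 1:] * ([:0, 1:] * ([:0, 1:] * (tp \<phi> + [:21, 16:]) + [:6:]) + [:6:]) + [:2:] +
     ([:0, 1:] * [:12, 8:] + [:2:]) + [:8, 8:] + [:9, 8:]"

context store
begin

fun holds :: "(nat \<Rightarrow> nat) \<Rightarrow> fm \<Rightarrow> bool" where
  "holds e (Eq x y) \<longleftrightarrow> e x = e y"
| "holds e (InS x y s) \<longleftrightarrow> inp w (n + 1 + e x * n + e y) = s"
| "holds e (Neg \<phi>) \<longleftrightarrow> \<not> holds e \<phi>"
| "holds e (Conj \<phi> \<psi>) \<longleftrightarrow> holds e \<phi> \<and> holds e \<psi>"
| "holds e (Ex x \<phi>) \<longleftrightarrow> (\<exists>i<n. holds (e(x := i)) \<phi>)"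
| "holds e (Reach x y u v c \<phi>) \<longleftrightarrow>
     (\<lambda>a b. a < n \<and> b < n \<and> holds (e(u := a, v := b)) \<phi>)\<^sup>*\<^sup>* (e x) (e y)"

lemma holds_cong: "wf_fm m B \<phi> \<Longrightarrow> (\<And>b. b \<in> insert 2 B \<Longrightarrow> e b = e' b) \<Longrightarrow> holds e \<phi> = holds e' \<phi>"
proof (induction \<phi> arbitrary: B e e')
  case (Conj \<phi> \<psi>)
  have "holds e \<phi> = holds e' \<phi>" "holds e \<psi> = holds e' \<psi>"
    using Conj.IH(1)[of B e e'] Conj.IH(2)[of B e e'] Conj.prems by auto
  then show ?case by simp
next
  case (Ex x \<phi>)
  have "holds (e(x := i)) \<phi> = holds (e'(x := i)) \<phi>" for i
    using Ex.prems by (intro Ex.IH[of "insert x B"]) auto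
  then show ?case by simp
next
  case (Reach x y u v c \<phi>)
  have "holds (e(u := a, v := b)) \<phi> = holds (e'(u := a, v := b)) \<phi>" for a b
    using Reach.prems by (intro Reach.IH[of "insert v (insert u B)"]) auto
  moreover have "e x = e' x" "e y = e' y" using Reach.prems(1) Reach.prems(2)[of x] Reach.prems(2)[of y] by simp_all
  ultimately show ?case by simp
next
  case (Neg \<phi>)
  have "wf_fm m B \<phi>" using Neg.prems(1) by simp
  from Neg.IH[OF this Neg.prems(2)] show ?case by simp
next
  case (Eq x y)
  show ?case using Eq.prems(1) Eq.prems(2)[of x] Eq.prems(2)[of y] by simp
next
  case (InS x y s)
  show ?case using InS.prems(1) InS.prems(2)[of x] InS.prems(2)[of y] by simp
qed

text \<open>Counter values between instructions: variables in scope name vertices, variable 2 holds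
  \<open>n\<close>, and all other heads rest at 0.\<close>

definition env :: "nat \<Rightarrow> nat set \<Rightarrow> (nat \<Rightarrow> nat) \<Rightarrow> bool" where
  "env m B e \<longleftrightarrow> e 2 = n \<and> B \<subseteq> {3..<m} \<and> (\<forall>v\<in>B. e v < n) \<and> (\<forall>v. v \<notin> insert 2 B \<longrightarrow> e v = 0)"

lemma env_le: "env m B e \<Longrightarrow> e v \<le> n"
  unfolding env_def by (cases "v \<in> insert 2 B") (auto simp: less_imp_le)

lemma env_upd: "env m B e \<Longrightarrow> 3 \<le> x \<Longrightarrow> x < m \<Longrightarrow> i < n \<Longrightarrow> env m (insert x B) (e(x := i))"
  unfolding env_def by auto

lemma env_zero: "env m B e \<Longrightarrow> v \<notin> insert 2 B \<Longrightarrow> e v = 0"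
  unfolding env_def by blast

lemma env_temps: "env m B e \<Longrightarrow> e 0 = 0 \<and> e 1 = 0 \<and> (\<forall>k\<ge>m. 3 \<le> k \<longrightarrow> e k = 0)"
proof -
  assume e: "env m B e"
  then have B: "B \<subseteq> {3..<m}" by (simp add: env_def)
  have "e v = 0" if "v < 2 \<or> m \<le> v \<and> 3 \<le> v" for v
    using that B by (intro env_zero[OF e]) auto
  then show ?thesis by simp
qed

lemma env_var: "env m B e \<Longrightarrow> x \<in> B \<Longrightarrow> 3 \<le> x \<and> x < m"
  unfolding env_def by auto

text \<open>Tapes above \<open>k\<close> may end with any contents; tapes below \<open>k\<close>,
  which hold intermediate results of the surrounding formula, must be kept.\<close>

definition computes :: "instr list \<Rightarrow> nat \<Rightarrow> nat \<Rightarrow> (nat \<Rightarrow> nat) \<Rightarrow> bool \<Rightarrow> bool" where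
  "computes c T k e b \<longleftrightarrow> (\<forall>A. \<exists>A'. runs c (conf 0 A e) T (conf 0 A' e) \<and> A' k 0 = b \<and> (\<forall>j<k. A' j = A j))"

lemma runs_flag:
  assumes "k < K" "e k = 0"
  shows "runs [put k b] (conf 0 A e) 1 (conf 0 (A(k := (A k)(0 := b))) e)"
  using runs_put[OF assms(1), of b 0 A e] assms(2) by simp

text \<open>A round either finds the set of reached vertices closed under \<open>Q\<close> or adds a
  vertex to it. The set starts with one vertex and has at most \<open>n\<close>, so \<open>n\<close>
  rounds are enough.\<close>

lemma compile_Reach:
  assumes e: "env m B e" and k: "3 \<le> m" "m \<le> k" "k + 2 < K"
    and wf_fm: "wf_fm m B (Reach x y u v c \<phi>)"
    and sub: "\<And>i a b. i < n \<Longrightarrow> a < n \<Longrightarrow> b < n \<Longrightarrow>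
      computes (compile (k + 2) \<phi>) T (k + 2) (e(c := i, u := a, v := b)) (Q a b)"
  shows "computes (compile k (Reach x y u v c \<phi>))
     (n * (n * (n * (T + (16 * n + 21)) + 6) + 6) + 2 + (n * (8 * n + 12) + 2) + (8 * n + 8) + (8 * n + 9)) k e
     ((\<lambda>a b. a < n \<and> b < n \<and> Q a b)\<^sup>*\<^sup>* (e x) (e y))"
  unfolding computes_def
proof
  fix A :: "nat \<Rightarrow> nat \<Rightarrow> bool"
  have xyB: "x \<in> B" "y \<in> B" and uvc: "u \<notin> B" "v \<notin> B" "c \<notin> B" "u \<noteq> v" "u \<noteq> c" "v \<noteq> c"
      "3 \<le> u" "3 \<le> v" "3 \<le> c" "u < m" "v < m" "c < m"
    using wf_fm by auto
  have xy: "3 \<le> x" "x < m" "3 \<le> y" "y < m" "e x < n" "e y < n"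
    using env_var[OF e] xyB e unfolding env_def by auto
  have e0: "e u = 0" "e v = 0" "e c = 0" "e 0 = 0" "e k = 0" "e (k + 1) = 0" "e (k + 2) = 0"
    using env_zero[OF e] env_temps[OF e] uvc k by auto
  let ?R = "k + 1" and ?S = "\<lambda>a b. a < n \<and> b < n \<and> Q a b"
  let ?same = "\<lambda>A'. \<forall>j<k. A' j = A j"
  have kK: "k < K" "?R < K" "u < K" "v < K" "c < K" "x < K" "y < K" using k uvc xy by auto
  have "\<exists>A1. runs (forI u (putI ?R u False)) (conf 0 A e) (n * (8 * n + 8 + 4) + 2) (conf 0 A1 e) \<and>
      ((\<forall>j<n. \<not> A1 ?R j) \<and> ?same A1)"
  proof (rule runs_forI[where P = "\<lambda>i A'. (\<forall>j<i. \<not> A' ?R j) \<and> ?same A'"])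
    fix i A' assume i: "i < n" and P: "(\<forall>j<i. \<not> A' ?R j) \<and> ?same A'"
    have "runs (putI ?R u False) (conf 0 A' (e(u := i))) (8 * n + 8)
        (conf 0 (A'(?R := (A' ?R)((e(u := i)) u := False))) (e(u := i)))"
      using uvc k i e0 by (intro runs_putI kK) auto
    then show "\<exists>B. runs (putI ?R u False) (conf 0 A' (e(u := i))) (8 * n + 8) (conf 0 B (e(u := i))) \<and>
        ((\<forall>j<Suc i. \<not> B ?R j) \<and> ?same B)"
      using P by (intro exI[of _ "A'(?R := (A' ?R)(i := False))"]) (auto simp: less_Suc_eq)
  qed (use kK e0 in auto)
  then obtain A1 where A1: "runs (forI u (putI ?R u False)) (conf 0 A e) (n * (8 * n + 12) + 2) (conf 0 A1 e)"
    "\<And>j. j < n \<Longrightarrow> \<not> A1 ?R j" "?same A1" by (auto simp: algebra_simps)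
  define A2 where "A2 = A1(?R := (A1 ?R)(e x := True))"
  have A2: "runs (putI ?R x True) (conf 0 A1 e) (8 * n + 8) (conf 0 A2 e)"
    unfolding A2_def using e0 xy k by (intro runs_putI kK) auto
  \<comment> \<open>Soundness of the set on tape \<open>k + 1\<close>: it contains the source and
    only reachable vertices. Completeness comes from \<open>cl\<close>.\<close>
  define good where "good A' \<longleftrightarrow> A' ?R (e x) \<and> (\<forall>j<n. A' ?R j \<longrightarrow> ?S\<^sup>*\<^sup>* (e x) j) \<and> ?same A'" for A'
  have g2: "good A2" using A1 by (auto simp: good_def A2_def)
  define cl where "cl A' \<longleftrightarrow> (\<forall>a b. ?S a b \<longrightarrow> A' ?R a \<longrightarrow> A' ?R b)" for A' :: "nat \<Rightarrow> nat \<Rightarrow> bool"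
  define sz where "sz A' = card {j. j < n \<and> A' ?R j}" for A' :: "nat \<Rightarrow> nat \<Rightarrow> bool"
  define inner where "inner = memI ?R u (compile (k + 2) \<phi> @ [Cond (bitT (k + 2)) (putI ?R v True) []]) []"
  have inner: "\<exists>A'. runs inner (conf 0 A0 (e(c := i, u := a, v := b))) (T + (16 * n + 17))
      (conf 0 A' (e(c := i, u := a, v := b))) \<and> good A' \<and> (\<forall>j. A0 ?R j \<longrightarrow> A' ?R j) \<and> (A0 ?R a \<longrightarrow> Q a b \<longrightarrow> A' ?R b)"
    if g: "good A0" and iab: "i < n" "a < n" "b < n" for A0 i a b
  proof -
    let ?e = "e(c := i, u := a, v := b)"
    have ee: "?e u = a" "?e v = b" "?e 0 = 0" "?e ?R = 0" "?e (k + 2) = 0" using uvc e0 k by auto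
    show ?thesis
    proof (cases "A0 ?R a")
      case False
      have "runs inner (conf 0 A0 ?e) (8 * n + 8 + 0) (conf 0 A0 ?e)"
        unfolding inner_def using False ee iab uvc k by (intro runs_memI kK) auto
      then have "runs inner (conf 0 A0 ?e) (T + (16 * n + 17)) (conf 0 A0 ?e)" by (rule runs_mono) simp
      then show ?thesis using g False by blast
    next
      case True
      obtain A' where A': "runs (compile (k + 2) \<phi>) (conf 0 A0 ?e) T (conf 0 A' ?e)" "A' (k + 2) 0 = Q a b"
        "\<And>j. j < k + 2 \<Longrightarrow> A' j = A0 j"
        using sub[OF iab] unfolding computes_def by blast
      define A'' where "A'' = (if Q a b then A'(?R := (A' ?R)(b := True)) else A')"
      have "runs (if bitT (k + 2) (map read_tape (conf 0 A' ?e)) then putI ?R v True else [])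
          (conf 0 A' ?e) (8 * n + 8) (conf 0 A'' ?e)"
      proof (cases "Q a b")
        case True
        have "runs (putI ?R v True) (conf 0 A' ?e) (8 * n + 8) (conf 0 (A'(?R := (A' ?R)(?e v := True))) ?e)"
          using ee iab uvc k by (intro runs_putI kK) auto
        then show ?thesis using True ee A'(2) k by (simp add: A''_def)
      qed (use ee A'(2) k in \<open>simp add: A''_def\<close>)
      then have "runs [Cond (bitT (k + 2)) (putI ?R v True) []] (conf 0 A' ?e) (Suc (8 * n + 8)) (conf 0 A'' ?e)"
        by (rule runs_Cond)
      with A'(1) have "runs (compile (k + 2) \<phi> @ [Cond (bitT (k + 2)) (putI ?R v True) []]) (conf 0 A0 ?e)
          (T + Suc (8 * n + 8)) (conf 0 A'' ?e)" by (rule runs_append)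
      then have "runs inner (conf 0 A0 ?e) (8 * n + 8 + (T + Suc (8 * n + 8))) (conf 0 A'' ?e)"
        unfolding inner_def using True ee iab uvc k by (intro runs_memI kK) auto
      then have "runs inner (conf 0 A0 ?e) (T + (16 * n + 17)) (conf 0 A'' ?e)" by (rule runs_mono) simp
      moreover have "?S\<^sup>*\<^sup>* (e x) b" if "Q a b"
      proof (rule rtranclp.rtrancl_into_rtrancl)
        show "?S\<^sup>*\<^sup>* (e x) a" using g True iab by (simp add: good_def)
      qed (use iab that in simp)
      then have "good A''" using g A'(3) iab unfolding good_def A''_def by auto
      moreover have "A0 ?R j \<longrightarrow> A'' ?R j" for j using A'(3)[of ?R] by (auto simp: A''_def)
      moreover have "Q a b \<longrightarrow> A'' ?R b" by (simp add: A''_def)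
      ultimately show ?thesis by blast
    qed
  qed
  have row: "\<exists>A'. runs (forI v inner) (conf 0 A0 (e(c := i, u := a))) (n * (T + (16 * n + 17) + 4) + 2)
      (conf 0 A' (e(c := i, u := a))) \<and>
      (good A' \<and> (\<forall>j. A0 ?R j \<longrightarrow> A' ?R j) \<and> (\<forall>b<n. A0 ?R a \<longrightarrow> Q a b \<longrightarrow> A' ?R b))"
    if g: "good A0" and ia: "i < n" "a < n" for A0 i a
  proof (rule runs_forI[where P = "\<lambda>b' A'. good A' \<and> (\<forall>j. A0 ?R j \<longrightarrow> A' ?R j) \<and>
      (\<forall>b<b'. A0 ?R a \<longrightarrow> Q a b \<longrightarrow> A' ?R b)"])
    fix b A' assume b: "b < n" and P: "good A' \<and> (\<forall>j. A0 ?R j \<longrightarrow> A' ?R j) \<and> (\<forall>b'<b. A0 ?R a \<longrightarrow> Q a b' \<longrightarrow> A' ?R b')"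
    then have g': "good A'" by blast
    from inner[OF g' ia b] obtain A'' where A'': "runs inner (conf 0 A' (e(c := i, u := a, v := b))) (T + (16 * n + 17))
        (conf 0 A'' (e(c := i, u := a, v := b))) \<and> good A'' \<and> (\<forall>j. A' ?R j \<longrightarrow> A'' ?R j) \<and>
        (A' ?R a \<longrightarrow> Q a b \<longrightarrow> A'' ?R b)" ..
    have new: "\<forall>b'<Suc b. A0 ?R a \<longrightarrow> Q a b' \<longrightarrow> A'' ?R b'" using A'' P by (simp add: less_Suc_eq)
    show "\<exists>B. runs inner (conf 0 A' (e(c := i, u := a, v := b))) (T + (16 * n + 17)) (conf 0 B (e(c := i, u := a, v := b))) \<and>
      (good B \<and> (\<forall>j. A0 ?R j \<longrightarrow> B ?R j) \<and> (\<forall>b'<Suc b. A0 ?R a \<longrightarrow> Q a b' \<longrightarrow> B ?R b'))"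
      by (rule exI[of _ A'']) (use A'' P new in simp)
  qed (use kK e0 uvc g in auto)
  have round: "\<exists>A'. runs (forI u (forI v inner)) (conf 0 A0 (e(c := i)))
      (n * (n * (T + (16 * n + 17) + 4) + 2 + 4) + 2) (conf 0 A' (e(c := i))) \<and>
      (good A' \<and> (\<forall>j. A0 ?R j \<longrightarrow> A' ?R j) \<and> (\<forall>a<n. \<forall>b<n. A0 ?R a \<longrightarrow> Q a b \<longrightarrow> A' ?R b))"
    if g: "good A0" and i: "i < n" for A0 i
  proof (rule runs_forI[where P = "\<lambda>a' A'. good A' \<and> (\<forall>j. A0 ?R j \<longrightarrow> A' ?R j) \<and>
      (\<forall>a<a'. \<forall>b<n. A0 ?R a \<longrightarrow> Q a b \<longrightarrow> A' ?R b)"])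
    fix a A' assume a: "a < n" and P: "good A' \<and> (\<forall>j. A0 ?R j \<longrightarrow> A' ?R j) \<and>
      (\<forall>a'<a. \<forall>b<n. A0 ?R a' \<longrightarrow> Q a' b \<longrightarrow> A' ?R b)"
    then have g': "good A'" by blast
    from row[OF g' i a] obtain A'' where A'': "runs (forI v inner) (conf 0 A' (e(c := i, u := a))) (n * (T + (16 * n + 17) + 4) + 2)
      (conf 0 A'' (e(c := i, u := a))) \<and> (good A'' \<and> (\<forall>j. A' ?R j \<longrightarrow> A'' ?R j) \<and>
      (\<forall>b<n. A' ?R a \<longrightarrow> Q a b \<longrightarrow> A'' ?R b))" ..
    have new: "\<forall>a'<Suc a. \<forall>b<n. A0 ?R a' \<longrightarrow> Q a' b \<longrightarrow> A'' ?R b" using A'' P by (simp add: less_Suc_eq)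
    show "\<exists>B. runs (forI v inner) (conf 0 A' (e(c := i, u := a))) (n * (T + (16 * n + 17) + 4) + 2)
        (conf 0 B (e(c := i, u := a))) \<and>
      (good B \<and> (\<forall>j. A0 ?R j \<longrightarrow> B ?R j) \<and> (\<forall>a'<Suc a. \<forall>b<n. A0 ?R a' \<longrightarrow> Q a' b \<longrightarrow> B ?R b))"
      by (rule exI[of _ A'']) (use A'' P new in simp)
  qed (use kK e0 uvc g in auto)
  have "\<exists>A3. runs (forI c (forI u (forI v inner))) (conf 0 A2 e)
      (n * (n * (n * (T + (16 * n + 17) + 4) + 2 + 4) + 2 + 4) + 2) (conf 0 A3 e) \<and>
      (good A3 \<and> (cl A3 \<or> n < sz A3))"
  \<comment> \<open>After \<open>i\<close> rounds the set is closed or has more than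
    \<open>i\<close> elements; for \<open>i = n\<close> the second alternative is
    impossible.\<close>
  proof (rule runs_forI[where P = "\<lambda>i A'. good A' \<and> (cl A' \<or> i < sz A')"])
    have "{j. j < n \<and> A2 ?R j} \<noteq> {}" using g2 xy by (auto simp: good_def)
    then show "good A2 \<and> (cl A2 \<or> 0 < sz A2)" using g2 by (simp add: sz_def card_gt_0_iff)
  next
    fix i A' assume i: "i < n" and P: "good A' \<and> (cl A' \<or> i < sz A')"
    then have g': "good A'" by blast
    from round[OF g' i] obtain A'' where "runs (forI u (forI v inner)) (conf 0 A' (e(c := i)))
      (n * (n * (T + (16 * n + 17) + 4) + 2 + 4) + 2) (conf 0 A'' (e(c := i))) \<and> (good A'' \<and>
      (\<forall>j. A' ?R j \<longrightarrow> A'' ?R j) \<and> (\<forall>a<n. \<forall>b<n. A' ?R a \<longrightarrow> Q a b \<longrightarrow> A'' ?R b))" ..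
    then have A'': "runs (forI u (forI v inner)) (conf 0 A' (e(c := i)))
      (n * (n * (T + (16 * n + 17) + 4) + 2 + 4) + 2) (conf 0 A'' (e(c := i)))" "good A''"
      "\<And>j. A' ?R j \<Longrightarrow> A'' ?R j" "\<And>a b. a < n \<Longrightarrow> b < n \<Longrightarrow> A' ?R a \<Longrightarrow> Q a b \<Longrightarrow> A'' ?R b"
      by simp_all
    have sub: "{j. j < n \<and> A' ?R j} \<subseteq> {j. j < n \<and> A'' ?R j}" using A''(3) by blast
    have "cl A'' \<or> Suc i < sz A''"
    proof (cases "{j. j < n \<and> A' ?R j} = {j. j < n \<and> A'' ?R j}")
      case True
      then have "A' ?R j \<longleftrightarrow> A'' ?R j" if "j < n" for j using that by blast
      then have "cl A''" using A''(4) unfolding cl_def by blast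
      then show ?thesis by simp
    next
      case False
      have "\<not> cl A'"
      proof
        assume "cl A'"
        have "A' ?R j" if "j < n" "A'' ?R j" for j
        proof -
          have "?S\<^sup>*\<^sup>* (e x) j" using A''(2) that by (simp add: good_def)
          then show ?thesis
          proof (induction rule: rtranclp_induct)
            case base
            then show ?case using P by (simp add: good_def)
          next
            case (step y z)
            then show ?case using \<open>cl A'\<close> unfolding cl_def by blast
          qed
        qed
        then show False using False sub by blast
      qed
      moreover have "sz A' < sz A''" unfolding sz_def using False sub by (intro psubset_card_mono) auto
      ultimately show ?thesis using P by simp
    qed
    then show "\<exists>B. runs (forI u (forI v inner)) (conf 0 A' (e(c := i)))
      (n * (n * (T + (16 * n + 17) + 4) + 2 + 4) + 2) (conf 0 B (e(c := i))) \<and> (good B \<and> (cl B \<or> Suc i < sz B))"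
      using A''(1,2) by (intro exI[of _ A''] conjI)
  qed (use kK e0 in auto)
  then obtain A3 where A3: "runs (forI c (forI u (forI v inner))) (conf 0 A2 e)
      (n * (n * (n * (T + (16 * n + 21)) + 6) + 6) + 2) (conf 0 A3 e)" "good A3" "cl A3 \<or> n < sz A3"
    unfolding add.assoc by auto
  have "sz A3 \<le> card {..<n}" unfolding sz_def by (intro card_mono) auto
  then have "cl A3" using A3(3) by simp
  have iff: "A3 ?R (e y) \<longleftrightarrow> ?S\<^sup>*\<^sup>* (e x) (e y)"
  proof
    assume "?S\<^sup>*\<^sup>* (e x) (e y)"
    then show "A3 ?R (e y)"
    proof (induction rule: rtranclp_induct)
      case base
      then show ?case using A3(2) by (simp add: good_def)
    next
      case (step y z)
      then show ?case using \<open>cl A3\<close> unfolding cl_def by blast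
    qed
  qed (use A3(2) xy in \<open>simp add: good_def\<close>)
  define A4 where "A4 = A3(k := (A3 k)(0 := A3 ?R (e y)))"
  have "runs (if A3 ?R (e y) then [put k True] else [put k False]) (conf 0 A3 e) 1 (conf 0 A4 e)"
    using runs_flag[of k e _ A3] kK e0 by (simp add: A4_def)
  then have "runs (memI ?R y [put k True] [put k False]) (conf 0 A3 e) (8 * n + 8 + 1) (conf 0 A4 e)"
    using e0 xy k by (intro runs_memI kK) auto
  from runs_append[OF A1(1) runs_append[OF A2 runs_append[OF A3(1) this]]]
  have "runs (compile k (Reach x y u v c \<phi>)) (conf 0 A e)
    (n * (n * (n * (T + (16 * n + 21)) + 6) + 6) + 2 + (n * (8 * n + 12) + 2) + (8 * n + 8) + (8 * n + 9)) (conf 0 A4 e)"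
    unfolding inner_def by (auto intro: runs_mono)
  moreover have "A4 k 0 = ?S\<^sup>*\<^sup>* (e x) (e y)" using iff by (simp add: A4_def)
  moreover have "\<forall>j<k. A4 j = A j" using A3(2) by (auto simp: A4_def good_def)
  ultimately show "\<exists>A'. runs (compile k (Reach x y u v c \<phi>)) (conf 0 A e)
     (n * (n * (n * (T + (16 * n + 21)) + 6) + 6) + 2 + (n * (8 * n + 12) + 2) + (8 * n + 8) + (8 * n + 9)) (conf 0 A' e) \<and>
     A' k 0 = ?S\<^sup>*\<^sup>* (e x) (e y) \<and> (\<forall>j<k. A' j = A j)" by blast
qed

lemma compile_correct:
  assumes "wf_fm m B \<phi>" "env m B e" "3 \<le> m" "m \<le> k" "k + depth \<phi> \<le> K"
  shows "computes (compile k \<phi>) (poly (tp \<phi>) n) k e (holds e \<phi>)"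
  using assms
proof (induction \<phi> arbitrary: B e k)
  case (Eq x y)
  note e = Eq.prems(2)
  have xy: "3 \<le> x" "x < m" "3 \<le> y" "y < m" using env_var[OF e] Eq.prems(1) by auto
  have e0: "e 0 = 0" "e k = 0" using env_temps[OF e] Eq.prems by auto
  show ?case unfolding computes_def
  proof
    fix A :: "nat \<Rightarrow> nat \<Rightarrow> bool"
    let ?A = "A(k := (A k)(0 := e x = e y))"
    have "runs (if e x = e y then [put k True] else [put k False]) (conf 0 A e) 1 (conf 0 ?A e)"
      using runs_flag[of k e _ A] e0 Eq.prems by simp
    then have "runs (compile k (Eq x y)) (conf 0 A e) (8 * n + 8 + 1) (conf 0 ?A e)"
      unfolding compile.simps using xy e0 env_le[OF e] Eq.prems by (intro runs_eqI) auto
    then have "runs (compile k (Eq x y)) (conf 0 A e) (poly (tp (Eq x y)) n) (conf 0 ?A e)"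
      by (rule runs_mono) simp
    then show "\<exists>A'. runs (compile k (Eq x y)) (conf 0 A e) (poly (tp (Eq x y)) n) (conf 0 A' e) \<and>
      A' k 0 = holds e (Eq x y) \<and> (\<forall>j<k. A' j = A j)" by (intro exI[of _ ?A]) simp
  qed
next
  case (InS x y s)
  note e = InS.prems(2)
  have xy: "2 \<le> x" "x < m" "2 \<le> y" "y < m"
    using env_var[OF e, of x] env_var[OF e, of y] InS.prems by auto
  have e0: "e 0 = 0" "e 1 = 0" "e k = 0" using env_temps[OF e] InS.prems by auto
  show ?case unfolding computes_def
  proof
    fix A :: "nat \<Rightarrow> nat \<Rightarrow> bool"
    let ?b = "inp w (n + 1 + e x * n + e y) = s"
    let ?A = "A(k := (A k)(0 := ?b))"
    have "runs (if ?b then [put k True] else [put k False]) (conf 0 A e) 1 (conf 0 ?A e)"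
      using runs_flag[of k e _ A] e0 InS.prems by simp
    then have "runs (compile k (InS x y s)) (conf 0 A e) (10 * n * n + 32 * n + 20 + 1) (conf 0 ?A e)"
      unfolding compile.simps using xy e0 env_le[OF e] InS.prems by (intro runs_inI) auto
    then have "runs (compile k (InS x y s)) (conf 0 A e) (poly (tp (InS x y s)) n) (conf 0 ?A e)"
      by (rule runs_mono) (simp add: algebra_simps)
    then show "\<exists>A'. runs (compile k (InS x y s)) (conf 0 A e) (poly (tp (InS x y s)) n) (conf 0 A' e) \<and>
      A' k 0 = holds e (InS x y s) \<and> (\<forall>j<k. A' j = A j)" by (intro exI[of _ ?A]) simp
  qed
next
  case (Neg \<phi>)
  have e0: "e k = 0" using env_temps[OF Neg.prems(2)] Neg.prems by auto
  have d: "0 < depth \<phi>" by (induction \<phi>) auto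
  have IH: "computes (compile k \<phi>) (poly (tp \<phi>) n) k e (holds e \<phi>)" using Neg by simp
  show ?case unfolding computes_def
  proof
    fix A :: "nat \<Rightarrow> nat \<Rightarrow> bool"
    obtain A1 where A1: "runs (compile k \<phi>) (conf 0 A e) (poly (tp \<phi>) n) (conf 0 A1 e)" "A1 k 0 = holds e \<phi>"
      "\<forall>j<k. A1 j = A j" using IH unfolding computes_def by blast
    let ?A = "A1(k := (A1 k)(0 := \<not> holds e \<phi>))"
    have "runs (if bitT k (map read_tape (conf 0 A1 e)) then [put k False] else [put k True]) (conf 0 A1 e) 1 (conf 0 ?A e)"
      using runs_flag[of k e _ A1] e0 d Neg.prems A1(2) by simp
    then have "runs [Cond (bitT k) [put k False] [put k True]] (conf 0 A1 e) (Suc 1) (conf 0 ?A e)"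
      by (rule runs_Cond)
    from runs_append[OF A1(1) this]
    have "runs (compile k (Neg \<phi>)) (conf 0 A e) (poly (tp (Neg \<phi>)) n) (conf 0 ?A e)"
      by (simp add: numeral_2_eq_2)
    then show "\<exists>A'. runs (compile k (Neg \<phi>)) (conf 0 A e) (poly (tp (Neg \<phi>)) n) (conf 0 A' e) \<and>
      A' k 0 = holds e (Neg \<phi>) \<and> (\<forall>j<k. A' j = A j)" using A1(3) by (intro exI[of _ ?A]) simp
  qed
next
  case (Conj \<phi> \<psi>)
  have e0: "e k = 0" using env_temps[OF Conj.prems(2)] Conj.prems by auto
  have d: "0 < depth \<phi>" by (induction \<phi>) auto
  have IH: "computes (compile k \<phi>) (poly (tp \<phi>) n) k e (holds e \<phi>)" "computes (compile k \<psi>) (poly (tp \<psi>) n) k e (holds e \<psi>)"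
    using Conj.IH(1)[of B e k] Conj.IH(2)[of B e k] Conj.prems by auto
  show ?case unfolding computes_def
  proof
    fix A :: "nat \<Rightarrow> nat \<Rightarrow> bool"
    obtain A1 where A1: "runs (compile k \<phi>) (conf 0 A e) (poly (tp \<phi>) n) (conf 0 A1 e)" "A1 k 0 = holds e \<phi>"
      "\<forall>j<k. A1 j = A j" using IH unfolding computes_def by blast
    obtain A2 where A2: "runs (compile k \<psi>) (conf 0 A1 e) (poly (tp \<psi>) n) (conf 0 A2 e)" "A2 k 0 = holds e \<psi>"
      "\<forall>j<k. A2 j = A1 j" using IH unfolding computes_def by blast
    let ?A = "if holds e \<phi> then A2 else A1"
    have "runs (if bitT k (map read_tape (conf 0 A1 e)) then compile k \<psi> else []) (conf 0 A1 e) (poly (tp \<psi>) n) (conf 0 ?A e)"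
      using A2(1) e0 d Conj.prems A1(2) by simp
    then have "runs [Cond (bitT k) (compile k \<psi>) []] (conf 0 A1 e) (Suc (poly (tp \<psi>) n)) (conf 0 ?A e)"
      by (rule runs_Cond)
    from runs_append[OF A1(1) this]
    have "runs (compile k (Conj \<phi> \<psi>)) (conf 0 A e) (poly (tp (Conj \<phi> \<psi>)) n) (conf 0 ?A e)" by simp
    then show "\<exists>A'. runs (compile k (Conj \<phi> \<psi>)) (conf 0 A e) (poly (tp (Conj \<phi> \<psi>)) n) (conf 0 A' e) \<and>
      A' k 0 = holds e (Conj \<phi> \<psi>) \<and> (\<forall>j<k. A' j = A j)"
      using A1(2,3) A2(2,3) by (intro exI[of _ ?A]) simp
  qed
next
  case (Ex x \<phi>)
  note e = Ex.prems(2)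
  have d: "0 < depth \<phi>" by (induction \<phi>) auto
  have x: "3 \<le> x" "x < m" "e x = 0" using Ex.prems(1) env_zero[OF e, of x] by auto
  have e0: "e k = 0" "e (k + 1) = 0" using env_temps[OF e] Ex.prems by auto
  have kK: "k < K" "k + 1 < K" "x < K" using Ex.prems x d by auto
  have IH: "computes (compile (k + 1) \<phi>) (poly (tp \<phi>) n) (k + 1) (e(x := i)) (holds (e(x := i)) \<phi>)" if "i < n" for i
    using Ex.prems by (intro Ex.IH[OF _ env_upd[OF e x(1,2) that]]) auto
  show ?case unfolding computes_def
  proof
    fix A :: "nat \<Rightarrow> nat \<Rightarrow> bool"
    let ?c = "compile (k + 1) \<phi> @ [Cond (bitT (k + 1)) [put k True] []]"
    let ?A0 = "A(k := (A k)(0 := False))"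
    have "\<exists>A1. runs (forI x ?c) (conf 0 ?A0 e) (n * (poly (tp \<phi>) n + 2 + 4) + 2) (conf 0 A1 e) \<and>
      ((A1 k 0 \<longleftrightarrow> (\<exists>i<n. holds (e(x := i)) \<phi>)) \<and> (\<forall>j<k. A1 j = A j))"
    proof (rule runs_forI[where P = "\<lambda>b A1. (A1 k 0 \<longleftrightarrow> (\<exists>i<b. holds (e(x := i)) \<phi>)) \<and> (\<forall>j<k. A1 j = A j)"])
      fix i A1 assume i: "i < n" and P: "(A1 k 0 \<longleftrightarrow> (\<exists>i'<i. holds (e(x := i')) \<phi>)) \<and> (\<forall>j<k. A1 j = A j)"
      obtain A2 where A2: "runs (compile (k + 1) \<phi>) (conf 0 A1 (e(x := i))) (poly (tp \<phi>) n) (conf 0 A2 (e(x := i)))"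
        "A2 (k + 1) 0 = holds (e(x := i)) \<phi>" "\<forall>j<k + 1. A2 j = A1 j" using IH[OF i] unfolding computes_def by blast
      let ?A = "if holds (e(x := i)) \<phi> then A2(k := (A2 k)(0 := True)) else A2"
      have "(e(x := i)) k = 0" "(e(x := i)) (k + 1) = 0" using e0 x Ex.prems by auto
      then have "runs (if bitT (k + 1) (map read_tape (conf 0 A2 (e(x := i)))) then [put k True] else [])
          (conf 0 A2 (e(x := i))) 1 (conf 0 ?A (e(x := i)))"
        using runs_flag[of k "e(x := i)" True A2] kK A2(2) by simp
      then have "runs [Cond (bitT (k + 1)) [put k True] []] (conf 0 A2 (e(x := i))) (Suc 1) (conf 0 ?A (e(x := i)))"
        by (rule runs_Cond)
      from runs_append[OF A2(1) this]
      have "runs ?c (conf 0 A1 (e(x := i))) (poly (tp \<phi>) n + 2) (conf 0 ?A (e(x := i)))"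
        by (simp add: numeral_2_eq_2)
      moreover have "(?A k 0 \<longleftrightarrow> (\<exists>i'<Suc i. holds (e(x := i')) \<phi>)) \<and> (\<forall>j<k. ?A j = A j)"
        using P A2(3) by (auto simp: less_Suc_eq)
      ultimately show "\<exists>B. runs ?c (conf 0 A1 (e(x := i))) (poly (tp \<phi>) n + 2) (conf 0 B (e(x := i))) \<and>
        ((B k 0 \<longleftrightarrow> (\<exists>i'<Suc i. holds (e(x := i')) \<phi>)) \<and> (\<forall>j<k. B j = A j))" by blast
    qed (use kK x in auto)
    then obtain A1 where A1: "runs (forI x ?c) (conf 0 ?A0 e) (n * (poly (tp \<phi>) n + 2 + 4) + 2) (conf 0 A1 e)"
      "A1 k 0 \<longleftrightarrow> (\<exists>i<n. holds (e(x := i)) \<phi>)" "\<forall>j<k. A1 j = A j" by blast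
    have "runs [put k False] (conf 0 A e) 1 (conf 0 ?A0 e)" using runs_flag[of k e False A] kK(1) e0(1) by blast
    from runs_Cons[OF this A1(1)]
    have "runs (compile k (Ex x \<phi>)) (conf 0 A e) (poly (tp (Ex x \<phi>)) n) (conf 0 A1 e)"
      by (simp add: numeral_3_eq_3)
    then show "\<exists>A'. runs (compile k (Ex x \<phi>)) (conf 0 A e) (poly (tp (Ex x \<phi>)) n) (conf 0 A' e) \<and>
      A' k 0 = holds e (Ex x \<phi>) \<and> (\<forall>j<k. A' j = A j)" using A1(2,3) by auto
  qed
next
  case (Reach x y u v c \<phi>)
  note e = Reach.prems(2) and w = Reach.prems(1)
  have d: "0 < depth \<phi>" by (induction \<phi>) auto
  have uvc: "3 \<le> u" "3 \<le> v" "3 \<le> c" "u < m" "v < m" "c < m" "c \<notin> insert 2 (insert v (insert u B))" using w by auto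
  have "computes (compile (k + 2) \<phi>) (poly (tp \<phi>) n) (k + 2) (e(c := i, u := a, v := b)) (holds (e(u := a, v := b)) \<phi>)"
    if i: "i < n" "a < n" "b < n" for i a b
  proof -
    have env: "env m (insert v (insert u (insert c B))) (e(c := i, u := a, v := b))"
      using uvc i by (intro env_upd e)
    \<comment> \<open>The round counter \<open>c\<close> is in scope while the body is evaluated but
      is not mentioned in it, so the truth value is the same in every round.\<close>
    have "holds (e(c := i, u := a, v := b)) \<phi> = holds (e(u := a, v := b)) \<phi>"
      using w uvc(7) by (intro holds_cong[of m "insert v (insert u B)"]) auto
    moreover have "computes (compile (k + 2) \<phi>) (poly (tp \<phi>) n) (k + 2) (e(c := i, u := a, v := b))
      (holds (e(c := i, u := a, v := b)) \<phi>)"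
      using Reach.prems by (intro Reach.IH[OF _ env]) auto
    ultimately show ?thesis by simp
  qed
  then have "computes (compile k (Reach x y u v c \<phi>))
     (n * (n * (n * (poly (tp \<phi>) n + (16 * n + 21)) + 6) + 6) + 2 + (n * (8 * n + 12) + 2) + (8 * n + 8) + (8 * n + 9)) k e
     (holds e (Reach x y u v c \<phi>))"
    unfolding holds.simps using Reach.prems d by (intro compile_Reach[OF e _ _ _ w]) auto
  moreover have "poly (tp (Reach x y u v c \<phi>)) n =
     n * (n * (n * (poly (tp \<phi>) n + (16 * n + 21)) + 6) + 6) + 2 + (n * (8 * n + 12) + 2) + (8 * n + 8) + (8 * n + 9)"
    by (simp add: algebra_simps)
  ultimately show ?case by (simp only:)
qed

end

section \<open>Reading the size of the graph and running the compiled formula\<close>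

lemma poly_nat_mono: "x \<le> y \<Longrightarrow> poly p x \<le> poly p y" for p :: "nat poly"
  by (induction p) (auto intro: add_mono mult_mono)

definition env0 :: "nat \<Rightarrow> nat \<Rightarrow> nat" where
  "env0 n = (\<lambda>_. 0)(2 := n)"

definition all_tapes :: "nat \<Rightarrow> (nat \<Rightarrow> nat \<times> direction) \<Rightarrow> instr list" where
  "all_tapes K g = map (\<lambda>j. Act (Suc j) g) [0..<K]"

text \<open>Tape 2 is left out when the heads return, so that variable 2 keeps the value
  \<open>n\<close>.\<close>

definition other_tapes :: "nat \<Rightarrow> (nat \<Rightarrow> nat \<times> direction) \<Rightarrow> instr list" where
  "other_tapes K g = map (\<lambda>j. Act (Suc j) g) (filter (\<lambda>j. j \<noteq> 2) [0..<K])"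

text \<open>On entry all heads stand at cell \<open>n\<close>. Adding 4 writes the end marks there,
  also for \<open>n = 0\<close>, where the mark shares its cell with the start mark.\<close>

definition main_prog :: "nat \<Rightarrow> nat \<Rightarrow> fm \<Rightarrow> instr list" where
  "main_prog K m \<phi> = all_tapes K (\<lambda>s. (s + 4, Stay)) @
     [Loop (\<lambda>rs. \<not> zeroT 0 rs) (inL # other_tapes K (\<lambda>s. (s, Go_Left)))] @
     compile m \<phi> @ [Cond (bitT m) [Halt True] [Halt False]]"

text \<open>All heads advance together over the unary prefix, whose bits appear as symbol 2. Symbol
  1 is the separator; a blank in its place means that the input encodes no graph.\<close>

definition prog :: "nat \<Rightarrow> nat \<Rightarrow> fm \<Rightarrow> instr list" where
  "prog K m \<phi> = all_tapes K (\<lambda>s. (1, Stay)) @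
     [Loop (inT 2) (inR # all_tapes K (\<lambda>s. (s, Go_Right)))] @
     [Cond (inT 1) (main_prog K m \<phi>) [Halt False]]"

context store
begin

lemma runs_list:
  assumes "distinct js" "set js \<subseteq> {..<K}"
  shows "runs (map (\<lambda>j. Act (Suc j) g) js) (cfg i T) (length js)
    (cfg i (\<lambda>j. if j \<in> set js then act_tape (clip (g (read_tape (T j)))) (T j) else T j))"
  using assms
proof (induction js arbitrary: T)
  case (Cons j js)
  let ?T = "T(j := act_tape (clip (g (read_tape (T j)))) (T j))"
  have "runs [Act (Suc j) g] (cfg i T) 1 (cfg i ?T)" using runs_cfg[of j g i T] Cons.prems by simp
  moreover have "runs (map (\<lambda>j. Act (Suc j) g) js) (cfg i ?T) (length js)
    (cfg i (\<lambda>k. if k \<in> set js then act_tape (clip (g (read_tape (?T k)))) (?T k) else ?T k))"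
    using Cons by simp
  moreover have "(\<lambda>k. if k \<in> set js then act_tape (clip (g (read_tape (?T k)))) (?T k) else ?T k) =
     (\<lambda>k. if k \<in> set (j # js) then act_tape (clip (g (read_tape (T k)))) (T k) else T k)"
    using Cons.prems by (auto simp: fun_eq_iff)
  ultimately show ?case using runs_Cons by fastforce
qed simp

lemma cfg_cong: "(\<And>j. j < K \<Longrightarrow> T j = T' j) \<Longrightarrow> cfg i T = cfg i T'"
  by (simp add: cfg_def)

lemma runs_all_tapes:
  assumes "\<And>j. j < K \<Longrightarrow> act_tape (clip (g (read_tape (T j)))) (T j) = T' j"
  shows "runs (all_tapes K g) (cfg i T) K (cfg i T')"
proof -
  have "runs (all_tapes K g) (cfg i T) (length [0..<K])
    (cfg i (\<lambda>j. if j \<in> set [0..<K] then act_tape (clip (g (read_tape (T j)))) (T j) else T j))"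
    unfolding all_tapes_def by (rule runs_list) auto
  moreover have "cfg i (\<lambda>j. if j \<in> set [0..<K] then act_tape (clip (g (read_tape (T j)))) (T j) else T j) = cfg i T'"
    by (rule cfg_cong) (simp add: assms)
  ultimately show ?thesis by simp
qed

lemma runs_other_tapes:
  assumes "\<And>j. j < K \<Longrightarrow> j \<noteq> 2 \<Longrightarrow> act_tape (clip (g (read_tape (T j)))) (T j) = T' j" "T 2 = T' 2"
  shows "runs (other_tapes K g) (cfg i T) K (cfg i T')"
proof -
  let ?js = "filter (\<lambda>j. j \<noteq> 2) [0..<K]"
  have "runs (other_tapes K g) (cfg i T) (length ?js)
    (cfg i (\<lambda>j. if j \<in> set ?js then act_tape (clip (g (read_tape (T j)))) (T j) else T j))"
    unfolding other_tapes_def by (rule runs_list) auto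
  moreover have "cfg i (\<lambda>j. if j \<in> set ?js then act_tape (clip (g (read_tape (T j)))) (T j) else T j) = cfg i T'"
    by (rule cfg_cong) (auto simp: assms)
  moreover have "length ?js \<le> length [0..<K]" by (rule length_filter_le)
  ultimately show ?thesis by (auto intro: runs_mono)
qed

definition blank1 :: "nat \<Rightarrow> nat" where "blank1 = (\<lambda>_. 0)(0 := 1)"

lemma act_keep: "t h < 8 \<Longrightarrow> act_tape (clip (read_tape (t, h), d)) (t, h) = (t, move_head d h)"
  by (simp add: clip_def)

lemma blank1_less: "blank1 h < 8"
  by (simp add: blank1_def)

lemma runs_count:
  assumes w: "\<And>i. i < n \<Longrightarrow> inp w i = 2" "inp w n \<noteq> 2"
  shows "runs (all_tapes K (\<lambda>s. (1, Stay)) @ [Loop (inT 2) (inR # all_tapes K (\<lambda>s. (s, Go_Right)))])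
    (cfg 0 (\<lambda>_. ((\<lambda>_. 0), 0))) (K + (n * (Suc K + 1) + 1)) (cfg n (\<lambda>_. (blank1, n)))"
proof (rule runs_append)
  show "runs (all_tapes K (\<lambda>s. (1, Stay))) (cfg 0 (\<lambda>_. ((\<lambda>_. 0), 0))) K (cfg 0 (\<lambda>_. (blank1, 0)))"
    by (rule runs_all_tapes) (simp add: clip_def blank1_def)
  define s where "s k = cfg k (\<lambda>_. (blank1, k))" for k
  have "runs [Loop (inT 2) (inR # all_tapes K (\<lambda>s. (s, Go_Right)))] (s 0) (n * (Suc K + 1) + 1) (s n)"
  proof (rule runs_Loop_iter)
    fix k assume k: "k < n"
    have "runs [inR] (s k) 1 (cfg (Suc k) (\<lambda>_. (blank1, k)))" unfolding s_def by (rule runs_in)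
    moreover have "runs (all_tapes K (\<lambda>s. (s, Go_Right))) (cfg (Suc k) (\<lambda>_. (blank1, k))) K (s (Suc k))"
      unfolding s_def by (rule runs_all_tapes) (simp only: act_keep[of blank1] blank1_less move_head.simps Suc_eq_plus1)
    ultimately have "runs (inR # all_tapes K (\<lambda>s. (s, Go_Right))) (s k) (1 + K) (s (Suc k))" by (rule runs_Cons)
    then show "inT 2 (map read_tape (s k)) \<and> runs (inR # all_tapes K (\<lambda>s. (s, Go_Right))) (s k) (Suc K) (s (Suc k))"
      using w(1)[OF k] by (simp add: inT_def s_def read_cfg)
  qed (use w(2) in \<open>simp add: inT_def s_def read_cfg\<close>)
  then show "runs [Loop (inT 2) (inR # all_tapes K (\<lambda>s. (s, Go_Right)))] (cfg 0 (\<lambda>_. (blank1, 0)))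
    (n * (Suc K + 1) + 1) (cfg n (\<lambda>_. (blank1, n)))" by (simp add: s_def)
qed

lemma halts_main:
  assumes \<phi>: "wf_fm m {} \<phi>" "3 \<le> m" "m + depth \<phi> \<le> K"
  shows "halts (main_prog K m \<phi>) (cfg n (\<lambda>_. (blank1, n))) (K + (n * (Suc K + 1) + 1 + (poly (tp \<phi>) n + 1)))
    (holds (env0 n) \<phi>)"
proof -
  define A0 :: "nat \<Rightarrow> nat \<Rightarrow> bool" where "A0 = (\<lambda>_ _. False)"
  define s where "s k = conf (n - k) A0 (\<lambda>j. if j = 2 then n else n - k)" for k
  have mark: "runs (all_tapes K (\<lambda>s. (s + 4, Stay))) (cfg n (\<lambda>_. (blank1, n))) K (s 0)"
    unfolding s_def conf_def diff_zero
  proof (rule runs_all_tapes)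
    fix j :: nat
    show "act_tape (clip (read_tape (blank1, n) + 4, Stay)) (blank1, n) =
      (cell n (A0 j), if j = 2 then n else n)"
      by (auto simp: clip_def blank1_def cell_def A0_def fun_eq_iff)
  qed
  let ?c = "inL # other_tapes K (\<lambda>s. (s, Go_Left))"
  have "runs [Loop (\<lambda>rs. \<not> zeroT 0 rs) ?c] (s 0) (n * (Suc K + 1) + 1) (s n)"
  proof (rule runs_Loop_iter)
    fix k assume k: "k < n"
    have "runs [inL] (s k) 1 (conf (n - Suc k) A0 (\<lambda>j. if j = 2 then n else n - k))"
      using runs_inL[of "n - k" A0] by (simp add: s_def)
    moreover have "runs (other_tapes K (\<lambda>s. (s, Go_Left))) (conf (n - Suc k) A0 (\<lambda>j. if j = 2 then n else n - k)) K (s (Suc k))"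
      unfolding s_def conf_def
    proof (rule runs_other_tapes)
      fix j :: nat assume "j \<noteq> 2"
      then show "act_tape (clip (read_tape (cell n (A0 j), if j = 2 then n else n - k), Go_Left))
        (cell n (A0 j), if j = 2 then n else n - k) = (cell n (A0 j), if j = 2 then n else n - Suc k)"
        using act_keep[of "cell n (A0 j)" "n - k" Go_Left] by simp
    qed simp
    ultimately have "runs ?c (s k) (1 + K) (s (Suc k))" by (rule runs_Cons)
    then show "\<not> zeroT 0 (map read_tape (s k)) \<and> runs ?c (s k) (Suc K) (s (Suc k))"
      using k K0 by (simp add: s_def)
  qed (use K0 in \<open>simp add: s_def\<close>)
  moreover have "s n = conf 0 A0 (env0 n)" unfolding s_def env0_def
    by (rule arg_cong2[of _ _ _ _ "\<lambda>i. conf i A0"]) auto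
  ultimately have rew: "runs [Loop (\<lambda>rs. \<not> zeroT 0 rs) ?c] (s 0) (n * (Suc K + 1) + 1) (conf 0 A0 (env0 n))" by simp
  have env: "env m {} (env0 n)" by (simp add: env_def env0_def)
  obtain A where A: "runs (compile m \<phi>) (conf 0 A0 (env0 n)) (poly (tp \<phi>) n) (conf 0 A (env0 n))"
    "A m 0 = holds (env0 n) \<phi>"
    using compile_correct[OF \<phi>(1) env \<phi>(2) order_refl \<phi>(3)] unfolding computes_def by blast
  have "0 < depth \<phi>" by (induction \<phi>) auto
  then have mK: "m < K" using \<phi>(3) by simp
  have "halts (if bitT m (map read_tape (conf 0 A (env0 n))) then [Halt True] else [Halt False])
      (conf 0 A (env0 n)) 0 (holds (env0 n) \<phi>)"
    using A(2) \<phi>(2) mK halts_Halt[of _ _ 0] by (simp add: env0_def)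
  then have "halts [Cond (bitT m) [Halt True] [Halt False]] (conf 0 A (env0 n)) (Suc 0) (holds (env0 n) \<phi>)"
    by (rule halts_Cond)
  from runs_halts[OF mark runs_halts[OF rew runs_halts[OF A(1) this]]]
  show ?thesis unfolding main_prog_def by (rule halts_mono) simp
qed

end

lemma inp_append_True: "i < n \<Longrightarrow> inp (replicate n True @ v) i = 2"
  by (simp add: inp_def input_tape_def nth_append)

lemma inp_append_False: "inp (replicate n True @ False # v) n = 1"
  by (simp add: inp_def input_tape_def nth_append)

lemma inp_beyond: "length w \<le> i \<Longrightarrow> inp w i = 0"
  by (simp add: inp_def input_tape_def)

theorem fm_polynomial_time:
  assumes \<phi>: "wf_fm m {} \<phi>" "3 \<le> m"
    and L: "\<And>w. w \<in> L \<longleftrightarrow> (\<exists>n v. w = replicate n True @ False # v \<and> store.holds w n (env0 n) \<phi>)"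
  shows "polynomial_time_solvable L"
proof -
  define K where "K = m + depth \<phi>"
  have st: "store K" by unfold_locales (use \<phi>(2) in \<open>simp add: K_def\<close>)
  \<comment> \<open>The time is polynomial in the length \<open>n\<close> of the unary prefix; since
    \<open>n\<close> is at most the length of the input and \<open>q\<close> is monotone, it is
    polynomial in the input length.\<close>
  define q :: "nat poly" where "q = [:K + 1, K + 2:] + [:1:] + ([:K + 2, K + 2:] + tp \<phi>)"
  have q: "poly q n = K + (n * (Suc K + 1) + 1) + Suc (K + (n * (Suc K + 1) + 1 + (poly (tp \<phi>) n + 1)))" for n
    by (simp add: q_def algebra_simps)
  have "halts (prog K m \<phi>) (input_tape w # replicate (Suc K - 1) ((\<lambda>_. 0), 0)) (poly q (length w)) (w \<in> L)" for w
  proof -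
    have start: "input_tape w # replicate (Suc K - 1) ((\<lambda>_. 0), 0) = store.cfg w K 0 (\<lambda>_. ((\<lambda>_. 0), 0))"
      by (simp add: store.cfg_def[OF st] inp_def input_tape_def map_replicate_const)
    define n where "n = length (takeWhile (\<lambda>b. b) w)"
    have tw: "takeWhile (\<lambda>b. b) w = replicate n True"
      unfolding n_def by (rule replicate_eqI[symmetric, of _ "length (takeWhile (\<lambda>b. b) w)", THEN sym]) (auto dest: set_takeWhileD)
    then have w: "w = replicate n True @ dropWhile (\<lambda>b. b) w" by (metis takeWhile_dropWhile_id)
    have nw: "n \<le> length w" unfolding n_def by (rule length_takeWhile_le)
    have two: "inp w i = 2" if "i < n" for i using inp_append_True[OF that] w by metis
    show ?thesis
    proof (cases "dropWhile (\<lambda>b. b) w")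
      case Nil
      then have w': "w = replicate n True" using w by (metis append_Nil2)
      then have "inp w n = 0" by (intro inp_beyond) simp
      have "w \<notin> L"
      proof
        assume "w \<in> L"
        then obtain k v where "replicate n True = replicate k True @ False # v" using L w' by metis
        then have "False \<in> set (replicate n True)" by simp
        then show False by simp
      qed
      have "halts [Cond (inT 1) (main_prog K m \<phi>) [Halt False]] (store.cfg w K n (\<lambda>_. (store.blank1, n))) (Suc 0) False"
        using \<open>inp w n = 0\<close> halts_Halt[of False _ 0]
        by (intro halts_Cond) (simp add: inT_def store.read_cfg[OF st])
      from runs_halts[OF store.runs_count[OF st two, of n] this]
      have "halts (prog K m \<phi>) (store.cfg w K 0 (\<lambda>_. ((\<lambda>_. 0), 0))) (K + (n * (Suc K + 1) + 1) + Suc 0) False"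
        using \<open>inp w n = 0\<close> by (simp add: prog_def)
      moreover have "K + (n * (Suc K + 1) + 1) + Suc 0 \<le> poly q n" unfolding q by simp
      ultimately show ?thesis unfolding start using \<open>w \<notin> L\<close> poly_nat_mono[OF nw, of q]
        by (auto intro: halts_mono)
    next
      case (Cons b v)
      then have "\<not> b" using hd_dropWhile[of "\<lambda>b. b" w] by simp
      then have w': "w = replicate n True @ False # v" using w Cons by metis
      then have one: "inp w n = 1" using inp_append_False by metis
      have "w \<in> L \<longleftrightarrow> store.holds w n (env0 n) \<phi>"
      proof -
        have "k = n" if "w = replicate k True @ False # v'" for k v'
          using replicate_True_append_False_inject[of k v' n v] w' that by metis
        then show ?thesis using L w' by blast
      qed
      moreover have "halts (main_prog K m \<phi>) (store.cfg w K n (\<lambda>_. (store.blank1, n)))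
          (K + (n * (Suc K + 1) + 1 + (poly (tp \<phi>) n + 1))) (store.holds w n (env0 n) \<phi>)"
        by (rule store.halts_main[OF st \<phi>]) (simp add: K_def)
      ultimately have "halts [Cond (inT 1) (main_prog K m \<phi>) [Halt False]] (store.cfg w K n (\<lambda>_. (store.blank1, n)))
          (Suc (K + (n * (Suc K + 1) + 1 + (poly (tp \<phi>) n + 1)))) (w \<in> L)"
        using one by (intro halts_Cond) (simp add: inT_def store.read_cfg[OF st])
      from runs_halts[OF store.runs_count[OF st two, of n] this]
      have "halts (prog K m \<phi>) (store.cfg w K 0 (\<lambda>_. ((\<lambda>_. 0), 0))) (poly q n) (w \<in> L)"
        using one unfolding q prog_def by simp
      then show ?thesis unfolding start using poly_nat_mono[OF nw, of q] by (auto intro: halts_mono)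
    qed
  qed
  then obtain M where "wf_tm M" "decides_in_time M L (poly q)"
    using decides_prog[of "Suc K" "prog K m \<phi>" "poly q" L] by auto
  then show ?thesis unfolding polynomial_time_solvable_def by blast
qed

section \<open>The certificate and the validity of the encoding as formulas\<close>

section \<open>The certificate as a formula\<close>

text \<open>A tautology built from variable 2, which is the only one that is always in
  scope.\<close>

definition Tru :: fm where "Tru = Neg (Conj (InS 2 2 0) (Neg (InS 2 2 0)))"
definition conjs :: "fm list \<Rightarrow> fm" where "conjs \<phi>s = foldr Conj \<phi>s Tru"
definition disjs :: "fm list \<Rightarrow> fm" where "disjs \<phi>s = Neg (conjs (map Neg \<phi>s))"
definition All :: "nat \<Rightarrow> fm \<Rightarrow> fm" where "All x \<phi> = Neg (Ex x (Neg \<phi>))"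
definition Imp :: "fm \<Rightarrow> fm \<Rightarrow> fm" where "Imp \<phi> \<psi> = Neg (Conj \<phi> (Neg \<psi>))"
definition Edge :: "nat \<Rightarrow> nat \<Rightarrow> fm" where "Edge x y = InS x y 2"

lemma wf_connectives [simp]:
  "wf_fm m B (conjs \<phi>s) \<longleftrightarrow> (\<forall>\<phi>\<in>set \<phi>s. wf_fm m B \<phi>)"
  "wf_fm m B (disjs \<phi>s) \<longleftrightarrow> (\<forall>\<phi>\<in>set \<phi>s. wf_fm m B \<phi>)"
  "wf_fm m B (All x \<phi>) \<longleftrightarrow> x \<notin> B \<and> 3 \<le> x \<and> x < m \<and> wf_fm m (insert x B) \<phi>"
  "wf_fm m B (Imp \<phi> \<psi>) \<longleftrightarrow> wf_fm m B \<phi> \<and> wf_fm m B \<psi>"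
  "wf_fm m B (Edge x y) \<longleftrightarrow> x \<in> insert 2 B \<and> y \<in> insert 2 B"
proof -
  show c: "wf_fm m B (conjs \<phi>s) \<longleftrightarrow> (\<forall>\<phi>\<in>set \<phi>s. wf_fm m B \<phi>)" for \<phi>s
    by (induction \<phi>s) (auto simp: conjs_def Tru_def)
  show "wf_fm m B (disjs \<phi>s) \<longleftrightarrow> (\<forall>\<phi>\<in>set \<phi>s. wf_fm m B \<phi>)" by (simp add: disjs_def c)
qed (simp_all add: All_def Imp_def Edge_def)

context store
begin

lemma holds_connectives [simp]:
  "holds e (conjs \<phi>s) \<longleftrightarrow> (\<forall>\<phi>\<in>set \<phi>s. holds e \<phi>)"
  "holds e (disjs \<phi>s) \<longleftrightarrow> (\<exists>\<phi>\<in>set \<phi>s. holds e \<phi>)"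
  "holds e (All x \<phi>) \<longleftrightarrow> (\<forall>i<n. holds (e(x := i)) \<phi>)"
  "holds e (Imp \<phi> \<psi>) \<longleftrightarrow> (holds e \<phi> \<longrightarrow> holds e \<psi>)"
proof -
  show c: "holds e (conjs \<phi>s) \<longleftrightarrow> (\<forall>\<phi>\<in>set \<phi>s. holds e \<phi>)" for \<phi>s
    by (induction \<phi>s) (auto simp: conjs_def Tru_def)
  show "holds e (disjs \<phi>s) \<longleftrightarrow> (\<exists>\<phi>\<in>set \<phi>s. holds e \<phi>)" by (simp add: disjs_def c)
qed (simp_all add: All_def Imp_def)

text \<open>A block of quantifiers amounts to the choice of one environment, which lets the whole
  certificate be treated as a single assignment \<open>e\<close>.\<close>

lemma holds_foldr_Ex:
  "distinct xs \<Longrightarrow> holds e (foldr Ex xs \<phi>) \<longleftrightarrow>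
    (\<exists>e'. (\<forall>v. v \<notin> set xs \<longrightarrow> e' v = e v) \<and> (\<forall>x\<in>set xs. e' x < n) \<and> holds e' \<phi>)"
proof (induction xs arbitrary: e)
  case Nil
  have "(\<forall>v. e' v = e v) \<longleftrightarrow> e' = e" for e' by auto
  then show ?case by simp
next
  case (Cons x xs)
  have "holds e (foldr Ex (x # xs) \<phi>) \<longleftrightarrow>
    (\<exists>i<n. \<exists>e'. (\<forall>v. v \<notin> set xs \<longrightarrow> e' v = (e(x := i)) v) \<and> (\<forall>x\<in>set xs. e' x < n) \<and> holds e' \<phi>)"
    using Cons by simp
  also have "\<dots> \<longleftrightarrow> (\<exists>e'. (\<forall>v. v \<notin> set (x # xs) \<longrightarrow> e' v = e v) \<and> (\<forall>x\<in>set (x # xs). e' x < n) \<and> holds e' \<phi>)"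
    (is "?l \<longleftrightarrow> ?r")
  proof
    assume ?l
    then obtain i e' where "i < n" "\<forall>v. v \<notin> set xs \<longrightarrow> e' v = (e(x := i)) v" "\<forall>x\<in>set xs. e' x < n" "holds e' \<phi>" by blast
    then show ?r using Cons.prems by (intro exI[of _ e']) auto
  next
    assume ?r
    then obtain e' where "\<forall>v. v \<notin> set (x # xs) \<longrightarrow> e' v = e v" "\<forall>x\<in>set (x # xs). e' x < n" "holds e' \<phi>" by blast
    then show ?l by (intro exI[of _ "e' x"] conjI exI[of _ e']) auto
  qed
  finally show ?case .
qed

end

lemma wf_foldr_Ex:
  "distinct xs \<Longrightarrow> set xs \<inter> B = {} \<Longrightarrow> set xs \<subseteq> {3..<m} \<Longrightarrow> wf_fm m (set xs \<union> B) \<phi> \<Longrightarrow> wf_fm m B (foldr Ex xs \<phi>)"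
proof (induction xs arbitrary: B)
  case (Cons x xs)
  then have "wf_fm m (insert x B) (foldr Ex xs \<phi>)" by (intro Cons.IH) auto
  then show ?case using Cons.prems by simp
qed simp

text \<open>Variable \<open>3\<close> is the pendant vertex, \<open>4, \<dots>, 9\<close> enumerate the set \<open>A0\<close> to be contracted to its
  first element, and \<open>10, \<dots>, 13\<close> are the four pairwise inseparable vertices.\<close>

definition inA :: "nat \<Rightarrow> fm" where "inA x = disjs (map (Eq x) [4..<10])"

definition inV :: "nat \<Rightarrow> fm" where
  "inV x = disjs [Eq x 4, conjs [Neg (Eq x 3), Neg (Edge 3 x), Neg (inA x)]]"

text \<open>Membership of both ends in the vertex set is part of the formula, because
  \<open>Reach\<close> walks over all numbers below \<open>n\<close>.\<close>

definition radjF :: fm where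
  "radjF = conjs [inV 16, inV 17, disjs (Edge 16 17 #
     map (\<lambda>a. Conj (Eq 16 4) (Edge a 17)) [4..<10] @ map (\<lambda>a. Conj (Eq 17 4) (Edge 16 a)) [4..<10])]"

text \<open>Variables 14 and 15 are the deleted vertices, 16 and 17 the ends of an edge, and 18
  counts rounds.\<close>

definition insepF :: "nat \<Rightarrow> nat \<Rightarrow> fm" where
  "insepF a b = All 14 (All 15 (Imp (conjs [Neg (Eq 14 a), Neg (Eq 14 b), Neg (Eq 15 a), Neg (Eq 15 b)])
     (Reach a b 16 17 18 (conjs [radjF, Neg (Eq 16 14), Neg (Eq 16 15), Neg (Eq 17 14), Neg (Eq 17 15)]))))"

definition certBody :: fm where
  "certBody = conjs (
     map (\<lambda>a. Neg (Eq 3 a)) [4..<10] @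
     map (\<lambda>a. Reach 4 a 16 17 18 (conjs [inA 16, inA 17, Edge 16 17])) [5..<10] @
     [disjs (map (Edge 3) [4..<10])] @ map inV [10..<14] @
     [Neg (Eq 10 11), Neg (Eq 10 12), Neg (Eq 10 13), Neg (Eq 11 12), Neg (Eq 11 13), Neg (Eq 12 13)] @
     [Reach 4 10 16 17 18 radjF] @
     [insepF 10 11, insepF 10 12, insepF 10 13, insepF 11 12, insepF 11 13, insepF 12 13])"

definition certF :: fm where "certF = foldr Ex [3..<14] certBody"

text \<open>The last two conditions say that nothing follows the adjacency matrix; the very last one is
  needed only for \<open>n = 0\<close>.\<close>

definition validF :: fm where
  "validF = conjs [All 19 (All 20 (conjs [Neg (InS 19 20 0), Imp (InS 19 20 2) (InS 20 19 2)])),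
     All 19 (InS 19 19 1), All 19 (InS 2 19 0), InS 2 2 0]"

lemma wf_certF: "wf_fm 21 {} (Conj validF certF)"
proof -
  have A: "wf_fm 21 B (inA x)" if "x \<in> B" "x \<notin> {4..<10}" "{4..<10} \<subseteq> B" for B x
    using that by (auto simp: inA_def)
  have V: "wf_fm 21 B (inV x)" if "x \<in> B" "x \<notin> {3..<10}" "{3..<10} \<subseteq> B" for B x
  proof -
    have "3 \<in> B" "4 \<in> B" using that(3) by auto
    moreover have "wf_fm 21 B (inA x)" using that by (intro A) auto
    ultimately show ?thesis using that by (auto simp: inV_def)
  qed
  have R: "wf_fm 21 B radjF" if "{3..<10} \<subseteq> B" "16 \<in> B" "17 \<in> B" for B
  proof -
    have "a \<in> B" if "4 \<le> a" "a < 10" for a using \<open>{3..<10} \<subseteq> B\<close> that by auto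
    moreover have "4 \<in> B" using that(1) by auto
    moreover have "wf_fm 21 B (inV 16)" "wf_fm 21 B (inV 17)" using that by (auto intro!: V)
    ultimately show ?thesis using that(2,3) by (auto simp: radjF_def)
  qed
  have I: "wf_fm 21 {3..<14} (insepF a b)" if "a \<in> {10..<14}" "b \<in> {10..<14}" for a b
  proof -
    have "{3..<10} \<subseteq> {3..<14::nat}" by auto
    then have "wf_fm 21 (insert 17 (insert 16 (insert 15 (insert 14 {3..<14})))) radjF"
      "wf_fm 21 (insert 17 (insert 16 (insert 18 (insert 15 (insert 14 {3..<14}))))) radjF"
      by (intro R subset_insertI2; simp)+
    moreover have "3 \<le> a" "a < 14" "3 \<le> b" "b < 14" using that by auto
    ultimately show ?thesis unfolding insepF_def by simp
  qed
  have "wf_fm 21 {3..<14} certBody"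
  proof -
    have "{3..<10} \<subseteq> {3..<14::nat}" "{4..<10} \<subseteq> {3..<14::nat}" by auto
    then have "wf_fm 21 (insert 17 (insert 16 {3..<14})) (inA x)" "wf_fm 21 (insert 17 (insert 16 {3..<14})) radjF"
      "wf_fm 21 (insert 17 (insert 16 (insert 18 {3..<14}))) (inA x)"
      "wf_fm 21 (insert 17 (insert 16 (insert 18 {3..<14}))) radjF" if "x = 16 \<or> x = 17" for x
      using that by (auto intro!: A R subset_insertI2)
    moreover have "wf_fm 21 {3..<14} (inV x)" if "10 \<le> x" "x < 14" for x using that by (intro V) auto
    ultimately show ?thesis using I by (auto simp: certBody_def)
  qed
  then have "wf_fm 21 {} certF" 
    unfolding certF_def using wf_foldr_Ex[of "[3..<14]" "{}" 21 certBody] by (simp del: upt_rec_numeral)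
  then show ?thesis by (simp add: validF_def)
qed

text \<open>\<open>insep\<close> quantifies over the whole type, the formula only over vertices. A
  deletion outside \<open>W\<close> is simulated by deleting a third vertex \<open>c\<close>;
  deleting more only makes reachability harder.\<close>

lemma insep_bounded:
  assumes "V \<subseteq> W" "c \<in> W" "c \<notin> {a, b}"
  shows "insep E V a b \<longleftrightarrow> (\<forall>x\<in>W. \<forall>y\<in>W. x \<notin> {a, b} \<longrightarrow> y \<notin> {a, b} \<longrightarrow> reach E (V - {x, y}) a b)"
proof
  assume r: "\<forall>x\<in>W. \<forall>y\<in>W. x \<notin> {a, b} \<longrightarrow> y \<notin> {a, b} \<longrightarrow> reach E (V - {x, y}) a b"
  show "insep E V a b"
    unfolding insep_def
  proof (intro allI impI)
    fix x y assume xy: "x \<notin> {a, b}" "y \<notin> {a, b}"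
    define g where "g z = (if z \<in> W then z else c)" for z
    have "g x \<in> W" "g y \<in> W" "g x \<notin> {a, b}" "g y \<notin> {a, b}" using xy assms by (auto simp: g_def)
    then have "reach E (V - {g x, g y}) a b" using r by blast
    then show "reach E (V - {x, y}) a b" by (rule reach_mono) (use assms(1) in \<open>auto simp: g_def\<close>)
  qed
qed (auto simp: insep_def)

text \<open>Six variables name any non-empty set of at most six vertices if \<open>r\<close> is
  repeated as padding.\<close>

lemma enumerate_6:
  fixes r :: nat
  assumes "finite A0" "card A0 \<le> 6" "r \<in> A0"
  shows "\<exists>g. g ` {4..<10::nat} = A0 \<and> g 4 = r"
proof -
  obtain xs where xs: "set xs = A0 - {r}" "distinct xs" using assms(1) finite_distinct_list by blast
  then have len: "length xs \<le> 5" using assms distinct_card[OF xs(2)] by simp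
  define g where "g k = (if 5 \<le> k \<and> k - 5 < length xs then xs ! (k - 5) else r)" for k
  have "g ` {4..<10} = A0"
  proof (intro equalityI subsetI)
    fix z assume "z \<in> g ` {4..<10}"
    then show "z \<in> A0" using xs(1) assms(3) nth_mem[of _ xs] by (auto simp: g_def split: if_splits)
  next
    fix z assume z: "z \<in> A0"
    show "z \<in> g ` {4..<10}"
    proof (cases "z = r")
      case True
      then show ?thesis by (intro image_eqI[of _ _ 4]) (auto simp: g_def)
    next
      case False
      then obtain k where "k < length xs" "xs ! k = z" using z xs(1) by (metis Diff_iff in_set_conv_nth singletonD)
      then show ?thesis using len by (intro image_eqI[of _ _ "k + 5"]) (auto simp: g_def)
    qed
  qed
  then show ?thesis by (intro exI[of _ g]) (simp add: g_def)
qed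

locale encoded = store w n K for w n K +
  fixes G :: "nat ugraph"
  assumes G: "simple_graph G" "verts G = {0..<n}"
    and sym_w: "\<And>i j. i < n \<Longrightarrow> j < n \<Longrightarrow> inp w (n + 1 + i * n + j) = 2 \<longleftrightarrow> adj G i j"
begin

sublocale fin_graph "adj G" "{0..<n}"
  using sym_graph_adj by (simp add: fin_graph_def fin_graph_axioms_def)

lemma holds_Edge [simp]: "e x < n \<Longrightarrow> e y < n \<Longrightarrow> holds e (Edge x y) \<longleftrightarrow> adj G (e x) (e y)"
  using sym_w by (simp add: Edge_def)

definition rV :: "(nat \<Rightarrow> nat) \<Rightarrow> nat set" where "rV e = rverts (e 3) (e ` {4..<10}) (e 4)"
definition rE :: "(nat \<Rightarrow> nat) \<Rightarrow> nat \<Rightarrow> nat \<Rightarrow> bool" where "rE e = radj (e ` {4..<10}) (e 4)"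

context
  fixes e :: "nat \<Rightarrow> nat"
  assumes e: "\<forall>x\<in>{3..<14}. e x < n"
begin

lemma e_less: "x \<in> {3..<14} \<Longrightarrow> e x < n"
  using e by blast

lemma holds_inA: "(\<And>v. v \<in> {3..<14} \<Longrightarrow> e' v = e v) \<Longrightarrow> holds e' (inA x) \<longleftrightarrow> e' x \<in> e ` {4..<10}"
proof -
  assume e': "\<And>v. v \<in> {3..<14} \<Longrightarrow> e' v = e v"
  have "holds e' (inA x) \<longleftrightarrow> (\<exists>a\<in>{4..<10}. e' x = e' a)" by (simp add: inA_def del: upt_rec_numeral)
  also have "\<dots> \<longleftrightarrow> (\<exists>a\<in>{4..<10}. e' x = e a)" using e' by (intro bex_cong) auto
  finally show ?thesis by (simp only: image_iff)
qed

lemma holds_inV: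
  assumes "\<And>v. v \<in> {3..<14} \<Longrightarrow> e' v = e v" "e' x < n"
  shows "holds e' (inV x) \<longleftrightarrow> e' x \<in> rV e"
proof -
  have "e' 3 = e 3" "e' 4 = e 4" "e 3 < n" using assms e_less by auto
  then show ?thesis using holds_inA[OF assms(1), of x] assms(2) by (auto simp: inV_def rV_def rverts_def)
qed

lemma rV_sub: "rV e \<subseteq> {0..<n}"
  using e_less by (auto simp: rV_def rverts_def)

lemma holds_radjF:
  assumes "\<And>v. v \<in> {3..<14} \<Longrightarrow> e' v = e v" "e' 16 < n" "e' 17 < n"
  shows "holds e' radjF \<longleftrightarrow> e' 16 \<in> rV e \<and> e' 17 \<in> rV e \<and> rE e (e' 16) (e' 17)"
proof -
  have e4: "e' 4 = e 4" using assms by auto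
  have E: "holds e' (Edge a 17) \<longleftrightarrow> adj G (e a) (e' 17)" "holds e' (Edge 16 a) \<longleftrightarrow> adj G (e' 16) (e a)"
    if "a \<in> {4..<10}" for a
    using assms(1)[of a] assms(2,3) e_less[of a] that by simp_all
  have R: "holds e' radjF \<longleftrightarrow> holds e' (inV 16) \<and> holds e' (inV 17) \<and> (holds e' (Edge 16 17) \<or>
      (\<exists>a\<in>{4..<10}. e' 16 = e' 4 \<and> holds e' (Edge a 17)) \<or> (\<exists>a\<in>{4..<10}. e' 17 = e' 4 \<and> holds e' (Edge 16 a)))"
    by (simp add: radjF_def bex_Un del: upt_rec_numeral)
  have 1: "(\<exists>a\<in>{4..<10}. e' 16 = e' 4 \<and> holds e' (Edge a 17)) \<longleftrightarrow> e' 16 = e 4 \<and> (\<exists>x\<in>e ` {4..<10}. adj G x (e' 17))"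
    unfolding e4 using E(1) by auto
  have 2: "(\<exists>a\<in>{4..<10}. e' 17 = e' 4 \<and> holds e' (Edge 16 a)) \<longleftrightarrow> e' 17 = e 4 \<and> (\<exists>x\<in>e ` {4..<10}. adj G (e' 16) x)"
    unfolding e4 using E(2) by auto
  have I: "holds e' (inV 16) \<longleftrightarrow> e' 16 \<in> rV e" "holds e' (inV 17) \<longleftrightarrow> e' 17 \<in> rV e"
    by (intro holds_inV assms; assumption)+
  show ?thesis
    unfolding R 1 2 rE_def radj_def I holds_Edge[of e' 16 17, OF assms(2,3)] by (rule refl)
qed

lemma holds_reach:
  assumes "U \<subseteq> {0..<n}" "\<And>a b. a < n \<Longrightarrow> b < n \<Longrightarrow> holds (e'(16 := a, 17 := b)) \<phi> \<longleftrightarrow> a \<in> U \<and> b \<in> U \<and> Q a b"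
  shows "holds e' (Reach x y 16 17 18 \<phi>) \<longleftrightarrow> reach Q U (e' x) (e' y)"
proof -
  have "(\<lambda>a b. a < n \<and> b < n \<and> holds (e'(16 := a, 17 := b)) \<phi>) = (\<lambda>a b. a \<in> U \<and> b \<in> U \<and> Q a b)"
  proof (intro ext)
    fix a b
    show "(a < n \<and> b < n \<and> holds (e'(16 := a, 17 := b)) \<phi>) \<longleftrightarrow> a \<in> U \<and> b \<in> U \<and> Q a b"
      using assms(1) assms(2)[of a b] by (cases "a < n \<and> b < n") auto
  qed
  then show ?thesis by (simp add: reach_def)
qed

text \<open>The vertex \<open>e c\<close> is the third vertex demanded by
  \<open>insep_bounded\<close>; another of the four inseparable vertices will supply it.\<close>

lemma holds_insepF:
  assumes "a \<in> {10..<14}" "b \<in> {10..<14}" "c \<in> {10..<14}" "e c \<notin> {e a, e b}"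
  shows "holds e (insepF a b) \<longleftrightarrow> insep (rE e) (rV e) (e a) (e b)"
proof -
  let ?\<phi> = "conjs [radjF, Neg (Eq 16 14), Neg (Eq 16 15), Neg (Eq 17 14), Neg (Eq 17 15)]"
  have r: "holds (e(14 := x, 15 := y)) (Reach a b 16 17 18 ?\<phi>) \<longleftrightarrow> reach (rE e) (rV e - {x, y}) (e a) (e b)" for x y
  proof -
    have "holds (e(14 := x, 15 := y, 16 := s, 17 := t)) radjF \<longleftrightarrow> s \<in> rV e \<and> t \<in> rV e \<and> rE e s t" if "s < n" "t < n" for s t
      using holds_radjF[of "e(14 := x, 15 := y, 16 := s, 17 := t)"] that by simp
    then have "holds (e(14 := x, 15 := y)) (Reach a b 16 17 18 ?\<phi>) \<longleftrightarrow>
        reach (rE e) (rV e - {x, y}) ((e(14 := x, 15 := y)) a) ((e(14 := x, 15 := y)) b)"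
      using rV_sub by (intro holds_reach) auto
    then show ?thesis using assms by simp
  qed
  have "holds e (insepF a b) \<longleftrightarrow> (\<forall>x\<in>{0..<n}. \<forall>y\<in>{0..<n}. x \<notin> {e a, e b} \<longrightarrow> y \<notin> {e a, e b} \<longrightarrow>
      reach (rE e) (rV e - {x, y}) (e a) (e b))"
    using assms(1,2) r by (auto simp: insepF_def)
  also have "\<dots> \<longleftrightarrow> insep (rE e) (rV e) (e a) (e b)"
    by (rule insep_bounded[symmetric, of _ _ "e c"]) (use rV_sub e_less assms in auto)
  finally show ?thesis .
qed

lemma holds_certBody:
  "holds e certBody \<longleftrightarrow> e 3 \<notin> e ` {4..<10} \<and> conn (adj G) (e ` {4..<10}) \<and> (\<exists>a\<in>e ` {4..<10}. adj G (e 3) a) \<and>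
     {e 10, e 11, e 12, e 13} \<subseteq> rV e \<and> distinct [e 10, e 11, e 12, e 13] \<and> reach (rE e) (rV e) (e 4) (e 10) \<and>
     insep (rE e) (rV e) (e 10) (e 11) \<and> insep (rE e) (rV e) (e 10) (e 12) \<and> insep (rE e) (rV e) (e 10) (e 13) \<and>
     insep (rE e) (rV e) (e 11) (e 12) \<and> insep (rE e) (rV e) (e 11) (e 13) \<and> insep (rE e) (rV e) (e 12) (e 13)"
proof -
  let ?A = "e ` {4..<10}"
  have sA: "?A \<subseteq> {0..<n}" using e_less by auto
  have set5: "{4..<10} = insert 4 {5..<10::nat}" by auto
  have "holds (e(16 := s, 17 := t)) (conjs [inA 16, inA 17, Edge 16 17]) \<longleftrightarrow> s \<in> ?A \<and> t \<in> ?A \<and> adj G s t"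
    if "s < n" "t < n" for s t
    using that holds_inA[of "e(16 := s, 17 := t)"] by simp
  then have 1: "holds e (Reach 4 a 16 17 18 (conjs [inA 16, inA 17, Edge 16 17])) \<longleftrightarrow> reach (adj G) ?A (e 4) (e a)" for a
    by (intro holds_reach[OF sA]) auto
  \<comment> \<open>Reachability from one element of \<open>A0\<close> suffices for connectedness,
    by symmetry and transitivity.\<close>
  have 2: "conn (adj G) ?A \<longleftrightarrow> (\<forall>a\<in>{5..<10}. reach (adj G) ?A (e 4) (e a))"
  proof
    assume *: "\<forall>a\<in>{5..<10}. reach (adj G) ?A (e 4) (e a)"
    have "reach (adj G) ?A (e 4) z" if "z \<in> ?A" for z
      using that * by (auto simp: set5)
    then have "reach (adj G) ?A y z" if "y \<in> ?A" "z \<in> ?A" for y z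
      using reach_trans[OF reach_sym[of ?A "e 4" y]] that by blast
    then show "conn (adj G) ?A" by (simp add: conn_def)
  qed (auto simp: conn_def)
  have 3: "holds e (Reach 4 10 16 17 18 radjF) \<longleftrightarrow> reach (rE e) (rV e) (e 4) (e 10)"
  proof (rule holds_reach[OF rV_sub])
    fix a b assume "a < n" "b < n"
    then show "holds (e(16 := a, 17 := b)) radjF \<longleftrightarrow> a \<in> rV e \<and> b \<in> rV e \<and> rE e a b"
      using holds_radjF[of "e(16 := a, 17 := b)"] by simp
  qed
  have 4: "(\<forall>a\<in>{10..<14}. holds e (inV a)) \<longleftrightarrow> {e 10, e 11, e 12, e 13} \<subseteq> rV e"
  proof -
    have s4: "{10..<14} = {10, 11, 12, 13::nat}" by auto
    show ?thesis unfolding s4 using holds_inV[of e] e_less by simp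
  qed
  have 5: "(\<exists>a\<in>{4..<10}. holds e (Edge 3 a)) \<longleftrightarrow> (\<exists>a\<in>?A. adj G (e 3) a)"
  proof -
    have "holds e (Edge 3 a) \<longleftrightarrow> adj G (e 3) (e a)" if "a \<in> {4..<10}" for a
      using e_less that by (intro holds_Edge) auto
    then show ?thesis by simp
  qed
  have 6: "(\<forall>a\<in>{4..<10}. \<not> holds e (Eq 3 a)) \<longleftrightarrow> e 3 \<notin> ?A" by auto
  have 7: "holds e (insepF 10 11) \<longleftrightarrow> insep (rE e) (rV e) (e 10) (e 11)" "holds e (insepF 10 12) \<longleftrightarrow> insep (rE e) (rV e) (e 10) (e 12)"
     "holds e (insepF 10 13) \<longleftrightarrow> insep (rE e) (rV e) (e 10) (e 13)" "holds e (insepF 11 12) \<longleftrightarrow> insep (rE e) (rV e) (e 11) (e 12)"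
     "holds e (insepF 11 13) \<longleftrightarrow> insep (rE e) (rV e) (e 11) (e 13)" "holds e (insepF 12 13) \<longleftrightarrow> insep (rE e) (rV e) (e 12) (e 13)"
    if "distinct [e 10, e 11, e 12, e 13]"
    using that holds_insepF[of 10 11 12] holds_insepF[of 10 12 11] holds_insepF[of 10 13 11]
      holds_insepF[of 11 12 10] holds_insepF[of 11 13 10] holds_insepF[of 12 13 10] by auto
  have C: "holds e certBody \<longleftrightarrow> (\<forall>a\<in>{4..<10}. \<not> holds e (Eq 3 a)) \<and>
     (\<forall>a\<in>{5..<10}. holds e (Reach 4 a 16 17 18 (conjs [inA 16, inA 17, Edge 16 17]))) \<and>
     (\<exists>a\<in>{4..<10}. holds e (Edge 3 a)) \<and> (\<forall>a\<in>{10..<14}. holds e (inV a)) \<and>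
     distinct [e 10, e 11, e 12, e 13] \<and> holds e (Reach 4 10 16 17 18 radjF) \<and>
     holds e (insepF 10 11) \<and> holds e (insepF 10 12) \<and> holds e (insepF 10 13) \<and> holds e (insepF 11 12) \<and>
     holds e (insepF 11 13) \<and> holds e (insepF 12 13)"
    unfolding certBody_def holds_connectives set_append set_map set_upt ball_Un
    by (simp del: holds.simps(6) upt_rec_numeral)
  show ?thesis
  proof (cases "distinct [e 10, e 11, e 12, e 13]")
    case True
    show ?thesis unfolding C 1 2[symmetric] 3 4 5 6 7[OF True] by (rule refl)
  qed (simp only: C simp_thms)
qed

end

lemma holds_certF: "holds (env0 n) certF \<longleftrightarrow> certified"
proof
  assume "holds (env0 n) certF"
  then obtain e where e: "\<forall>x\<in>{3..<14}. e x < n" and b: "holds e certBody"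
    
    unfolding certF_def using holds_foldr_Ex[of "[3..<14]" "env0 n" certBody]
    by (simp del: upt_rec_numeral) blast
  have e': "\<And>x. x \<in> {3..<14} \<Longrightarrow> e x < n" using e by blast
  note B = holds_certBody[OF e, THEN iffD1, OF b, unfolded rV_def rE_def]
  have "card (e ` {4..<10}) \<le> card {4..<10::nat}" by (rule card_image_le) simp
  then have "card (e ` {4..<10}) \<le> 6" by simp
  moreover have "e ` {4..<10} \<subseteq> {0..<n}" "e 3 \<in> {0..<n}" using e' by auto
  moreover have "e 4 \<in> e ` {4..<10}" by simp
  ultimately show certified using B unfolding certified_def
    by - (rule exI[of _ "e 3"], rule exI[of _ "e ` {4..<10}"], rule exI[of _ "e 4"], rule exI[of _ "e 10"],
      rule exI[of _ "e 11"], rule exI[of _ "e 12"], rule exI[of _ "e 13"], simp only: simp_thms)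
next
  assume certified
  then obtain p A0 r u1 u2 u3 u4 where c: "p \<in> {0..<n}" "A0 \<subseteq> {0..<n}" "r \<in> A0" "card A0 \<le> 6" "p \<notin> A0"
     "conn (adj G) A0" "\<exists>a\<in>A0. adj G p a"
     "{u1, u2, u3, u4} \<subseteq> rverts p A0 r" "distinct [u1, u2, u3, u4]"
     "reach (radj A0 r) (rverts p A0 r) r u1"
     "insep (radj A0 r) (rverts p A0 r) u1 u2" "insep (radj A0 r) (rverts p A0 r) u1 u3"
     "insep (radj A0 r) (rverts p A0 r) u1 u4" "insep (radj A0 r) (rverts p A0 r) u2 u3"
     "insep (radj A0 r) (rverts p A0 r) u2 u4" "insep (radj A0 r) (rverts p A0 r) u3 u4"
    unfolding certified_def by (elim exE conjE) (rule that; assumption)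
  have "finite A0" using c(2) by (rule finite_subset) simp
  then obtain g :: "nat \<Rightarrow> nat" where g: "g ` {4..<10} = A0" "g 4 = r"
    using enumerate_6[OF \<open>finite A0\<close> c(4) c(3)] by (elim exE conjE) (rule that; assumption)
  define e where "e x = (if x \<in> {4..<10} then g x else if x = 3 then p else if x = 10 then u1 else
    if x = 11 then u2 else if x = 12 then u3 else if x = 13 then u4 else env0 n x)" for x
  have "e ` {4..<10} = g ` {4..<10}" by (rule image_cong) (simp_all add: e_def)
  then have eA: "e ` {4..<10} = A0" by (simp only: g(1))
  have es: "e 3 = p" "e 4 = r" "e 10 = u1" "e 11 = u2" "e 12 = u3" "e 13 = u4" using g(2) by (simp_all add: e_def)
  have sub: "rverts p A0 r \<subseteq> {0..<n}" using c(2,3) by (auto simp: rverts_def)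
  have en: "e x < n" if "x \<in> {3..<14}" for x
  proof -
    have "x \<in> {4..<10} \<or> x = 3 \<or> x = 10 \<or> x = 11 \<or> x = 12 \<or> x = 13" using that by auto
    then show ?thesis
    proof
      assume "x \<in> {4..<10}"
      then have "e x \<in> A0" using eA by blast
      then show ?thesis using c(2) by auto
    next
      assume "x = 3 \<or> x = 10 \<or> x = 11 \<or> x = 12 \<or> x = 13"
      moreover have "{p, u1, u2, u3, u4} \<subseteq> {0..<n}" using c(1,8) sub by blast
      ultimately show ?thesis using es by auto
    qed
  qed
  have "holds e certBody" 
    by (rule holds_certBody[THEN iffD2]) (use en in blast, use c in \<open>simp only: rV_def rE_def eA es simp_thms\<close>)
  moreover have "\<forall>v. v \<notin> {3..<14} \<longrightarrow> e v = env0 n v" by (simp add: e_def)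
  ultimately have "\<exists>e'. (\<forall>v. v \<notin> set [3..<14] \<longrightarrow> e' v = env0 n v) \<and>
      (\<forall>x\<in>set [3..<14]. e' x < n) \<and> holds e' certBody"
    unfolding set_upt by (intro exI[of _ e] conjI ballI en)
  then show "holds (env0 n) certF"
    unfolding certF_def by (rule holds_foldr_Ex[THEN iffD2, OF distinct_upt])
qed

end

section \<open>The adjacency matrix on the input tape\<close>

lemma concat_rows:
  "concat (map (\<lambda>i. map (\<lambda>j. f (i * n + j)) [0..<n]) [0..<m]) = map f [0..<m * n]" for n :: nat
proof (induction m)
  case (Suc m)
  have "Suc m * n = m * n + n" by simp
  then have "map f [0..<Suc m * n] = map f [0..<m * n] @ map f [m * n..<m * n + n]"
    by (simp only: upt_add_eq_append[OF le0] map_append)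
  moreover have "map f [m * n..<m * n + n] = map (\<lambda>j. f (m * n + j)) [0..<n]"
    by (rule nth_equalityI) auto
  ultimately show ?case using Suc by simp
qed simp

lemma inp_matrix: "inp (replicate n True @ False # v) (n + 1 + k) = (if k < length v then bit_sym (v ! k) else 0)"
  by (simp add: inp_def input_tape_def nth_append)

lemma bit_sym_eq: "bit_sym b = 2 \<longleftrightarrow> b" "bit_sym b = 1 \<longleftrightarrow> \<not> b" "bit_sym b \<noteq> 0"
  by (cases b; simp)+

lemma matrix_index: "i < n \<Longrightarrow> j < n \<Longrightarrow> i * n + j < n * n" for n :: nat
proof -
  assume "i < n" "j < n"
  then have "i * n + j < i * n + n" "Suc i * n \<le> n * n" by (simp, intro mult_right_mono) auto
  then show ?thesis by simp
qed

lemma encode_graph_split: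
  assumes "verts G = {0..<n}"
  shows "\<exists>v. encode_graph G = replicate n True @ False # v \<and> length v = n * n \<and>
    (\<forall>i<n. \<forall>j<n. v ! (i * n + j) \<longleftrightarrow> adj G i j)"
proof -
  define g where "g k = adj G (k div n) (k mod n)" for k
  have "concat (map (\<lambda>i. map (\<lambda>j. adj G i j) [0..<n]) [0..<n])
      = concat (map (\<lambda>i. map (\<lambda>j. g (i * n + j)) [0..<n]) [0..<n])"
    by (intro arg_cong[where f = concat] map_cong) (auto simp: g_def)
  also have "\<dots> = map g [0..<n * n]" by (rule concat_rows)
  finally have "encode_graph G = replicate n True @ False # map g [0..<n * n]"
    using assms by (simp add: encode_graph_def)
  then show ?thesis
    by (intro exI[of _ "map g [0..<n * n]"]) (auto simp: matrix_index g_def)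
qed

context store
begin

lemma holds_validF:
  "holds (env0 n) validF \<longleftrightarrow>
    (\<forall>i<n. \<forall>j<n. inp w (n + 1 + i * n + j) \<noteq> 0 \<and>
       (inp w (n + 1 + i * n + j) = 2 \<longrightarrow> inp w (n + 1 + j * n + i) = 2)) \<and>
    (\<forall>i<n. inp w (n + 1 + i * n + i) = 1) \<and> (\<forall>i<n. inp w (n + 1 + n * n + i) = 0) \<and> inp w (n + 1 + n * n + n) = 0"
  by (simp add: validF_def env0_def)

text \<open>The formula fixes the length of the matrix and makes it symmetric with empty diagonal,
  which is exactly what is needed to read off a simple graph.\<close>

lemma encoded_if_valid:
  assumes w: "w = replicate n True @ False # v" and val: "holds (env0 n) validF"
  shows "\<exists>G. simple_graph G \<and> verts G = {0..<n} \<and> w = encode_graph G"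
proof -
  note V = val[unfolded holds_validF]
  note V1 = conjunct1[OF V] and V2 = conjunct1[OF conjunct2[OF V]] and V3 = conjunct1[OF conjunct2[OF conjunct2[OF V]]]
    and V4 = conjunct2[OF conjunct2[OF conjunct2[OF V]]]
  have i: "inp w (n + 1 + k) = (if k < length v then bit_sym (v ! k) else 0)" for k
    unfolding w by (rule inp_matrix)
  \<comment> \<open>For \<open>n > 0\<close> the matrix cell \<open>(n - 1, n - 1)\<close> is not
    blank and the next cell, read as \<open>(n, 0)\<close>, is. For \<open>n = 0\<close> the matrix
    is empty, and blankness at \<open>(n, n)\<close> shows that nothing follows the
    separator.\<close>
  have len: "length v = n * n"
  proof (cases "n = 0")
    case True
    then show ?thesis using V4 i[of 0] bit_sym_eq(3)[of "v ! 0"] by (auto split: if_splits)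
  next
    case False
    then have n0: "0 < n" by simp
    then have l: "n - 1 < n" by simp
    have "inp w (n + 1 + (n * n + 0)) = 0" using V3[THEN spec, THEN mp, OF n0] by (simp only: add.assoc)
    then have "\<not> n * n + 0 < length v" using i[of "n * n + 0"] bit_sym_eq(3)[of "v ! (n * n + 0)"] by (simp only: if_True simp_thms) metis
    moreover have "inp w (n + 1 + ((n - 1) * n + (n - 1))) \<noteq> 0"
      using V1[rule_format, OF l l, THEN conjunct1] by (simp only: add.assoc simp_thms)
    then have "(n - 1) * n + (n - 1) < length v" using i[of "(n - 1) * n + (n - 1)"] by presburger
    moreover have "Suc ((n - 1) * n + (n - 1)) = n * n" using False by (cases n) auto
    ultimately show ?thesis by linarith
  qed
  have v: "inp w (n + 1 + i * n + j) = bit_sym (v ! (i * n + j))" if "i < n" "j < n" for i j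
    using i[of "i * n + j"] matrix_index[OF that] len by (simp add: add.assoc)
  have sy: "v ! (i * n + j) \<Longrightarrow> v ! (j * n + i)" if "i < n" "j < n" for i j
    using V1[rule_format, OF that] unfolding v[OF that] v[OF that(2,1)] bit_sym_eq by blast
  have ir: "\<not> v ! (i * n + i)" if "i < n" for i
    using V2[rule_format, OF that] unfolding v[OF that that] bit_sym_eq .
  define G :: "nat ugraph" where "G = ({0..<n}, {{i, j} |i j. i < n \<and> j < n \<and> v ! (i * n + j)})"
  have a: "adj G i j \<longleftrightarrow> v ! (i * n + j)" if "i < n" "j < n" for i j
    unfolding G_def using that sy by (auto simp: doubleton_eq_iff)
  have "simple_graph G"
  proof -
    have "e \<subseteq> {0..<n} \<and> card e = 2" if "e \<in> edges G" for e
    proof -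
      obtain i j where ij: "e = {i, j}" "i < n" "j < n" "v ! (i * n + j)" using \<open>e \<in> edges G\<close> unfolding G_def by auto
      then have "i \<noteq> j" using ir by blast
      then show ?thesis using ij by simp
    qed
    then show ?thesis by (simp add: simple_graph_def G_def)
  qed
  moreover have V: "verts G = {0..<n}" by (simp add: G_def)
  moreover have "w = encode_graph G"
  proof -
    have "concat (map (\<lambda>i. map (\<lambda>j. adj G i j) [0..<n]) [0..<n])
        = concat (map (\<lambda>i. map (\<lambda>j. v ! (i * n + j)) [0..<n]) [0..<n])"
      by (intro arg_cong[where f = concat] map_cong) (auto simp: a)
    also have "\<dots> = map ((!) v) [0..<n * n]" by (rule concat_rows)
    also have "\<dots> = v" using len by (simp flip: len add: map_nth)
    finally show ?thesis unfolding w encode_graph_def V by simp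
  qed
  ultimately show ?thesis by blast
qed

lemma valid_if_encoded:
  assumes G: "simple_graph G" "verts G = {0..<n}" and w: "w = encode_graph G"
  shows "holds (env0 n) validF" "\<And>i j. i < n \<Longrightarrow> j < n \<Longrightarrow> inp w (n + 1 + i * n + j) = 2 \<longleftrightarrow> adj G i j"
proof -
  obtain v where v: "w = replicate n True @ False # v" "length v = n * n"
    "\<And>i j. i < n \<Longrightarrow> j < n \<Longrightarrow> v ! (i * n + j) \<longleftrightarrow> adj G i j"
    using encode_graph_split[OF G(2)] w by blast
  have i: "inp w (n + 1 + i * n + j) = bit_sym (adj G i j)" if "i < n" "j < n" for i j
    using inp_matrix[of n v "i * n + j"] matrix_index[OF that] v(3)[OF that] v(1,2) by (simp add: add.assoc)
  have z: "inp w (n + 1 + n * n + k) = 0" for k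
    using inp_matrix[of n v "n * n + k"] v(1,2) by (simp add: add.assoc)
  show "inp w (n + 1 + i * n + j) = 2 \<longleftrightarrow> adj G i j" if "i < n" "j < n" for i j
    using i[OF that] bit_sym_eq by simp
  have nl: "\<not> adj G a a" for a using adj_simple[OF G(1), of a a] by blast
  have sy: "adj G a b \<Longrightarrow> adj G b a" for a b by (simp add: insert_commute)
  show "holds (env0 n) validF"
    unfolding holds_validF
  proof (intro conjI allI impI)
    fix a b assume ab: "a < n" "b < n"
    show "inp w (n + 1 + a * n + b) \<noteq> 0" unfolding i[OF ab] by (rule bit_sym_eq)
    assume "inp w (n + 1 + a * n + b) = 2"
    then show "inp w (n + 1 + b * n + a) = 2" unfolding i[OF ab] i[OF ab(2,1)] bit_sym_eq by (rule sy)
  next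
    fix a assume a: "a < n"
    show "inp w (n + 1 + a * n + a) = 1" unfolding i[OF a a] bit_sym_eq by (rule nl)
  qed (rule z)+
qed

end

theorem theorem9: "polynomial_time_solvable (induced_minor_problem F1)"
proof (rule fm_polynomial_time[OF wf_certF])
  fix w
  have st: "store K" if "2 \<le> K" for K using that by (rule store.intro)
  have cert: "store.holds w n (env0 n) certF \<longleftrightarrow> contains_induced_minor G F1"
    if G: "simple_graph G" "verts G = {0..<n}" "w = encode_graph G" for n G
  proof -
    \<comment> \<open>The truth of a formula does not depend on the number of tapes, so the smallest
      admissible value 2 serves here.\<close>
    interpret encoded w n 2 G
      by unfold_locales (use G store.valid_if_encoded(2)[OF st[OF order_refl] G] in auto)
    show ?thesis using holds_certF mdl_iff_certified F1_minor_iff[OF G(1)] G(2) by simp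
  qed
  show "w \<in> induced_minor_problem F1 \<longleftrightarrow>
    (\<exists>n v. w = replicate n True @ False # v \<and> store.holds w n (env0 n) (Conj validF certF))"
  proof
    assume "w \<in> induced_minor_problem F1"
    then obtain G n where G: "simple_graph G" "verts G = {0..<n}" "w = encode_graph G" "contains_induced_minor G F1"
      unfolding induced_minor_problem_def by blast
    have "store.holds w n (env0 n) (Conj validF certF)"
      using store.valid_if_encoded(1)[OF st[OF order_refl] G(1-3)] cert[OF G(1-3)] G(4)
      by (simp add: store.holds.simps[OF st[OF order_refl]])
    then show "\<exists>n v. w = replicate n True @ False # v \<and> store.holds w n (env0 n) (Conj validF certF)"
      using encode_graph_split[OF G(2)] G(3) by blast
  next
    assume "\<exists>n v. w = replicate n True @ False # v \<and> store.holds w n (env0 n) (Conj validF certF)"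
    then obtain n v where w: "w = replicate n True @ False # v"
      and h: "store.holds w n (env0 n) validF" "store.holds w n (env0 n) certF"
      by (auto simp: store.holds.simps[OF st[OF order_refl]])
    obtain G where G: "simple_graph G" "verts G = {0..<n}" "w = encode_graph G"
      using store.encoded_if_valid[OF st[OF order_refl] w h(1)] by blast
    then show "w \<in> induced_minor_problem F1"
      using cert[OF G] h(2) unfolding induced_minor_problem_def by blast
  qed
qed simp

end
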